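(* Let $m>n$, let $A,K:[0,T]\to\mathbb{R}^{n\times n}$ and $L:[0,T]\to\mathbb{R}^{n\times(m-n)}$ be bounded measurable functions, let $G\in\mathbb{R}^{n\times n}$ be symmetric, and let $Q,R:[0,T]\to\mathbb{R}^{n\times n}$ and $N:[0,T]\to\mathbb{R}^{(m-n)\times(m-n)}$ be bounded, measurable and symmetric-matrix-valued, such that for some $\delta>0$: $G\ge0$, $Q(s)\ge0$, $R(s)\ge0$, $N(s)\ge\delta I_{m-n}$ for a.e. $s\in[0,T]$. Let $\Sigma$ be the solution of the Riccati equation in the context. Let $0\le t_0<t_1\le T$, $x_0\in L^2_{\mathcal{F}_{t_0}}(\Omega;\mathbb{R}^n)$ and $x_1\in L^2_{\mathcal{F}_{t_1}}(\Omega;\mathbb{R}^n)$. A control $(z,v)\in L^2_{\mathbb F}(t_0,t_1;\mathbb{R}^n)\times L^2_{\mathbb F}(t_0,t_1;\mathbb{R}^{m-n})$ transfers $(t_0,x_0)$ to $(t_1,x_1)$ for the system $$dx(s)=[A(s)x(s)+K(s)z(s)+L(s)v(s)]ds+z(s)dW(s)\qquad(1)$$ if and only if the control $(\hat z,\hat v)$ defined by $$\hat z(s)=z(s),\qquad \hat v(s)=\begin{pmatrix}[N(s)]^{1/2}v(s)\\ [Q(s)]^{1/2}x(s)\\ [R(s)]^{1/2}z(s)\end{pmatrix},\qquad s\in[t_0,t_1],$$ does so for the system $$d\hat x(s)=[\widehat A(s)\hat x(s)+\widehat K(s)\hat z(s)+\widehat L(s)\hat v(s)]ds+\hat z(s)dW(s),\qquad(2)$$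 where $$\widehat A=A+\Sigma Q,\quad \widehat K=K(I_n+\Sigma R)^{-1},\quad \widehat L=\big(LN^{-1/2},\,-\Sigma Q^{1/2},\,K(I_n+\Sigma R)^{-1}\Sigma R^{1/2}\big),$$ and $x$ is the solution of (1) with initial pair $(t_0,x_0)$ and control $(z,v)$.
   Context: $(\Omega,\mathcal{F},\mathbb{P})$ is a complete probability space carrying a standard one-dimensional Brownian motion $W$, and $\mathbb{F}=\{\mathcal{F}_s\}_{s\ge0}$ is the natural filtration of $W$ augmented by all $\mathbb{P}$-null sets. $L^2_{\mathcal{F}_s}(\Omega;\mathbb{R}^d)$ is the space of $\mathcal{F}_s$-measurable square-integrable $\mathbb{R}^d$-valued random variables; $L^2_{\mathbb F}(t_0,t_1;\mathbb{R}^d)$ is the space of $\mathbb{F}$-progressively measurable $u:[t_0,t_1]\times\Omega\to\mathbb{R}^d$ with $\mathbb{E}\int_{t_0}^{t_1}|u(s)|^2ds<\infty$. A control transfers $(t_0,x_0)$ to $(t_1,x_1)$ for a controlled SDE if the solution started at $x_0$ at time $t_0$ under this control equals $x_1$ at time $t_1$ almost surely. $\Sigma\in C([0,T];\mathbb{S}^n)$ ($\mathbb{S}^n$ = symmetric $n\times n$ real matrices) is the unique positive semidefinite solution (known to exist) of $$\dot\Sigma-\Sigma A^\top-A\Sigma-\Sigma Q\Sigma+LN^{-1}L^\top+K(I_n+\Sigma R)^{-1}\Sigma K^\top=0,\ s\in[0,T],\qquad \Sigma(T)=0.$$ For a positive semidefinite matrix $P$, $P^{1/2}$ is its positive semidefinite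 square root. *)

theory Defs
  imports "HOL-Probability.Probability"
begin

definition psd :: "real^'n^'n \<Rightarrow> bool" where
  "psd P \<longleftrightarrow> transpose P = P \<and> (\<forall>x. 0 \<le> x \<bullet> (P *v x))"

(* Only meaningful for positive semidefinite P, where the square root exists and is unique;
   for all other P it is one fixed unspecified matrix. *)
definition psd_sqrt :: "real^'n^'n \<Rightarrow> real^'n^'n" where
  "psd_sqrt P = (THE S. psd S \<and> S ** S = P)"

definition vec_append :: "real^'a \<Rightarrow> real^'b \<Rightarrow> real^('a + 'b)"  (infixr "@v" 65) where
  "u @v w = (\<chi> i. case i of Inl a \<Rightarrow> u $ a | Inr b \<Rightarrow> w $ b)"

definition mat_append_cols :: "real^'a^'m \<Rightarrow> real^'b^'m \<Rightarrow> real^('a + 'b)^'m"  (infixr "@c" 65) where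
  "B @c C = (\<chi> i. (B $ i) @v (C $ i))"

locale brownian_space = prob_space M + complete_measure M
  for M :: "'a measure" and W :: "real \<Rightarrow> 'a \<Rightarrow> real" +
  assumes W_measurable: "0 \<le> t \<Longrightarrow> W t \<in> borel_measurable M"
    and W_zero: "AE \<omega> in M. W 0 \<omega> = 0"
    and W_increment_normal: "0 \<le> s \<Longrightarrow> s < t \<Longrightarrow>
      distributed M lborel (\<lambda>\<omega>. W t \<omega> - W s \<omega>) (normal_density 0 (sqrt (t - s)))"
    and W_increment_indep: "0 \<le> s \<Longrightarrow> s < t \<Longrightarrow>
      indep_set {(\<lambda>\<omega>. W t \<omega> - W s \<omega>) -` B \<inter> space M | B. B \<in> sets borel}
        (sigma_sets (space M)
          {W r -` B \<inter> space M | r B. 0 \<le> r \<and> r \<le> s \<and> B \<in> sets borel})"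
    and W_continuous: "AE \<omega> in M. continuous_on {0..} (\<lambda>t. W t \<omega>)"

(* The measure of this sigma-algebra object is irrelevant (it is 0 everywhere);
   probabilities are always taken with respect to M. *)
definition aug_filtration :: "'a measure \<Rightarrow> (real \<Rightarrow> 'a \<Rightarrow> real) \<Rightarrow> real \<Rightarrow> 'a measure" where
  "aug_filtration M W s = sigma (space M)
     ({W r -` B \<inter> space M | r B. 0 \<le> r \<and> r \<le> s \<and> B \<in> sets borel} \<union> null_sets M)"

definition adapted_on ::
  "(real \<Rightarrow> 'a measure) \<Rightarrow> real \<Rightarrow> real \<Rightarrow> (real \<Rightarrow> 'a \<Rightarrow> 'b::euclidean_space) \<Rightarrow> bool" where
  "adapted_on F t0 t1 X \<longleftrightarrow> (\<forall>t\<in>{t0..t1}. X t \<in> borel_measurable (F t))"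

definition progressive_on ::
  "(real \<Rightarrow> 'a measure) \<Rightarrow> real \<Rightarrow> real \<Rightarrow> (real \<Rightarrow> 'a \<Rightarrow> 'b::euclidean_space) \<Rightarrow> bool" where
  "progressive_on F t0 t1 u \<longleftrightarrow>
     (\<forall>t\<in>{t0..t1}. (\<lambda>(s, \<omega>). u s \<omega>) \<in> borel_measurable (restrict_space borel {t0..t} \<Otimes>\<^sub>M F t))"

definition L2_rv :: "'a measure \<Rightarrow> 'a measure \<Rightarrow> ('a \<Rightarrow> 'b::euclidean_space) set" where
  "L2_rv M Fs = {\<xi>. \<xi> \<in> borel_measurable Fs \<and> integrable M (\<lambda>\<omega>. (norm (\<xi> \<omega>))\<^sup>2)}"

definition time_prob :: "'a measure \<Rightarrow> real \<Rightarrow> real \<Rightarrow> (real \<times> 'a) measure" where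
  "time_prob M t0 t1 = restrict_space lborel {t0..t1} \<Otimes>\<^sub>M M"

(* As usual for an L2 space, processes are identified when they agree outside a null set of the
   product of Lebesgue measure and M, so membership means having a progressively measurable
   version.  The distinction matters: if Q is only Lebesgue measurable, then the process Q x is
   progressively measurable only after a change of Q on a Lebesgue null set. *)
definition L2_process ::
  "'a measure \<Rightarrow> (real \<Rightarrow> 'a measure) \<Rightarrow> real \<Rightarrow> real \<Rightarrow> (real \<Rightarrow> 'a \<Rightarrow> 'b::euclidean_space) set" where
  "L2_process M F t0 t1 = {u. \<exists>u'. progressive_on F t0 t1 u' \<and>
     (\<integral>\<^sup>+ (s, \<omega>). ennreal ((norm (u' s \<omega>))\<^sup>2) \<partial>time_prob M t0 t1) < \<infinity> \<and>
     (AE (s, \<omega>) in time_prob M t0 t1. u s \<omega> = u' s \<omega>)}"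

(* The simple process attached to (k, \<tau>, \<xi>) is the sum of \<xi> i on the interval
   (\<tau> i, \<tau> (i + 1)] over i < k. *)
definition simple_data ::
  "'a measure \<Rightarrow> (real \<Rightarrow> 'a measure) \<Rightarrow> real \<Rightarrow> real \<Rightarrow>
   nat \<Rightarrow> (nat \<Rightarrow> real) \<Rightarrow> (nat \<Rightarrow> 'a \<Rightarrow> 'b::euclidean_space) \<Rightarrow> bool" where
  "simple_data M F t0 t1 k \<tau> \<xi> \<longleftrightarrow> \<tau> 0 = t0 \<and> \<tau> k = t1 \<and>
     (\<forall>i<k. \<tau> i < \<tau> (Suc i) \<and> \<xi> i \<in> borel_measurable (F (\<tau> i)) \<and> bounded (\<xi> i ` space M))"

definition simple_process ::
  "nat \<Rightarrow> (nat \<Rightarrow> real) \<Rightarrow> (nat \<Rightarrow> 'a \<Rightarrow> 'b::euclidean_space) \<Rightarrow> real \<Rightarrow> 'a \<Rightarrow> 'b" where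
  "simple_process k \<tau> \<xi> s \<omega> = (\<Sum>i<k. indicator {\<tau> i<..\<tau> (Suc i)} s *\<^sub>R \<xi> i \<omega>)"

definition simple_ito ::
  "(real \<Rightarrow> 'a \<Rightarrow> real) \<Rightarrow> nat \<Rightarrow> (nat \<Rightarrow> real) \<Rightarrow> (nat \<Rightarrow> 'a \<Rightarrow> 'b::euclidean_space) \<Rightarrow>
   real \<Rightarrow> 'a \<Rightarrow> 'b" where
  "simple_ito W k \<tau> \<xi> t \<omega> = (\<Sum>i<k. (W (min (\<tau> (Suc i)) t) \<omega> - W (min (\<tau> i) t) \<omega>) *\<^sub>R \<xi> i \<omega>)"

(* I is (a continuous version of) the process t \<mapsto> integral of z dW over [t0, t]. *)
definition has_ito_integral ::
  "'a measure \<Rightarrow> (real \<Rightarrow> 'a \<Rightarrow> real) \<Rightarrow> real \<Rightarrow> real \<Rightarrow>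
   (real \<Rightarrow> 'a \<Rightarrow> 'b::euclidean_space) \<Rightarrow> (real \<Rightarrow> 'a \<Rightarrow> 'b) \<Rightarrow> bool" where
  "has_ito_integral M W t0 t1 z I \<longleftrightarrow>
     adapted_on (aug_filtration M W) t0 t1 I \<and>
     (AE \<omega> in M. continuous_on {t0..t1} (\<lambda>t. I t \<omega>)) \<and>
     (\<exists>k \<tau> \<xi>. (\<forall>j. simple_data M (aug_filtration M W) t0 t1 (k j) (\<tau> j) (\<xi> j)) \<and>
        (\<lambda>j. \<integral>\<^sup>+ (s, \<omega>). ennreal ((norm (simple_process (k j) (\<tau> j) (\<xi> j) s \<omega> - z s \<omega>))\<^sup>2)
               \<partial>time_prob M t0 t1) \<longlonglongrightarrow> 0 \<and>
        (\<forall>t\<in>{t0..t1}.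
          (\<lambda>j. \<integral>\<^sup>+ \<omega>. ennreal ((norm (simple_ito W (k j) (\<tau> j) (\<xi> j) t \<omega> - I t \<omega>))\<^sup>2) \<partial>M)
            \<longlonglongrightarrow> 0))"

definition sde_solution ::
  "'a measure \<Rightarrow> (real \<Rightarrow> 'a \<Rightarrow> real) \<Rightarrow>
   (real \<Rightarrow> real^'n^'n) \<Rightarrow> (real \<Rightarrow> real^'n^'n) \<Rightarrow> (real \<Rightarrow> real^'k^'n) \<Rightarrow> real \<Rightarrow> real \<Rightarrow>
   ('a \<Rightarrow> real^'n) \<Rightarrow> (real \<Rightarrow> 'a \<Rightarrow> real^'n) \<Rightarrow> (real \<Rightarrow> 'a \<Rightarrow> real^'k) \<Rightarrow>
   (real \<Rightarrow> 'a \<Rightarrow> real^'n) \<Rightarrow> bool" where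
  "sde_solution M W A K L t0 t1 x0 z v x \<longleftrightarrow>
     adapted_on (aug_filtration M W) t0 t1 x \<and>
     (AE \<omega> in M. continuous_on {t0..t1} (\<lambda>s. x s \<omega>)) \<and>
     (AE \<omega> in M. set_integrable lebesgue {t0..t1}
        (\<lambda>s. A s *v x s \<omega> + K s *v z s \<omega> + L s *v v s \<omega>)) \<and>
     (\<exists>I. has_ito_integral M W t0 t1 z I \<and>
        (AE \<omega> in M. \<forall>t\<in>{t0..t1}. x t \<omega> = x0 \<omega> +
           (LINT s:{t0..t}|lebesgue. A s *v x s \<omega> + K s *v z s \<omega> + L s *v v s \<omega>) + I t \<omega>))"

(* Solutions are unique up to indistinguishability, so it does not matter which one is taken. *)
definition transfers ::
  "'a measure \<Rightarrow> (real \<Rightarrow> 'a \<Rightarrow> real) \<Rightarrow>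
   (real \<Rightarrow> real^'n^'n) \<Rightarrow> (real \<Rightarrow> real^'n^'n) \<Rightarrow> (real \<Rightarrow> real^'k^'n) \<Rightarrow>
   (real \<Rightarrow> 'a \<Rightarrow> real^'n) \<Rightarrow> (real \<Rightarrow> 'a \<Rightarrow> real^'k) \<Rightarrow>
   real \<times> ('a \<Rightarrow> real^'n) \<Rightarrow> real \<times> ('a \<Rightarrow> real^'n) \<Rightarrow> bool" where
  "transfers M W A K L z v p q \<longleftrightarrow> (case (p, q) of ((t0, x0), (t1, x1)) \<Rightarrow>
     z \<in> L2_process M (aug_filtration M W) t0 t1 \<and>
     v \<in> L2_process M (aug_filtration M W) t0 t1 \<and>
     (\<exists>x. sde_solution M W A K L t0 t1 x0 z v x \<and> (AE \<omega> in M. x t1 \<omega> = x1 \<omega>)))"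

(* The coefficients are only measurable, so the differential equation holds almost everywhere for
   an absolutely continuous \<Sigma>; this is its integrated form, with \<Sigma>(T) = 0. *)
definition riccati_solution ::
  "real \<Rightarrow> (real \<Rightarrow> real^'n^'n) \<Rightarrow> (real \<Rightarrow> real^'n^'n) \<Rightarrow> (real \<Rightarrow> real^'k^'n) \<Rightarrow>
   (real \<Rightarrow> real^'n^'n) \<Rightarrow> (real \<Rightarrow> real^'n^'n) \<Rightarrow> (real \<Rightarrow> real^'k^'k) \<Rightarrow>
   (real \<Rightarrow> real^'n^'n) \<Rightarrow> bool" where
  "riccati_solution T A K L Q R N \<Sigma> \<longleftrightarrow>
     (let rhs = (\<lambda>s. \<Sigma> s ** transpose (A s) + A s ** \<Sigma> s + \<Sigma> s ** Q s ** \<Sigma> s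
            - L s ** matrix_inv (N s) ** transpose (L s)
            - K s ** matrix_inv (mat 1 + \<Sigma> s ** R s) ** \<Sigma> s ** transpose (K s))
      in continuous_on {0..T} \<Sigma> \<and> (\<forall>s\<in>{0..T}. psd (\<Sigma> s)) \<and>
         set_integrable lebesgue {0..T} rhs \<and>
         (\<forall>t\<in>{0..T}. \<Sigma> t = - (LINT s:{t..T}|lebesgue. rhs s)))"

definition A_hat ::
  "(real \<Rightarrow> real^'n^'n) \<Rightarrow> (real \<Rightarrow> real^'n^'n) \<Rightarrow> (real \<Rightarrow> real^'n^'n) \<Rightarrow> real \<Rightarrow> real^'n^'n" where
  "A_hat A Q \<Sigma> s = A s + \<Sigma> s ** Q s"

definition K_hat ::
  "(real \<Rightarrow> real^'n^'n) \<Rightarrow> (real \<Rightarrow> real^'n^'n) \<Rightarrow> (real \<Rightarrow> real^'n^'n) \<Rightarrow> real \<Rightarrow> real^'n^'n" where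
  "K_hat K R \<Sigma> s = K s ** matrix_inv (mat 1 + \<Sigma> s ** R s)"

definition L_hat ::
  "(real \<Rightarrow> real^'n^'n) \<Rightarrow> (real \<Rightarrow> real^'k^'n) \<Rightarrow> (real \<Rightarrow> real^'n^'n) \<Rightarrow> (real \<Rightarrow> real^'n^'n) \<Rightarrow>
   (real \<Rightarrow> real^'k^'k) \<Rightarrow> (real \<Rightarrow> real^'n^'n) \<Rightarrow> real \<Rightarrow> real^('k + 'n + 'n)^'n" where
  "L_hat K L Q R N \<Sigma> s =
     (L s ** matrix_inv (psd_sqrt (N s))) @c
     (- (\<Sigma> s ** psd_sqrt (Q s))) @c
     (K s ** matrix_inv (mat 1 + \<Sigma> s ** R s) ** \<Sigma> s ** psd_sqrt (R s))"

definition v_hat ::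
  "(real \<Rightarrow> real^'n^'n) \<Rightarrow> (real \<Rightarrow> real^'n^'n) \<Rightarrow> (real \<Rightarrow> real^'k^'k) \<Rightarrow>
   (real \<Rightarrow> 'a \<Rightarrow> real^'n) \<Rightarrow> (real \<Rightarrow> 'a \<Rightarrow> real^'n) \<Rightarrow> (real \<Rightarrow> 'a \<Rightarrow> real^'k) \<Rightarrow>
   real \<Rightarrow> 'a \<Rightarrow> real^('k + 'n + 'n)" where
  "v_hat Q R N x z v s \<omega> =
     (psd_sqrt (N s) *v v s \<omega>) @v (psd_sqrt (Q s) *v x s \<omega>) @v (psd_sqrt (R s) *v z s \<omega>)"

end

theory Submission
  imports Defs
begin

text \<open>
  Since \<open>psd_sqrt P ** psd_sqrt P = P\<close>, substituting the transformed control into the second system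
  gives back the drift of the first one: the terms in \<open>Q\<close> cancel, and the terms in \<open>z\<close> combine through
  \<open>K (I + \<Sigma> R)^{-1} (I + \<Sigma> R) = K\<close>. Hence \<open>x\<close> itself solves both systems. Each of them has at
  most one solution, because stochastic integrals are unique by the isometry and the difference of two
  solutions satisfies a pathwise linear integral equation, so both transfer conditions say that
  \<open>x t1 = x1\<close> almost surely. The transformed control is square integrable because \<open>x\<close> is, by a
  pathwise energy estimate, and because the square root of a matrix is a Borel function of the matrix.
\<close>


section \<open>Square roots of positive semidefinite matrices\<close>

text \<open>In the transformed control \<open>x\<close> is a fixed process, not the state of the
  second system. A state \<open>y\<close> of that system is therefore not tied to \<open>x\<close>
  beforehand; uniqueness for the drift \<open>A_hat A Q \<Sigma> s *v y s \<omega>\<close> is what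
  forces \<open>y = x\<close>. From \<open>\<Sigma>\<close> come positivity, which makes
  \<open>mat 1 + \<Sigma> s ** R s\<close> injective, and continuity on a compact interval, which
  bounds \<open>A_hat\<close>. Three obstacles shape the rest. The root \<open>psd_sqrt\<close> is a
  definite description, so its existence, uniqueness and Borel dependence are all drawn from one
  explicit iteration. Finiteness of the second moment of \<open>x\<close> is not known in advance,
  so the energy estimate is made path by path, with deterministic constants and in the extended
  reals, and integrated only afterwards. Finally, the coefficients are Lebesgue measurable in time
  while progressive measurability is a Borel notion, and positivity holds only at almost every time,
  so processes and coefficients have to be exchanged for suitable versions.\<close>

lemma matrix_scaleR_left: "(c *\<^sub>R X) ** Y = c *\<^sub>R (X ** Y)"
  for X :: "real^'n^'m" and Y :: "real^'p^'n"
  by (simp add: matrix_matrix_mult_def vec_eq_iff sum_distrib_left ac_simps)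

lemma matrix_scaleR_right: "X ** (c *\<^sub>R Y) = c *\<^sub>R (X ** Y)"
  for X :: "real^'n^'m" and Y :: "real^'p^'n"
  by (simp add: matrix_matrix_mult_def vec_eq_iff sum_distrib_left ac_simps)

lemma matrix_add_rdistrib: "(X + X') ** Y = X ** Y + X' ** Y"
  for X :: "real^'n^'m" and Y :: "real^'p^'n"
  by (simp add: matrix_matrix_mult_def vec_eq_iff sum.distrib algebra_simps)

lemma matrix_diff_rdistrib: "(X - X') ** Y = X ** Y - X' ** Y"
  for X :: "real^'n^'m" and Y :: "real^'p^'n"
  by (simp add: matrix_matrix_mult_def vec_eq_iff sum_subtractf algebra_simps)

lemma matrix_diff_ldistrib: "X ** (Y - Y') = X ** Y - X ** Y'"
  for X :: "real^'n^'m" and Y :: "real^'p^'n"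
  by (simp add: matrix_matrix_mult_def vec_eq_iff sum_subtractf algebra_simps)

lemma psdD:
  assumes "psd P"
  shows "transpose P = P" "0 \<le> x \<bullet> (P *v x)"
  using assms by (auto simp: psd_def)

lemma inner_symmetric_matrix:
  fixes P :: "real^'n^'n"
  assumes "transpose P = P"
  shows "x \<bullet> (P *v y) = (P *v x) \<bullet> y"
  by (metis assms dot_lmul_matrix vector_transpose_matrix)

text \<open>Nonnegativity of the form along the line \<open>x + t *\<^sub>R y\<close> forces a
  nonpositive discriminant. The form may vanish at \<open>y\<close>, so \<open>b = 0\<close> is
  treated apart: an affine function of \<open>t\<close> that stays nonnegative has slope
  zero.\<close>

lemma psd_Cauchy_Schwarz:
  fixes P :: "real^'n^'n"
  assumes "psd P"
  shows "(x \<bullet> (P *v y))\<^sup>2 \<le> (x \<bullet> (P *v x)) * (y \<bullet> (P *v y))"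
proof -
  define a where "a = x \<bullet> (P *v x)"
  define m where "m = x \<bullet> (P *v y)"
  define b where "b = y \<bullet> (P *v y)"
  have q: "0 \<le> a + 2 * t * m + t\<^sup>2 * b" for t
  proof -
    have "0 \<le> (x + t *\<^sub>R y) \<bullet> (P *v (x + t *\<^sub>R y))"
      using psdD(2)[OF assms] .
    also have "\<dots> = a + 2 * t * m + t\<^sup>2 * b"
      using inner_symmetric_matrix[OF psdD(1)[OF assms], of y x]
      by (simp add: a_def m_def b_def matrix_vector_right_distrib matrix_vector_mult_scaleR
          inner_add_left inner_add_right inner_commute power2_eq_square algebra_simps)
    finally show ?thesis .
  qed
  show ?thesis
  proof (cases "b = 0")
    case True
    have "m = 0"
    proof (rule ccontr)
      assume "m \<noteq> 0"
      then show False
        \<comment> \<open>At this \<open>t\<close> the affine function \<open>a + 2 * t * m\<close>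
          takes the value -1.\<close>
        using q[of "- (a + 1) / (2 * m)"] True by (simp add: field_simps)
    qed
    then show ?thesis
      using True by (simp add: m_def b_def)
  next
    case False
    then have "b > 0"
      using psdD(2)[OF assms, of y] by (simp add: b_def)
    moreover have "0 \<le> a - m\<^sup>2 / b"
      using q[of "- m / b"] False by (simp add: power2_eq_square field_simps)
    ultimately show ?thesis
      by (simp add: a_def m_def b_def field_simps)
  qed
qed

text \<open>Cauchy-Schwarz with the test vector \<open>P *v x\<close> bounds the fourth power of
  \<open>norm (P *v x)\<close> by a multiple of \<open>x \<bullet> (P *v x)\<close>.\<close>

lemma psd_kernel:
  fixes P :: "real^'n^'n"
  assumes "psd P" "x \<bullet> (P *v x) = 0"
  shows "P *v x = 0"
  using psd_Cauchy_Schwarz[OF assms(1), of "P *v x" x] assms(2) by simp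

text \<open>With \<open>y = P *v x\<close>, Cauchy-Schwarz and the form bound give
  \<open>norm y ^ 4 \<le> (norm y)\<^sup>2 * (norm x)\<^sup>2\<close>. A bound on the quadratic form
  thus becomes a bound on the operator, without eigenvalues.\<close>

lemma psd_contraction:
  fixes P :: "real^'n^'n"
  assumes "psd P" "\<And>x. x \<bullet> (P *v x) \<le> (norm x)\<^sup>2"
  shows "norm (P *v x) \<le> norm x"
proof -
  define y where "y = P *v x"
  have "(y \<bullet> y)\<^sup>2 \<le> (y \<bullet> (P *v y)) * (x \<bullet> (P *v x))"
    using psd_Cauchy_Schwarz[OF assms(1), of y x] by (simp add: y_def)
  also have "\<dots> \<le> (norm y)\<^sup>2 * (norm x)\<^sup>2"
    by (intro mult_mono assms(2) psdD(2)[OF assms(1)]) auto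
  finally have "(norm y)\<^sup>2 * (norm y)\<^sup>2 \<le> (norm y)\<^sup>2 * (norm x)\<^sup>2"
    by (simp add: power2_norm_eq_inner power2_eq_square[of "y \<bullet> y"])
  then have "norm y = 0 \<or> (norm y)\<^sup>2 \<le> (norm x)\<^sup>2"
    by (smt (verit) mult_le_cancel_left zero_le_power2 power2_eq_square mult_eq_0_iff)
  then show ?thesis
    unfolding y_def by (auto simp: power2_le_iff_abs_le)
qed

text \<open>
  If \<open>Y = (B + Y\<^sup>2) / 2\<close>, then \<open>1 - Y\<close> is a square root of \<open>1 - B\<close>. The iteration for a contraction
  \<open>B\<close> is dominated by the scalar iteration for \<open>B = 1\<close>, which increases to \<open>1\<close>.
\<close>

fun sqrt_iter :: "real^'n^'n \<Rightarrow> nat \<Rightarrow> real^'n^'n" where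
  "sqrt_iter B 0 = 0"
| "sqrt_iter B (Suc k) = (1/2) *\<^sub>R (B + sqrt_iter B k ** sqrt_iter B k)"

fun sqrt_majorant :: "nat \<Rightarrow> real" where
  "sqrt_majorant 0 = 0"
| "sqrt_majorant (Suc k) = (1 + (sqrt_majorant k)\<^sup>2) / 2"

lemma sqrt_majorant_bounds: "0 \<le> sqrt_majorant k \<and> sqrt_majorant k \<le> 1"
proof (induction k)
  case (Suc k)
  then have "(sqrt_majorant k)\<^sup>2 \<le> 1"
    by (simp add: power_le_one)
  then show ?case by simp
qed simp

lemma sqrt_majorant_Suc: "sqrt_majorant k \<le> sqrt_majorant (Suc k)"
proof -
  have "0 \<le> (1 - sqrt_majorant k)\<^sup>2" by simp
  then show ?thesis by (simp add: power2_eq_square algebra_simps)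
qed

lemma convergent_sqrt_majorant: "convergent sqrt_majorant"
proof (rule Bseq_monoseq_convergent)
  show "Bseq sqrt_majorant"
    using sqrt_majorant_bounds by (intro BseqI'[of _ 1]) simp
  show "monoseq sqrt_majorant"
    using sqrt_majorant_Suc by (simp add: monoseq_Suc)
qed

lemma norm_sqrt_iter:
  fixes B :: "real^'n^'n"
  assumes "\<And>x. norm (B *v x) \<le> norm x"
  shows "norm (sqrt_iter B k *v x) \<le> sqrt_majorant k * norm x"
proof (induction k arbitrary: x)
  case (Suc k)
  let ?Y = "sqrt_iter B k" and ?y = "sqrt_majorant k"
  have "norm (?Y *v (?Y *v x)) \<le> ?y * norm (?Y *v x)" by (rule Suc)
  also have "\<dots> \<le> ?y * (?y * norm x)"
    using Suc sqrt_majorant_bounds by (intro mult_left_mono) auto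
  finally have "norm (B *v x + ?Y *v (?Y *v x)) \<le> norm x + ?y\<^sup>2 * norm x"
    using norm_triangle_ineq[of "B *v x" "?Y *v (?Y *v x)"] assms[of x]
    by (simp add: power2_eq_square mult.assoc)
  then show ?case
    by (simp add: scaleR_matrix_vector_assoc[symmetric] matrix_vector_mult_add_rdistrib
        matrix_vector_mul_assoc[symmetric] scaleR_add_right[symmetric] add_divide_distrib distrib_right)
qed simp

text \<open>The factorisation \<open>Z ** Z - Y ** Y = Z ** (Z - Y) + (Z - Y) ** Y\<close> asks for
  no commutation. Estimating both products by the majorant gives exactly the scalar
  \<open>z\<^sup>2 - y\<^sup>2\<close>, which is twice the next increment of the majorant, so
  nothing is lost in the induction.\<close>

lemma norm_sqrt_iter_diff:
  fixes B :: "real^'n^'n"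
  assumes "\<And>x. norm (B *v x) \<le> norm x"
  shows "norm ((sqrt_iter B (Suc k) - sqrt_iter B k) *v x)
    \<le> (sqrt_majorant (Suc k) - sqrt_majorant k) * norm x"
proof (induction k arbitrary: x)
  case 0
  then show ?case
    using assms[of x] by (simp add: scaleR_matrix_vector_assoc[symmetric])
next
  case (Suc k)
  let ?Y = "sqrt_iter B k" and ?y = "sqrt_majorant k"
  let ?Z = "sqrt_iter B (Suc k)" and ?z = "sqrt_majorant (Suc k)"
  have "sqrt_iter B (Suc (Suc k)) - ?Z = (1/2) *\<^sub>R (?Z ** ?Z - ?Y ** ?Y)"
    by (simp add: scaleR_diff_right scaleR_add_right)
  also have "?Z ** ?Z - ?Y ** ?Y = ?Z ** (?Z - ?Y) + (?Z - ?Y) ** ?Y"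
    by (simp add: matrix_diff_ldistrib matrix_diff_rdistrib del: sqrt_iter.simps)
  finally have e: "sqrt_iter B (Suc (Suc k)) - ?Z = (1/2) *\<^sub>R (?Z ** (?Z - ?Y) + (?Z - ?Y) ** ?Y)" .
  have "norm (?Z *v ((?Z - ?Y) *v x)) \<le> ?z * ((?z - ?y) * norm x)"
    by (rule order_trans[OF norm_sqrt_iter[OF assms]] mult_left_mono Suc)+
      (use sqrt_majorant_bounds in auto)
  moreover have "norm ((?Z - ?Y) *v (?Y *v x)) \<le> (?z - ?y) * (?y * norm x)"
    by (rule order_trans[OF Suc] mult_left_mono norm_sqrt_iter[OF assms])+
      (use sqrt_majorant_Suc[of k] in auto)
  ultimately have "norm (?Z *v ((?Z - ?Y) *v x) + (?Z - ?Y) *v (?Y *v x))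
      \<le> ?z * ((?z - ?y) * norm x) + (?z - ?y) * (?y * norm x)"
    by (intro norm_triangle_le add_mono)
  also have "\<dots> = (?z\<^sup>2 - ?y\<^sup>2) * norm x"
    by (simp add: power2_eq_square algebra_simps del: sqrt_majorant.simps)
  also have "\<dots> = 2 * ((sqrt_majorant (Suc (Suc k)) - ?z) * norm x)"
    unfolding sqrt_majorant.simps(2)[of "Suc k"] by (simp add: algebra_simps)
  finally show ?case
    unfolding e
    by (simp add: scaleR_matrix_vector_assoc[symmetric] matrix_vector_mult_add_rdistrib
        matrix_vector_mul_assoc[symmetric] del: sqrt_iter.simps sqrt_majorant.simps)
qed

text \<open>Each entry is a telescoping series whose terms are dominated by the increments of the
  convergent majorant. An entry is read off by applying the matrix to a unit vector, since the
  previous estimate concerns the action on vectors.\<close>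

lemma convergent_sqrt_iter:
  fixes B :: "real^'n^'n"
  assumes "\<And>x. norm (B *v x) \<le> norm x"
  shows "convergent (sqrt_iter B)"
proof -
  have entry: "convergent (\<lambda>k. sqrt_iter B k $ i $ j)" for i j
  proof -
    have entry_le: "\<bar>(sqrt_iter B (Suc k) - sqrt_iter B k) $ i $ j\<bar> \<le> sqrt_majorant (Suc k) - sqrt_majorant k" for k
    proof -
      have "(sqrt_iter B (Suc k) - sqrt_iter B k) $ i $ j
          = ((sqrt_iter B (Suc k) - sqrt_iter B k) *v axis j 1) $ i"
        by (simp add: matrix_vector_mult_basis column_def)
      also have "\<bar>\<dots>\<bar> \<le> norm ((sqrt_iter B (Suc k) - sqrt_iter B k) *v axis j 1)"
        by (rule component_le_norm_cart)
      finally show ?thesis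
        using norm_sqrt_iter_diff[OF assms, of k "axis j 1"] by (simp del: sqrt_iter.simps sqrt_majorant.simps)
    qed
    obtain l where "sqrt_majorant \<longlonglongrightarrow> l"
      using convergent_sqrt_majorant unfolding convergent_def by blast
    then have "summable (\<lambda>k. sqrt_majorant (Suc k) - sqrt_majorant k)"
      by (rule telescope_summable)
    then have "summable (\<lambda>k. (sqrt_iter B (Suc k) - sqrt_iter B k) $ i $ j)"
      by (rule summable_comparison_test'[where N = 0]) (unfold real_norm_def, rule entry_le)
    then have "convergent (\<lambda>m. \<Sum>k<m. sqrt_iter B (Suc k) $ i $ j - sqrt_iter B k $ i $ j)"
      by (simp add: summable_iff_convergent del: sqrt_iter.simps)
    then show ?thesis
      by (simp add: sum_lessThan_telescope[of "\<lambda>k. sqrt_iter B k $ i $ j"] del: sqrt_iter.simps(2))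
  qed
  have "(\<lambda>k. sqrt_iter B k) \<longlonglongrightarrow> (\<chi> i j. lim (\<lambda>k. sqrt_iter B k $ i $ j))"
    using entry by (intro vec_tendstoI) (simp add: convergent_LIMSEQ_iff)
  then show ?thesis by (auto simp: convergent_def)
qed

lemma tendsto_matrix_mul:
  fixes X :: "'b \<Rightarrow> real^'n^'m" and Y :: "'b \<Rightarrow> real^'p^'n"
  assumes "(X \<longlongrightarrow> A) F" "(Y \<longlongrightarrow> B) F"
  shows "((\<lambda>k. X k ** Y k) \<longlongrightarrow> A ** B) F"
  unfolding matrix_matrix_mult_def
  by (intro vec_tendstoI) (simp, intro tendsto_intros assms)

lemma tendsto_matrix_vector_mul:
  fixes X :: "'b \<Rightarrow> real^'n^'m"
  assumes "(X \<longlongrightarrow> A) F" "(y \<longlongrightarrow> b) F"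
  shows "((\<lambda>k. X k *v y k) \<longlongrightarrow> A *v b) F"
  unfolding matrix_vector_mult_def
  by (intro vec_tendstoI) (simp, intro tendsto_intros assms)

lemma tendsto_transpose:
  fixes X :: "'b \<Rightarrow> real^'n^'m"
  assumes "(X \<longlongrightarrow> A) F"
  shows "((\<lambda>k. transpose (X k)) \<longlongrightarrow> transpose A) F"
  unfolding transpose_def
  by (intro vec_tendstoI) (simp, intro tendsto_intros assms)

lemma transpose_scaleR: "transpose (c *\<^sub>R (X :: real^'n^'m)) = c *\<^sub>R transpose X"
  by (simp add: transpose_def vec_eq_iff)

lemma transpose_add: "transpose (X + Y :: real^'n^'m) = transpose X + transpose Y"
  by (simp add: transpose_def vec_eq_iff)

lemma transpose_diff: "transpose (X - Y :: real^'n^'m) = transpose X - transpose Y"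
  by (simp add: transpose_def vec_eq_iff)

lemma transpose_sqrt_iter: "transpose B = B \<Longrightarrow> transpose (sqrt_iter B k) = sqrt_iter B k"
proof (induction k)
  case 0
  show ?case by (simp add: transpose_def vec_eq_iff)
qed (simp add: transpose_scaleR transpose_add matrix_transpose_mul)

text \<open>The iterates are polynomials in \<open>B\<close>. In the limit this gives the
  commutation that the uniqueness of the square root rests on.\<close>

lemma sqrt_iter_commute:
  assumes "C ** B = B ** C"
  shows "C ** sqrt_iter B k = sqrt_iter B k ** C"
proof (induction k)
  case (Suc k)
  have "C ** (sqrt_iter B k ** sqrt_iter B k) = (sqrt_iter B k ** sqrt_iter B k) ** C"
    by (metis Suc matrix_mul_assoc)
  then show ?case
    using assms
    by (simp add: matrix_scaleR_left matrix_scaleR_right matrix_add_ldistrib matrix_add_rdistrib)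
qed simp

text \<open>This is the root of \<open>P\<close> obtained by normalising with \<open>c\<close>: if
  the form of \<open>P\<close> is at most \<open>c\<close> times the squared norm, then
  \<open>mat 1 - (1/c) *\<^sub>R P\<close> is a contraction and the iteration applies. The constant
  is a parameter and not computed from \<open>P\<close>, so that one function of \<open>P\<close>
  serves a whole bounded family of matrices and is visibly a limit of continuous functions.\<close>

definition scaled_sqrt :: "real \<Rightarrow> real^'n^'n \<Rightarrow> real^'n^'n" where
  "scaled_sqrt c P = sqrt c *\<^sub>R (mat 1 - lim (sqrt_iter (mat 1 - (1/c) *\<^sub>R P)))"

text \<open>Positivity of \<open>P\<close> bounds the form of \<open>B\<close> from above and the
  bound \<open>c\<close> makes \<open>B\<close> positive, so \<open>B\<close> is a contraction. The
  limit \<open>Y\<close> is then a fixed point and a contraction as well. The latter makes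
  \<open>mat 1 - Y\<close> positive; the former turns its square into \<open>mat 1 - B\<close>,
  which is \<open>(1/c) *\<^sub>R P\<close>.\<close>

lemma scaled_sqrt:
  fixes P :: "real^'n^'n"
  assumes P: "psd P" and c: "c > 0" and bound: "\<And>x. x \<bullet> (P *v x) \<le> c * (norm x)\<^sup>2"
  shows "psd (scaled_sqrt c P)" "scaled_sqrt c P ** scaled_sqrt c P = P"
    "C ** P = P ** C \<Longrightarrow> C ** scaled_sqrt c P = scaled_sqrt c P ** C"
proof -
  define B where "B = mat 1 - (1/c) *\<^sub>R P"
  define Y where "Y = lim (sqrt_iter B)"
  have Bx: "B *v x = x - (1/c) *\<^sub>R (P *v x)" for x
    by (simp add: B_def matrix_vector_mult_diff_rdistrib scaleR_matrix_vector_assoc[symmetric])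
  have xBx: "x \<bullet> (B *v x) = (norm x)\<^sup>2 - (1/c) * (x \<bullet> (P *v x))" for x
    by (simp add: Bx inner_diff_right power2_norm_eq_inner)
  have symB: "transpose B = B"
    by (simp add: B_def transpose_diff transpose_scaleR transpose_mat psdD(1)[OF P])
  have "psd B"
    unfolding psd_def using symB bound c by (auto simp: xBx field_simps)
  then have contr: "norm (B *v x) \<le> norm x" for x
    by (rule psd_contraction) (use psdD(2)[OF P] c in \<open>simp add: xBx\<close>)
  have lim: "sqrt_iter B \<longlonglongrightarrow> Y"
    unfolding Y_def using convergent_sqrt_iter[OF contr] by (simp add: convergent_LIMSEQ_iff)
  have Y: "Y = (1/2) *\<^sub>R (B + Y ** Y)"
  proof (rule LIMSEQ_unique)
    show "(\<lambda>k. sqrt_iter B (Suc k)) \<longlonglongrightarrow> Y" using lim by (rule LIMSEQ_Suc)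
    show "(\<lambda>k. sqrt_iter B (Suc k)) \<longlonglongrightarrow> (1/2) *\<^sub>R (B + Y ** Y)"
      by (simp, intro tendsto_intros tendsto_matrix_mul lim)
  qed
  have symY: "transpose Y = Y"
    using tendsto_transpose[OF lim] transpose_sqrt_iter[OF symB] lim LIMSEQ_unique by fastforce
  have contrY: "norm (Y *v x) \<le> norm x" for x
  proof (rule LIMSEQ_le_const2)
    show "(\<lambda>k. norm (sqrt_iter B k *v x)) \<longlonglongrightarrow> norm (Y *v x)"
      by (intro tendsto_intros tendsto_matrix_vector_mul lim)
    have "norm (sqrt_iter B k *v x) \<le> norm x" for k
      using norm_sqrt_iter[OF contr, of k x] sqrt_majorant_bounds[of k]
      by (meson mult_left_le_one_le norm_ge_zero order_trans)
    then show "\<exists>N. \<forall>k\<ge>N. norm (sqrt_iter B k *v x) \<le> norm x" by blast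
  qed
  have S: "scaled_sqrt c P = sqrt c *\<^sub>R (mat 1 - Y)"
    by (simp add: scaled_sqrt_def Y_def B_def)
  show "psd (scaled_sqrt c P)"
    unfolding psd_def S
  proof (intro conjI allI)
    show "transpose (sqrt c *\<^sub>R (mat 1 - Y)) = sqrt c *\<^sub>R (mat 1 - Y)"
      by (simp add: transpose_scaleR transpose_diff transpose_mat symY)
    fix x :: "real^'n"
    have "x \<bullet> (Y *v x) \<le> norm x * norm (Y *v x)" by (rule norm_cauchy_schwarz)
    also have "\<dots> \<le> norm x * norm x" by (intro mult_left_mono contrY) auto
    finally have "0 \<le> x \<bullet> ((mat 1 - Y) *v x)"
      by (simp add: matrix_vector_mult_diff_rdistrib inner_diff_right power2_norm_eq_inner[symmetric] power2_eq_square)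
    then show "0 \<le> x \<bullet> ((sqrt c *\<^sub>R (mat 1 - Y)) *v x)"
      using c by (simp add: scaleR_matrix_vector_assoc[symmetric])
  qed
  have "(mat 1 - Y) ** (mat 1 - Y) = mat 1 - 2 *\<^sub>R Y + Y ** Y"
    by (simp add: matrix_diff_ldistrib matrix_diff_rdistrib scaleR_2)
  also have "2 *\<^sub>R Y = B + Y ** Y"
    using arg_cong[OF Y, of "\<lambda>M. 2 *\<^sub>R M"] by simp
  finally have "(mat 1 - Y) ** (mat 1 - Y) = (1/c) *\<^sub>R P"
    by (simp add: B_def)
  then show "scaled_sqrt c P ** scaled_sqrt c P = P"
    using c by (simp add: S matrix_scaleR_left matrix_scaleR_right)
  assume "C ** P = P ** C"
  then have "C ** B = B ** C"
    by (simp add: B_def matrix_diff_ldistrib matrix_diff_rdistrib matrix_scaleR_left matrix_scaleR_right)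
  then have "C ** Y = Y ** C"
    using tendsto_matrix_mul[OF tendsto_const lim, of C] tendsto_matrix_mul[OF lim tendsto_const, of C]
      sqrt_iter_commute LIMSEQ_unique by fastforce
  then show "C ** scaled_sqrt c P = scaled_sqrt c P ** C"
    by (simp add: S matrix_diff_ldistrib matrix_diff_rdistrib matrix_scaleR_left matrix_scaleR_right)
qed

text \<open>
  Any psd square root \<open>S'\<close> of \<open>P\<close> commutes with \<open>P\<close>, hence with the limit \<open>S\<close> above, so that
  \<open>(S + S') (S - S') = 0\<close>.
\<close>

lemma psd_sqrt_eq_scaled_sqrt:
  fixes P :: "real^'n^'n"
  assumes P: "psd P" and c: "c > 0" and bound: "\<And>x. x \<bullet> (P *v x) \<le> c * (norm x)\<^sup>2"
  shows "psd_sqrt P = scaled_sqrt c P"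
  unfolding psd_sqrt_def
proof (rule the_equality)
  let ?S = "scaled_sqrt c P"
  note S = scaled_sqrt[OF assms]
  show "psd ?S \<and> ?S ** ?S = P" using S by blast
  fix S' assume S': "psd S' \<and> S' ** S' = P"
  then have "S' ** P = P ** S'" by (metis matrix_mul_assoc)
  then have comm: "S' ** ?S = ?S ** S'" by (rule S(3))
  have "S' *v x = ?S *v x" for x
  proof -
    define y where "y = (?S - S') *v x"
    have "(?S + S') ** (?S - S') = 0"
      using S(2) S' comm by (simp add: matrix_diff_ldistrib matrix_add_rdistrib)
    then have "(?S + S') *v y = 0"
      by (simp add: y_def matrix_vector_mul_assoc)
    then have "y \<bullet> (?S *v y) + y \<bullet> (S' *v y) = 0"
      by (simp add: matrix_vector_mult_add_rdistrib flip: inner_add_right)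
    \<comment> \<open>Two nonnegative numbers with sum zero both vanish, so \<open>y\<close> lies in
      the kernel of both roots. As \<open>y\<close> is also the image of \<open>x\<close> under the
      symmetric matrix \<open>?S - S'\<close>, moving that matrix across the inner product gives
      \<open>y \<bullet> y = 0\<close>.\<close>
    then have "y \<bullet> (?S *v y) = 0" "y \<bullet> (S' *v y) = 0"
      using psdD(2)[OF S(1), of y] psdD(2)[of S' y] S' by linarith+
    then have "(?S - S') *v y = 0"
      using psd_kernel S(1) S' by (metis matrix_vector_mult_diff_rdistrib diff_zero)
    moreover have "transpose (?S - S') = ?S - S'"
      using psdD(1)[OF S(1)] psdD(1)[of S'] S' by (simp add: transpose_diff)
    ultimately have "y \<bullet> y = 0"
      using inner_symmetric_matrix[of "?S - S'" y x] by (simp add: y_def)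
    then show ?thesis by (simp add: y_def matrix_vector_mult_diff_rdistrib)
  qed
  then show "S' = ?S" by (simp add: matrix_eq)
qed

section \<open>Matrix bounds, inverses, measurability of the root, and the drift identity\<close>

text \<open>The norm of a matrix is here the Euclidean norm of its vector of rows, that is the
  Frobenius norm; Cauchy-Schwarz in each row gives the bound.\<close>

lemma norm_matrix_vector_le:
  fixes A :: "real^'n^'m"
  shows "norm (A *v x) \<le> norm A * norm x"
proof -
  have "norm (A *v x) = L2_set (\<lambda>i. \<bar>A $ i \<bullet> x\<bar>) UNIV"
    by (simp add: norm_vec_def matrix_vector_mul_component)
  also have "\<dots> \<le> L2_set (\<lambda>i. norm x * norm (A $ i)) UNIV"
    by (intro L2_set_mono) (metis Cauchy_Schwarz_ineq2 mult.commute, simp)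
  also have "\<dots> = norm A * norm x"
    by (simp add: L2_set_right_distrib[symmetric] norm_vec_def)
  finally show ?thesis .
qed

lemma inner_matrix_vector_le:
  fixes P :: "real^'n^'n"
  shows "\<bar>x \<bullet> (P *v y)\<bar> \<le> norm P * (norm x * norm y)"
proof -
  have "\<bar>x \<bullet> (P *v y)\<bar> \<le> norm x * norm (P *v y)" by (rule Cauchy_Schwarz_ineq2)
  also have "\<dots> \<le> norm x * (norm P * norm y)"
    by (intro mult_left_mono norm_matrix_vector_le) auto
  finally show ?thesis by (simp add: ac_simps)
qed

text \<open>Every iterate is continuous in \<open>P\<close>, and \<open>lim\<close> of a sequence of
  measurable functions is measurable whatever value it takes where the sequence diverges.\<close>

lemma borel_measurable_scaled_sqrt [measurable]:
  "(scaled_sqrt c :: real^'n^'n \<Rightarrow> real^'n^'n) \<in> borel_measurable borel"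
proof -
  have "continuous_on UNIV (\<lambda>P :: real^'n^'n. sqrt_iter (mat 1 - (1/c) *\<^sub>R P) k)" for k
  proof (induction k)
    case (Suc k)
    show ?case
      using Suc unfolding continuous_on_def sqrt_iter.simps
      by (intro ballI tendsto_intros tendsto_matrix_mul) auto
  qed simp
  then have "(\<lambda>P :: real^'n^'n. sqrt_iter (mat 1 - (1/c) *\<^sub>R P) k) \<in> borel_measurable borel" for k
    by (rule borel_measurable_continuous_onI)
  then show ?thesis
    unfolding scaled_sqrt_def[abs_def]
    by (intro borel_measurable_scaleR borel_measurable_diff borel_measurable_const borel_measurable_lim_metric)
qed

text \<open>\<open>matrix_inv\<close> is a Hilbert choice and is an inverse only once invertibility
  is known; for a square matrix a trivial kernel provides it.\<close>

lemma matrix_inv_if_kernel_trivial: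
  fixes A :: "real^'n^'n"
  assumes "\<And>x. A *v x = 0 \<Longrightarrow> x = 0"
  shows "matrix_inv A ** A = mat 1"
proof -
  have "invertible A"
    using assms matrix_left_invertible_ker[of A] invertible_left_inverse[of A] by blast
  then show ?thesis
    unfolding invertible_def matrix_inv_def by (metis (mono_tags, lifting) someI_ex)
qed

lemma vec_append_inner: "(u @v w) \<bullet> (u' @v w') = u \<bullet> u' + w \<bullet> w'"
proof -
  have "(u @v w) \<bullet> (u' @v w') = (\<Sum>i\<in>UNIV <+> UNIV. (u @v w) $ i * (u' @v w') $ i)"
    by (simp add: inner_vec_def)
  also have "\<dots> = u \<bullet> u' + w \<bullet> w'"
    by (subst sum.Plus) (simp_all add: inner_vec_def vec_append_def)
  finally show ?thesis .
qed

lemma norm_vec_append: "(norm (u @v w))\<^sup>2 = (norm u)\<^sup>2 + (norm w)\<^sup>2"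
  by (simp add: power2_norm_eq_inner vec_append_inner)

lemma mat_append_cols_mult: "(B @c C) *v (u @v w) = B *v u + C *v w"
  by (simp add: vec_eq_iff matrix_vector_mul_component mat_append_cols_def vec_append_inner)

lemma borel_measurable_vec_append [measurable (raw)]:
  fixes f :: "'a \<Rightarrow> real^'n" and g :: "'a \<Rightarrow> real^'m"
  assumes "f \<in> borel_measurable M" "g \<in> borel_measurable M"
  shows "(\<lambda>x. f x @v g x) \<in> borel_measurable M"
proof (rule borel_measurable_continuous_Pair[OF assms])
  have "((\<lambda>y. fst y @v snd y) \<longlongrightarrow> fst x @v snd x) (at x)" for x :: "(real^'n) \<times> (real^'m)"
    unfolding vec_append_def
    by (intro vec_tendstoI) (auto split: sum.split intro!: tendsto_intros)
  then show "continuous_on UNIV (\<lambda>x :: (real^'n) \<times> (real^'m). fst x @v snd x)"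
    by (simp add: continuous_on_def)
qed

lemma borel_measurable_matrix_vector_mul [measurable (raw)]:
  fixes f :: "'a \<Rightarrow> real^'n^'m" and g :: "'a \<Rightarrow> real^'n"
  assumes "f \<in> borel_measurable M" "g \<in> borel_measurable M"
  shows "(\<lambda>x. f x *v g x) \<in> borel_measurable M"
proof (rule borel_measurable_continuous_Pair[OF assms])
  show "continuous_on UNIV (\<lambda>x :: (real^'n^'m) \<times> (real^'n). fst x *v snd x)"
    unfolding continuous_on_def
    by (intro ballI tendsto_matrix_vector_mul tendsto_intros)
qed

lemma psd_add:
  assumes "psd P" "psd Q"
  shows "psd (P + Q)"
  using assms by (simp add: psd_def transpose_add matrix_vector_mult_add_rdistrib inner_add_right)

lemma psd_scaleR_mat: "0 \<le> \<delta> \<Longrightarrow> psd (\<delta> *\<^sub>R mat 1)"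
  by (simp add: psd_def transpose_scaleR transpose_mat scaleR_matrix_vector_assoc[symmetric])

lemma psd_of_psd_diff:
  assumes "psd (N - \<delta> *\<^sub>R mat 1)" "0 \<le> \<delta>"
  shows "psd N"
  using psd_add[OF assms(1) psd_scaleR_mat[OF assms(2)]] by simp

text \<open>The norm bounds the quadratic form, so every \<open>c > norm P\<close> is an admissible
  normalisation; strictness gives \<open>c > 0\<close> even for \<open>P = 0\<close>. The first two
  facts take \<open>norm P + 1\<close>. The third leaves \<open>c\<close> free so that the same
  constant can be used at all times.\<close>

lemma psd_sqrt:
  fixes P :: "real^'n^'n"
  assumes "psd P"
  shows "psd (psd_sqrt P)" "psd_sqrt P ** psd_sqrt P = P"
    "norm P < c \<Longrightarrow> psd_sqrt P = scaled_sqrt c P"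
proof -
  have b: "c > 0" "x \<bullet> (P *v x) \<le> c * (norm x)\<^sup>2" if "norm P < c" for c x
  proof -
    have "x \<bullet> (P *v x) \<le> norm P * (norm x)\<^sup>2"
      using inner_matrix_vector_le[of x P x] by (simp add: power2_eq_square)
    also have "\<dots> \<le> c * (norm x)\<^sup>2"
      using that by (intro mult_right_mono) auto
    finally show "x \<bullet> (P *v x) \<le> c * (norm x)\<^sup>2" .
    show "c > 0" using that norm_ge_zero[of P] by linarith
  qed
  show "norm P < c \<Longrightarrow> psd_sqrt P = scaled_sqrt c P"
    by (rule psd_sqrt_eq_scaled_sqrt[OF assms]) (use b in auto)
  have "norm P < norm P + 1" by simp
  note b' = b[OF this]
  show "psd (psd_sqrt P)" "psd_sqrt P ** psd_sqrt P = P"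
    unfolding psd_sqrt_eq_scaled_sqrt[OF assms b'] using scaled_sqrt[OF assms b'] by blast+
qed

text \<open>By symmetry of the root the left side equals \<open>x \<bullet> (P *v x)\<close>, so the
  size of the root is controlled through \<open>P\<close> itself.\<close>

lemma norm_psd_sqrt:
  assumes "psd P"
  shows "(norm (psd_sqrt P *v x))\<^sup>2 \<le> norm P * (norm x)\<^sup>2"
proof -
  have "(norm (psd_sqrt P *v x))\<^sup>2 = x \<bullet> (P *v x)"
    using inner_symmetric_matrix[OF psdD(1)[OF psd_sqrt(1)[OF assms]], of x "psd_sqrt P *v x"]
    by (simp add: power2_norm_eq_inner matrix_vector_mul_assoc psd_sqrt(2)[OF assms])
  also have "\<dots> \<le> norm P * (norm x)\<^sup>2"
    using inner_matrix_vector_le[of x P x] by (simp add: power2_eq_square)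
  finally show ?thesis .
qed

text \<open>The kernel of the root lies in the kernel of \<open>N\<close>, which is trivial because
  the form of \<open>N\<close> is at least \<open>\<delta>\<close> times the squared norm.\<close>

lemma matrix_inv_psd_sqrt:
  fixes N :: "real^'k^'k"
  assumes "psd (N - \<delta> *\<^sub>R mat 1)" "\<delta> > 0"
  shows "matrix_inv (psd_sqrt N) ** psd_sqrt N = mat 1"
proof (rule matrix_inv_if_kernel_trivial)
  fix x assume "psd_sqrt N *v x = 0"
  then have "(psd_sqrt N ** psd_sqrt N) *v x = 0"
    by (simp flip: matrix_vector_mul_assoc)
  then have "N *v x = 0"
    using psd_sqrt(2)[OF psd_of_psd_diff[OF assms(1)]] assms(2) by simp
  then have "0 \<le> - \<delta> * (x \<bullet> x)"
    using psdD(2)[OF assms(1), of x]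
    by (simp add: matrix_vector_mult_diff_rdistrib scaleR_matrix_vector_assoc[symmetric])
  then show "x = 0"
    using assms(2) inner_ge_zero[of x] by (simp add: mult_le_0_iff order_antisym)
qed

lemma matrix_inv_one_plus_psd_mul:
  fixes P R :: "real^'n^'n"
  assumes "psd P" "psd R"
  shows "matrix_inv (mat 1 + P ** R) ** (mat 1 + P ** R) = mat 1"
proof (rule matrix_inv_if_kernel_trivial)
  fix x assume "(mat 1 + P ** R) *v x = 0"
  then have x: "x = - (P *v (R *v x))"
    by (simp add: matrix_vector_mult_add_rdistrib matrix_vector_mul_assoc eq_neg_iff_add_eq_0)
  have "x \<bullet> (R *v x) = - ((R *v x) \<bullet> (P *v (R *v x)))"
    by (metis x inner_commute inner_minus_left)
  then have "x \<bullet> (R *v x) = 0"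
    using psdD(2)[OF assms(1), of "R *v x"] psdD(2)[OF assms(2), of x] by linarith
  then have "R *v x = 0" by (rule psd_kernel[OF assms(2)])
  then show "x = 0" using x by simp
qed

text \<open>Pure algebra at one time \<open>s\<close>, for arbitrary processes \<open>x\<close>,
  \<open>z\<close> and \<open>v\<close>. It can therefore be applied at almost every time with an
  exceptional set that does not depend on \<open>\<omega>\<close>.\<close>

lemma drift_hat_eq:
  fixes A K Q R \<Sigma> :: "real \<Rightarrow> real^'n^'n" and L :: "real \<Rightarrow> real^'k^'n"
    and N :: "real \<Rightarrow> real^'k^'k"
  assumes "psd (\<Sigma> s)" "psd (Q s)" "psd (R s)" "psd (N s - \<delta> *\<^sub>R mat 1)" "\<delta> > 0"
  shows "A_hat A Q \<Sigma> s *v x s \<omega> + K_hat K R \<Sigma> s *v z s \<omega>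
      + L_hat K L Q R N \<Sigma> s *v v_hat Q R N x z v s \<omega>
    = A s *v x s \<omega> + K s *v z s \<omega> + L s *v v s \<omega>"
proof -
  let ?J = "matrix_inv (mat 1 + \<Sigma> s ** R s)"
  have "L s ** matrix_inv (psd_sqrt (N s)) ** psd_sqrt (N s) = L s"
    by (simp add: matrix_inv_psd_sqrt[OF assms(4,5)] flip: matrix_mul_assoc)
  moreover have "\<Sigma> s ** psd_sqrt (Q s) ** psd_sqrt (Q s) = \<Sigma> s ** Q s"
    by (simp add: psd_sqrt(2)[OF assms(2)] flip: matrix_mul_assoc)
  moreover have "K s ** ?J ** \<Sigma> s ** psd_sqrt (R s) ** psd_sqrt (R s) = K s ** ?J ** (\<Sigma> s ** R s)"
    by (simp add: psd_sqrt(2)[OF assms(3)] flip: matrix_mul_assoc)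
  moreover have "K s ** ?J + K s ** ?J ** (\<Sigma> s ** R s) = K s"
    using matrix_inv_one_plus_psd_mul[OF assms(1,3)]
    by (metis matrix_add_ldistrib matrix_mul_assoc matrix_mul_rid)
  then have "(K s ** ?J) *v z s \<omega> + (K s ** ?J ** (\<Sigma> s ** R s)) *v z s \<omega> = K s *v z s \<omega>"
    by (metis matrix_vector_mult_add_rdistrib)
  moreover have "(- X) ** Y = - (X ** Y)" "(- X) *v y = - (X *v y)" for X Y :: "real^'n^'n" and y
    using matrix_diff_rdistrib[of 0 X Y] matrix_vector_mult_diff_rdistrib[of 0 X y] by simp_all
  ultimately show ?thesis
    by (simp add: A_hat_def K_hat_def L_hat_def v_hat_def mat_append_cols_mult matrix_vector_mul_assoc
        matrix_vector_mult_add_rdistrib)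
qed

section \<open>The isometry for stochastic integrals of simple processes\<close>

text \<open>A squared substitute for the triangle inequality in L2. It stays within the extended
  nonnegative integrals, where no root and no integrability have to be discussed, and the factors 2
  are harmless in limits and in bounds.\<close>

lemma nn_integral_norm_diff_sq:
  fixes f g h :: "'a \<Rightarrow> 'b::euclidean_space"
  assumes [measurable]: "f \<in> borel_measurable M" "g \<in> borel_measurable M" "h \<in> borel_measurable M"
  shows "(\<integral>\<^sup>+x. ennreal ((norm (f x - h x))\<^sup>2) \<partial>M)
    \<le> 2 * (\<integral>\<^sup>+x. ennreal ((norm (f x - g x))\<^sup>2) \<partial>M) + 2 * (\<integral>\<^sup>+x. ennreal ((norm (g x - h x))\<^sup>2) \<partial>M)"
proof -
  have "(norm (u - w))\<^sup>2 \<le> 2 * (norm (u - v))\<^sup>2 + 2 * (norm (v - w))\<^sup>2" for u v w :: 'b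
  proof -
    have "norm (u - w) \<le> norm (u - v) + norm (v - w)" by norm
    then have "(norm (u - w))\<^sup>2 \<le> (norm (u - v) + norm (v - w))\<^sup>2" by (intro power_mono) auto
    also have "\<dots> \<le> 2 * (norm (u - v))\<^sup>2 + 2 * (norm (v - w))\<^sup>2"
      using zero_le_power2[of "norm (u - v) - norm (v - w)"] by (simp add: power2_eq_square algebra_simps)
    finally show ?thesis .
  qed
  then have "(\<integral>\<^sup>+x. ennreal ((norm (f x - h x))\<^sup>2) \<partial>M)
      \<le> (\<integral>\<^sup>+x. 2 * ennreal ((norm (f x - g x))\<^sup>2) + 2 * ennreal ((norm (g x - h x))\<^sup>2) \<partial>M)"
    by (intro nn_integral_mono) (simp add: ennreal_leI flip: ennreal_numeral ennreal_mult ennreal_plus)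
  also have "\<dots> = 2 * (\<integral>\<^sup>+x. ennreal ((norm (f x - g x))\<^sup>2) \<partial>M) + 2 * (\<integral>\<^sup>+x. ennreal ((norm (g x - h x))\<^sup>2) \<partial>M)"
    by (simp add: nn_integral_add nn_integral_cmult)
  finally show ?thesis .
qed

context brownian_space
begin

section \<open>The augmented filtration and the independence of increments\<close>

abbreviation "F \<equiv> aug_filtration M W"

text \<open>The raw history up to time \<open>s\<close>. Independence of increments is assumed over
  the sigma-algebra it generates, whereas \<open>F s\<close> contains the null sets as well.\<close>

definition W_events :: "real \<Rightarrow> 'a set set" where
  "W_events s = {W r -` B \<inter> space M | r B. 0 \<le> r \<and> r \<le> s \<and> B \<in> sets borel}"

lemma F_generator_subset:
  "W_events s \<subseteq> sets M"
  using W_measurable by (auto simp: W_events_def intro: measurable_sets)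

lemma F_generator_Pow:
  "W_events s \<union> null_sets M \<subseteq> Pow (space M)"
  using F_generator_subset[of s] sets.space_closed[of M] null_setsD2[of _ M] by blast

lemma space_F [simp]: "space (F s) = space M"
  unfolding aug_filtration_def W_events_def[symmetric] by (rule space_measure_of[OF F_generator_Pow])

lemma sets_F:
  "sets (F s) = sigma_sets (space M)
     (W_events s \<union> null_sets M)"
  unfolding aug_filtration_def W_events_def[symmetric] by (rule sets_measure_of[OF F_generator_Pow])

lemma sets_F_subset: "sets (F s) \<subseteq> sets M"
  unfolding sets_F
  using F_generator_subset[of s] null_setsD2[of _ M] by (intro sets.sigma_sets_subset) blast

lemma sets_F_mono: "s \<le> t \<Longrightarrow> sets (F s) \<subseteq> sets (F t)"
  unfolding sets_F W_events_def
  by (intro sigma_sets_mono' Un_mono order_refl Collect_mono impI)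
    (elim exE conjE, rule exI, rule exI, intro conjI, assumption, assumption, erule (1) order_trans)

lemma null_sets_F: "E \<in> null_sets M \<Longrightarrow> E \<in> sets (F s)"
  unfolding sets_F by auto

lemma F_measurable_mono: "f \<in> borel_measurable (F s) \<Longrightarrow> s \<le> t \<Longrightarrow> f \<in> borel_measurable (F t)"
  using sets_F_mono[of s t] by (auto simp: measurable_def)

lemma F_measurable_M: "f \<in> borel_measurable (F s) \<Longrightarrow> f \<in> borel_measurable M"
  using sets_F_subset[of s] by (auto simp: measurable_def)

lemma W_F_measurable: "0 \<le> r \<Longrightarrow> r \<le> s \<Longrightarrow> W r \<in> borel_measurable (F s)"
  by (rule measurableI) (auto simp: sets_F W_events_def)

text \<open>The sets that agree almost everywhere with a raw event form a sigma-algebra containing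
  the raw generators and all null sets. For unions, countably many exceptional null sets are merged
  into one.\<close>

lemma F_set_AE_eq:
  assumes "E \<in> sets (F s)"
  shows "\<exists>E'\<in>sigma_sets (space M) (W_events s).
    AE \<omega> in M. \<omega> \<in> E \<longleftrightarrow> \<omega> \<in> E'"
  using assms unfolding sets_F
proof (induction rule: sigma_sets.induct)
  case (Basic E)
  show ?case
  proof (cases "E \<in> null_sets M")
    case True
    then have "AE \<omega> in M. \<omega> \<in> E \<longleftrightarrow> \<omega> \<in> {}"
      using AE_not_in by fastforce
    then show ?thesis using sigma_sets.Empty by blast
  next
    case False
    then show ?thesis using Basic by (intro bexI[of _ E]) (auto intro!: sigma_sets.Basic)
  qed
next
  case Empty
  then show ?case using sigma_sets.Empty by fastforce
next
  case (Compl E)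
  then obtain E' where E': "E' \<in> sigma_sets (space M) (W_events s)"
    "AE \<omega> in M. \<omega> \<in> E \<longleftrightarrow> \<omega> \<in> E'" by blast
  then have "AE \<omega> in M. \<omega> \<in> space M - E \<longleftrightarrow> \<omega> \<in> space M - E'" by auto
  then show ?case using sigma_sets.Compl[OF E'(1)] by blast
next
  case (Union E)
  then have "\<forall>i::nat. \<exists>E'. E' \<in> sigma_sets (space M) (W_events s) \<and> (AE \<omega> in M. \<omega> \<in> E i \<longleftrightarrow> \<omega> \<in> E')"
    by blast
  then obtain E' where E': "\<And>i. E' i \<in> sigma_sets (space M) (W_events s)"
    "\<And>i. AE \<omega> in M. \<omega> \<in> E i \<longleftrightarrow> \<omega> \<in> E' i"
    unfolding choice_iff by blast
  then have "AE \<omega> in M. \<forall>i. \<omega> \<in> E i \<longleftrightarrow> \<omega> \<in> E' i" by (simp add: AE_all_countable)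
  then have "AE \<omega> in M. \<omega> \<in> (\<Union>i. E i) \<longleftrightarrow> \<omega> \<in> (\<Union>i. E' i)" by eventually_elim auto
  then show ?case using sigma_sets.Union[of E', OF E'(1)] by blast
qed

text \<open>Replacing an event of \<open>F s\<close> by a raw event that agrees with it almost
  everywhere changes no probability, so independence carries over from the raw history to the
  augmented one.\<close>

lemma indep_var_increment:
  assumes s: "0 \<le> s" "s < t" and \<zeta>: "\<zeta> \<in> borel_measurable (F s)"
  shows "indep_var borel (\<lambda>\<omega>. W t \<omega> - W s \<omega>) borel \<zeta>"
proof -
  define D where "D = (\<lambda>\<omega>. W t \<omega> - W s \<omega>)"
  have D [measurable]: "D \<in> borel_measurable M"
    unfolding D_def using s by (intro borel_measurable_diff W_measurable) auto
  note indep = W_increment_indep[OF s, folded D_def W_events_def, unfolded indep_sets2_eq]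
  have "indep_set {D -` B \<inter> space M | B. B \<in> sets borel} {\<zeta> -` B \<inter> space M | B. B \<in> sets borel}"
    unfolding indep_sets2_eq
  proof (intro conjI ballI)
    show "{D -` B \<inter> space M | B. B \<in> sets borel} \<subseteq> events"
      by auto
    show "{\<zeta> -` B \<inter> space M | B. B \<in> sets borel} \<subseteq> events"
      using F_measurable_M[OF \<zeta>] by auto
    fix a e assume a: "a \<in> {D -` B \<inter> space M | B. B \<in> sets borel}"
      and "e \<in> {\<zeta> -` B \<inter> space M | B. B \<in> sets borel}"
    then have e: "e \<in> sets (F s)" using measurable_sets[OF \<zeta>] by auto
    obtain e' where e': "e' \<in> sigma_sets (space M) (W_events s)"
      "AE \<omega> in M. \<omega> \<in> e \<longleftrightarrow> \<omega> \<in> e'" using F_set_AE_eq[OF e] by blast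
    have ev: "a \<in> events" "e \<in> events" "e' \<in> events"
      using a e e' sets_F_subset indep by auto
    have "prob (a \<inter> e) = prob (a \<inter> e')"
      using e'(2) by (intro finite_measure_eq_AE sets.Int ev) (auto elim: eventually_mono)
    also have "\<dots> = prob a * prob e'" using indep a e'(1) by blast
    also have "prob e' = prob e"
      using e'(2) by (intro finite_measure_eq_AE ev) (auto elim: eventually_mono)
    finally show "prob (a \<inter> e) = prob a * prob e" .
  qed
  moreover have "Int_stable {X -` B \<inter> space M | B. B \<in> sets borel}" for X :: "'a \<Rightarrow> real"
  proof (rule Int_stableI, clarify)
    fix B C :: "real set" assume "B \<in> sets borel" "C \<in> sets borel"
    then show "\<exists>Ba. X -` B \<inter> space M \<inter> (X -` C \<inter> space M) = X -` Ba \<inter> space M \<and> Ba \<in> sets borel"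
      by (intro exI[of _ "B \<inter> C"]) auto
  qed
  ultimately show ?thesis
    unfolding indep_var_eq D_def[symmetric] using D F_measurable_M[OF \<zeta>]
    by (intro conjI indep_set_sigma_sets) auto
qed

lemma increment_moments:
  assumes "0 \<le> s" "s < t"
  shows "integrable M (\<lambda>\<omega>. W t \<omega> - W s \<omega>)" "expectation (\<lambda>\<omega>. W t \<omega> - W s \<omega>) = 0"
    "integrable M (\<lambda>\<omega>. (W t \<omega> - W s \<omega>)\<^sup>2)" "expectation (\<lambda>\<omega>. (W t \<omega> - W s \<omega>)\<^sup>2) = t - s"
proof -
  have \<sigma>: "sqrt (t - s) > 0" using assms by simp
  note D = W_increment_normal[OF assms]
  show "expectation (\<lambda>\<omega>. W t \<omega> - W s \<omega>) = 0"
    by (rule normal_distributed_expectation[OF \<sigma> D])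
  then show "expectation (\<lambda>\<omega>. (W t \<omega> - W s \<omega>)\<^sup>2) = t - s"
    using normal_distributed_variance[OF \<sigma> D] assms by simp
  show "integrable M (\<lambda>\<omega>. W t \<omega> - W s \<omega>)"
    using distributed_integrable[OF D, of "\<lambda>x. x"] integrable_normal_moment[OF \<sigma>, of 0 1] by simp
  show "integrable M (\<lambda>\<omega>. (W t \<omega> - W s \<omega>)\<^sup>2)"
    using distributed_integrable[OF D, of "\<lambda>x. x\<^sup>2"] integrable_normal_moment[OF \<sigma>, of 0 2] by simp
qed

text \<open>Independence factorises both expectations: the first is the martingale property of
  \<open>W\<close>, the second its quadratic variation. The case \<open>s = t\<close> is apart
  because the normal law of an increment is assumed for \<open>s < t\<close> only.\<close>

lemma increment_mult:
  assumes "0 \<le> s" "s \<le> t" and \<zeta>: "\<zeta> \<in> borel_measurable (F s)" "integrable M \<zeta>"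
  shows "integrable M (\<lambda>\<omega>. (W t \<omega> - W s \<omega>) * \<zeta> \<omega>)"
    "expectation (\<lambda>\<omega>. (W t \<omega> - W s \<omega>) * \<zeta> \<omega>) = 0"
    "integrable M (\<lambda>\<omega>. (W t \<omega> - W s \<omega>)\<^sup>2 * \<zeta> \<omega>)"
    "expectation (\<lambda>\<omega>. (W t \<omega> - W s \<omega>)\<^sup>2 * \<zeta> \<omega>) = (t - s) * expectation \<zeta>"
proof -
  have "integrable M (\<lambda>\<omega>. (W t \<omega> - W s \<omega>) * \<zeta> \<omega>) \<and>
    expectation (\<lambda>\<omega>. (W t \<omega> - W s \<omega>) * \<zeta> \<omega>) = 0 \<and>
    integrable M (\<lambda>\<omega>. (W t \<omega> - W s \<omega>)\<^sup>2 * \<zeta> \<omega>) \<and>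
    expectation (\<lambda>\<omega>. (W t \<omega> - W s \<omega>)\<^sup>2 * \<zeta> \<omega>) = (t - s) * expectation \<zeta>"
  proof (cases "s = t")
    case False
    then have st: "0 \<le> s" "s < t" using assms by auto
    note mom = increment_moments[OF st]
    note i1 = indep_var_increment[OF st \<zeta>(1)]
    have "indep_var borel ((\<lambda>x. x\<^sup>2) \<circ> (\<lambda>\<omega>. W t \<omega> - W s \<omega>)) borel ((\<lambda>x. x) \<circ> \<zeta>)"
      by (rule indep_var_compose[OF i1]) simp_all
    then have i2: "indep_var borel (\<lambda>\<omega>. (W t \<omega> - W s \<omega>)\<^sup>2) borel \<zeta>"
      by (simp add: comp_def)
    show ?thesis
      unfolding indep_var_lebesgue_integral[OF i1 mom(1) \<zeta>(2)] indep_var_lebesgue_integral[OF i2 mom(3) \<zeta>(2)]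
        mom(2,4)
      using indep_var_integrable[OF i1 mom(1) \<zeta>(2)] indep_var_integrable[OF i2 mom(3) \<zeta>(2)] by auto
  qed simp
  then show "integrable M (\<lambda>\<omega>. (W t \<omega> - W s \<omega>) * \<zeta> \<omega>)"
    "expectation (\<lambda>\<omega>. (W t \<omega> - W s \<omega>) * \<zeta> \<omega>) = 0"
    "integrable M (\<lambda>\<omega>. (W t \<omega> - W s \<omega>)\<^sup>2 * \<zeta> \<omega>)"
    "expectation (\<lambda>\<omega>. (W t \<omega> - W s \<omega>)\<^sup>2 * \<zeta> \<omega>) = (t - s) * expectation \<zeta>"
    by auto
qed

lemma increment_mult_measurable:
  assumes "0 \<le> a" "a \<le> b" "b \<le> c" "\<zeta> \<in> borel_measurable (F c)"
  shows "(\<lambda>\<omega>. (W b \<omega> - W a \<omega>) * \<zeta> \<omega>) \<in> borel_measurable (F c)"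
  using assms by (intro borel_measurable_times borel_measurable_diff W_F_measurable) auto

text \<open>The longer increment is cut at \<open>b\<close>. The common part contributes the square,
  with factor \<open>b - c\<close>; the increment over \<open>[b, d]\<close> is multiplied by
  something known at time \<open>b\<close> and has mean zero.\<close>

lemma increment_square_overlap:
  assumes "0 \<le> c" "c \<le> b" "b \<le> d" and \<zeta>: "\<zeta> \<in> borel_measurable (F c)" "integrable M \<zeta>"
  shows "has_bochner_integral M (\<lambda>\<omega>. (W b \<omega> - W c \<omega>) * (W d \<omega> - W c \<omega>) * \<zeta> \<omega>) ((b - c) * expectation \<zeta>)"
proof -
  note inc = increment_mult[OF assms(1,2) \<zeta>]
  have "(\<lambda>\<omega>. (W b \<omega> - W c \<omega>) * \<zeta> \<omega>) \<in> borel_measurable (F b)"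
    using assms F_measurable_mono[OF \<zeta>(1) assms(2)] by (intro increment_mult_measurable) auto
  then have inc2: "integrable M (\<lambda>\<omega>. (W d \<omega> - W b \<omega>) * ((W b \<omega> - W c \<omega>) * \<zeta> \<omega>))"
    "expectation (\<lambda>\<omega>. (W d \<omega> - W b \<omega>) * ((W b \<omega> - W c \<omega>) * \<zeta> \<omega>)) = 0"
    using assms inc(1) by (auto intro!: increment_mult)
  have "has_bochner_integral M (\<lambda>\<omega>. (W b \<omega> - W c \<omega>)\<^sup>2 * \<zeta> \<omega> + (W d \<omega> - W b \<omega>) * ((W b \<omega> - W c \<omega>) * \<zeta> \<omega>))
    ((b - c) * expectation \<zeta> + 0)"
    using inc inc2 by (intro has_bochner_integral_add) (auto simp: has_bochner_integral_iff)
  then show ?thesis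
    by (simp add: power2_eq_square algebra_simps)
qed

text \<open>The increment over \<open>[a, b]\<close> is cut at \<open>c\<close>. Whatever lies
  before \<open>c\<close> is known when the other increment starts and contributes zero; what lies
  after \<open>c\<close> starts together with it, as in the preceding lemma. Boundedness of
  \<open>\<zeta>\<close> keeps its products with earlier increments integrable. The factor is the
  length of the overlap of the two intervals.\<close>

lemma increment_overlap_aux:
  assumes "0 \<le> a" "a \<le> b" "a \<le> c" "c \<le> d"
    and \<zeta>: "\<zeta> \<in> borel_measurable (F c)" "bounded (\<zeta> ` space M)"
  shows "has_bochner_integral M (\<lambda>\<omega>. (W b \<omega> - W a \<omega>) * (W d \<omega> - W c \<omega>) * \<zeta> \<omega>)
    (max 0 (min b d - max a c) * expectation \<zeta>)"
proof -
  have \<zeta>_int: "integrable M \<zeta>"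
  proof -
    obtain B where "\<And>\<omega>. \<omega> \<in> space M \<Longrightarrow> norm (\<zeta> \<omega>) \<le> B"
      using \<zeta>(2) by (auto simp: bounded_iff)
    then show ?thesis
      by (intro integrable_const_bound[of _ B] F_measurable_M[OF \<zeta>(1)] AE_I2)
  qed
  have before: "has_bochner_integral M (\<lambda>\<omega>. (W u \<omega> - W a \<omega>) * (W d \<omega> - W c \<omega>) * \<zeta> \<omega>) 0"
    if u: "a \<le> u" "u \<le> c" for u
  proof -
    have m: "(\<lambda>\<omega>. (W u \<omega> - W a \<omega>) * \<zeta> \<omega>) \<in> borel_measurable (F c)"
      using assms u by (intro increment_mult_measurable) auto
    obtain B where B: "\<And>\<omega>. \<omega> \<in> space M \<Longrightarrow> norm (\<zeta> \<omega>) \<le> B"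
      using \<zeta>(2) by (auto simp: bounded_iff)
    have "integrable M (\<lambda>\<omega>. (W u \<omega> - W a \<omega>) * B)"
      by (cases "a = u") (use increment_moments(1)[of a u] assms u in auto)
    then have "integrable M (\<lambda>\<omega>. (W u \<omega> - W a \<omega>) * \<zeta> \<omega>)"
    proof (rule Bochner_Integration.integrable_bound)
      show "(\<lambda>\<omega>. (W u \<omega> - W a \<omega>) * \<zeta> \<omega>) \<in> borel_measurable M"
        by (rule F_measurable_M[OF m])
      show "AE \<omega> in M. norm ((W u \<omega> - W a \<omega>) * \<zeta> \<omega>) \<le> norm ((W u \<omega> - W a \<omega>) * B)"
        using B by (intro AE_I2) (fastforce simp: abs_mult intro: mult_left_mono)
    qed
    note inc = increment_mult[OF _ assms(4) m this]
    have "has_bochner_integral M (\<lambda>\<omega>. (W d \<omega> - W c \<omega>) * ((W u \<omega> - W a \<omega>) * \<zeta> \<omega>)) 0"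
      using inc(1,2) assms by (auto simp: has_bochner_integral_iff)
    then show ?thesis by (simp add: ac_simps)
  qed
  show ?thesis
  proof (cases "b \<le> c")
    case True
    then have "max 0 (min b d - max a c) = 0" using assms by auto
    then show ?thesis using before[OF assms(2) True] by simp
  next
    case False
    have "has_bochner_integral M (\<lambda>\<omega>. (W b \<omega> - W c \<omega>) * (W d \<omega> - W c \<omega>) * \<zeta> \<omega>)
        ((min b d - c) * expectation \<zeta>)"
    proof (cases "b \<le> d")
      case True
      then show ?thesis using increment_square_overlap[of c b d \<zeta>] assms False \<zeta>_int by simp
    next
      case False
      then show ?thesis using increment_square_overlap[of c d b \<zeta>] assms \<zeta>_int
        by (simp add: mult.commute[of "W b _ - W c _"])
    qed
    from has_bochner_integral_add[OF this before[of c]]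
    have "has_bochner_integral M (\<lambda>\<omega>. (W b \<omega> - W a \<omega>) * (W d \<omega> - W c \<omega>) * \<zeta> \<omega>)
        ((min b d - c) * expectation \<zeta>)"
      using assms by (simp add: algebra_simps)
    then show ?thesis using False assms by (simp add: max_def)
  qed
qed

text \<open>The product \<open>\<xi> \<omega> \<bullet> \<eta> \<omega>\<close> is known at the
  later of the two left endpoints. The statement is symmetric in the two intervals, so the interval
  with that endpoint can be taken as \<open>[c, d]\<close>.\<close>

lemma increment_overlap:
  fixes \<xi> \<eta> :: "'a \<Rightarrow> 'b::euclidean_space"
  assumes "0 \<le> a" "a \<le> b" "0 \<le> c" "c \<le> d"
    and \<xi>: "\<xi> \<in> borel_measurable (F a)" "bounded (\<xi> ` space M)"
    and \<eta>: "\<eta> \<in> borel_measurable (F c)" "bounded (\<eta> ` space M)"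
  shows "has_bochner_integral M (\<lambda>\<omega>. (W b \<omega> - W a \<omega>) * (W d \<omega> - W c \<omega>) * (\<xi> \<omega> \<bullet> \<eta> \<omega>))
    (max 0 (min b d - max a c) * expectation (\<lambda>\<omega>. \<xi> \<omega> \<bullet> \<eta> \<omega>))"
proof -
  have bdd: "bounded ((\<lambda>\<omega>. \<xi> \<omega> \<bullet> \<eta> \<omega>) ` space M)"
  proof -
    obtain B C where "\<And>\<omega>. \<omega> \<in> space M \<Longrightarrow> norm (\<xi> \<omega>) \<le> B" "\<And>\<omega>. \<omega> \<in> space M \<Longrightarrow> norm (\<eta> \<omega>) \<le> C"
      using \<xi>(2) \<eta>(2) by (auto simp: bounded_iff)
    then have "norm (\<xi> \<omega> \<bullet> \<eta> \<omega>) \<le> B * C" if "\<omega> \<in> space M" for \<omega>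
      using that by (smt (verit) Cauchy_Schwarz_ineq2 mult_mono norm_ge_zero real_norm_def)
    then show ?thesis unfolding bounded_iff by blast
  qed
  show ?thesis
  proof (cases "a \<le> c")
    case True
    then have "(\<lambda>\<omega>. \<xi> \<omega> \<bullet> \<eta> \<omega>) \<in> borel_measurable (F c)"
      using F_measurable_mono[OF \<xi>(1) True] \<eta>(1) by (intro borel_measurable_inner)
    from increment_overlap_aux[OF assms(1,2) True assms(4) this bdd] show ?thesis .
  next
    case False
    then have "(\<lambda>\<omega>. \<xi> \<omega> \<bullet> \<eta> \<omega>) \<in> borel_measurable (F a)"
      using F_measurable_mono[OF \<eta>(1)] \<xi>(1) by (intro borel_measurable_inner) auto
    from increment_overlap_aux[OF assms(3,4) _ assms(2) this bdd] False show ?thesis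
      by (simp add: min.commute max.commute mult.commute[of "W d _ - W c _"])
  qed
qed

text \<open>The counterpart in time of the preceding expectation: the same overlap length appears,
  so the two sides of the isometry can be compared coefficient by coefficient.\<close>

lemma overlap_integral:
  "has_bochner_integral lborel (\<lambda>s. indicator {a<..b} s * indicator {c<..d} s)
    (max 0 (min b d - max a c :: real))"
proof -
  have "(\<lambda>s. indicator {a<..b} s * indicator {c<..d} s :: real) = indicator {max a c<..min b d}"
    by (auto simp: indicator_def fun_eq_iff)
  moreover have "measure lborel {max a c<..min b d} = max 0 (min b d - max a c)"
    by (cases "max a c \<le> min b d") (auto simp: max_def min_def)
  ultimately show ?thesis
    using has_bochner_integral_real_indicator[of "{max a c<..min b d}" lborel]
    by (cases "max a c \<le> min b d") (auto simp: emeasure_lborel_Ioc)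
qed

text \<open>Both squared norms expand into double sums over pairs of indices with the overlap length
  as coefficient. The intervals may overlap arbitrarily; this lets the difference of two simple
  processes be treated without a common refinement of their partitions.\<close>

lemma ito_isometry_family:
  fixes \<xi> :: "'p \<Rightarrow> 'a \<Rightarrow> 'b::euclidean_space"
  assumes P: "finite P"
    and ab: "\<And>p. p \<in> P \<Longrightarrow> 0 \<le> a p \<and> a p \<le> b p"
    and \<xi>: "\<And>p. p \<in> P \<Longrightarrow> \<xi> p \<in> borel_measurable (F (a p))" "\<And>p. p \<in> P \<Longrightarrow> bounded (\<xi> p ` space M)"
  shows "(\<integral>\<^sup>+\<omega>. ennreal ((norm (\<Sum>p\<in>P. (W (b p) \<omega> - W (a p) \<omega>) *\<^sub>R \<xi> p \<omega>))\<^sup>2) \<partial>M)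
    = (\<integral>\<^sup>+\<omega>. (\<integral>\<^sup>+s. ennreal ((norm (\<Sum>p\<in>P. indicator {a p<..b p} s *\<^sub>R \<xi> p \<omega>))\<^sup>2) \<partial>lborel) \<partial>M)"
proof -
  define ov where "ov p q = max 0 (min (b p) (b q) - max (a p) (a q))" for p q
  have sq: "(norm (\<Sum>p\<in>P. c p *\<^sub>R y p))\<^sup>2 = (\<Sum>p\<in>P. \<Sum>q\<in>P. c p * c q * (y p \<bullet> y q))"
    for c and y :: "'p \<Rightarrow> 'b"
    by (simp add: power2_norm_eq_inner inner_sum_left inner_sum_right sum_distrib_left inner_commute ac_simps)
  have inner_int: "integrable M (\<lambda>\<omega>. \<xi> p \<omega> \<bullet> \<xi> q \<omega>)" if pq: "p \<in> P" "q \<in> P" for p q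
  proof -
    obtain B C where "\<And>\<omega>. \<omega> \<in> space M \<Longrightarrow> norm (\<xi> p \<omega>) \<le> B" "\<And>\<omega>. \<omega> \<in> space M \<Longrightarrow> norm (\<xi> q \<omega>) \<le> C"
      using \<xi>(2)[OF pq(1)] \<xi>(2)[OF pq(2)] by (auto simp: bounded_iff)
    then have "norm (\<xi> p \<omega> \<bullet> \<xi> q \<omega>) \<le> B * C" if "\<omega> \<in> space M" for \<omega>
      using that by (smt (verit) Cauchy_Schwarz_ineq2 mult_mono norm_ge_zero real_norm_def)
    then show ?thesis
      by (intro integrable_const_bound[of _ "B * C"] borel_measurable_inner F_measurable_M[OF \<xi>(1)] pq AE_I2)
  qed
  have "has_bochner_integral M (\<lambda>\<omega>. (norm (\<Sum>p\<in>P. (W (b p) \<omega> - W (a p) \<omega>) *\<^sub>R \<xi> p \<omega>))\<^sup>2)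
      (\<Sum>p\<in>P. \<Sum>q\<in>P. ov p q * expectation (\<lambda>\<omega>. \<xi> p \<omega> \<bullet> \<xi> q \<omega>))"
    unfolding sq ov_def
    using ab \<xi> by (intro has_bochner_integral_sum increment_overlap) auto
  then have "(\<integral>\<^sup>+\<omega>. ennreal ((norm (\<Sum>p\<in>P. (W (b p) \<omega> - W (a p) \<omega>) *\<^sub>R \<xi> p \<omega>))\<^sup>2) \<partial>M)
      = ennreal (\<Sum>p\<in>P. \<Sum>q\<in>P. ov p q * expectation (\<lambda>\<omega>. \<xi> p \<omega> \<bullet> \<xi> q \<omega>))"
    by (intro nn_integral_eq_integral[THEN trans]) (auto simp: has_bochner_integral_iff)
  moreover have pt: "(\<integral>\<^sup>+s. ennreal ((norm (\<Sum>p\<in>P. indicator {a p<..b p} s *\<^sub>R \<xi> p \<omega>))\<^sup>2) \<partial>lborel)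
      = ennreal (\<Sum>p\<in>P. \<Sum>q\<in>P. ov p q * (\<xi> p \<omega> \<bullet> \<xi> q \<omega>))"
    and pt_nonneg: "0 \<le> (\<Sum>p\<in>P. \<Sum>q\<in>P. ov p q * (\<xi> p \<omega> \<bullet> \<xi> q \<omega>))" for \<omega>
  proof -
    have h: "has_bochner_integral lborel (\<lambda>s. (norm (\<Sum>p\<in>P. indicator {a p<..b p} s *\<^sub>R \<xi> p \<omega>))\<^sup>2)
      (\<Sum>p\<in>P. \<Sum>q\<in>P. ov p q * (\<xi> p \<omega> \<bullet> \<xi> q \<omega>))"
      unfolding sq ov_def
      by (intro has_bochner_integral_sum has_bochner_integral_mult_left overlap_integral)
    then show "(\<integral>\<^sup>+s. ennreal ((norm (\<Sum>p\<in>P. indicator {a p<..b p} s *\<^sub>R \<xi> p \<omega>))\<^sup>2) \<partial>lborel)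
      = ennreal (\<Sum>p\<in>P. \<Sum>q\<in>P. ov p q * (\<xi> p \<omega> \<bullet> \<xi> q \<omega>))"
      by (intro nn_integral_eq_integral[THEN trans]) (auto simp: has_bochner_integral_iff)
    show "0 \<le> (\<Sum>p\<in>P. \<Sum>q\<in>P. ov p q * (\<xi> p \<omega> \<bullet> \<xi> q \<omega>))"
      unfolding has_bochner_integral_integral_eq[OF h, symmetric]
      by (rule Bochner_Integration.integral_nonneg) simp
  qed
  moreover have "(\<integral>\<^sup>+\<omega>. ennreal (\<Sum>p\<in>P. \<Sum>q\<in>P. ov p q * (\<xi> p \<omega> \<bullet> \<xi> q \<omega>)) \<partial>M)
      = ennreal (\<Sum>p\<in>P. \<Sum>q\<in>P. ov p q * expectation (\<lambda>\<omega>. \<xi> p \<omega> \<bullet> \<xi> q \<omega>))"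
    using inner_int pt_nonneg
    by (subst nn_integral_eq_integral)
      (auto intro!: Bochner_Integration.integrable_sum simp: Bochner_Integration.integral_sum)
  ultimately show ?thesis by simp
qed


section \<open>Simple processes on the product of time and probability space\<close>

lemma simple_data_bounds:
  assumes "simple_data M F t0 t1 k \<tau> \<xi>" "i \<le> k"
  shows "t0 \<le> \<tau> i" "\<tau> i \<le> t1"
proof -
  have step: "\<tau> j \<le> \<tau> (Suc j)" if "j < k" for j
    using assms that by (auto simp: simple_data_def less_imp_le)
  have "j \<le> k \<Longrightarrow> \<tau> 0 \<le> \<tau> j" for j
  proof (induction j)
    case (Suc j)
    then show ?case using step[of j] by simp
  qed simp
  then show "t0 \<le> \<tau> i" using assms by (auto simp: simple_data_def)
  have "\<tau> i \<le> \<tau> k" using assms(2)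
  proof (induction rule: inc_induct)
    case (step n)
    then show ?case using \<open>\<And>j. j < k \<Longrightarrow> \<tau> j \<le> \<tau> (Suc j)\<close>[of n] by simp
  qed simp
  then show "\<tau> i \<le> t1" using assms by (auto simp: simple_data_def)
qed

lemma sigma_finite_restrict_lborel: "sigma_finite_measure (restrict_space lborel {t0..t1::real})"
  by (rule sigma_finite_measure_restrict_space) (simp_all add: lborel.sigma_finite_measure_axioms)

lemma pair_sigma_finite_time: "pair_sigma_finite (restrict_space lborel {t0..t1::real}) M"
  by (intro pair_sigma_finite.intro sigma_finite_restrict_lborel sigma_finite_measure_axioms)

lemma simple_process_measurable:
  fixes \<xi> :: "nat \<Rightarrow> 'a \<Rightarrow> 'b::euclidean_space"
  assumes "simple_data M F t0 t1 k \<tau> \<xi>"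
  shows "(\<lambda>p. simple_process k \<tau> \<xi> (fst p) (snd p)) \<in> borel_measurable (time_prob M t0 t1)"
proof -
  have "(\<lambda>p. \<xi> i (snd p)) \<in> borel_measurable (time_prob M t0 t1)" if "i < k" for i
    using assms that unfolding time_prob_def simple_data_def
    by (intro measurable_compose[OF measurable_snd] F_measurable_M) auto
  moreover have "(\<lambda>p. indicator {\<tau> i<..\<tau> (Suc i)} (fst p) :: real) \<in> borel_measurable (time_prob M t0 t1)" for i
    unfolding time_prob_def
    by (intro measurable_compose[OF measurable_fst] measurable_restrict_space1) simp
  ultimately show ?thesis
    unfolding simple_process_def by (intro borel_measurable_sum borel_measurable_scaleR) auto
qed

lemma simple_ito_measurable:
  fixes \<xi> :: "nat \<Rightarrow> 'a \<Rightarrow> 'b::euclidean_space"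
  assumes "simple_data M F t0 t1 k \<tau> \<xi>" "0 \<le> t0" "t0 \<le> t"
  shows "simple_ito W k \<tau> \<xi> t \<in> borel_measurable M"
proof -
  have "\<xi> i \<in> borel_measurable M" if "i < k" for i
    using assms that by (auto simp: simple_data_def intro: F_measurable_M)
  moreover have "W (min (\<tau> i) t) \<in> borel_measurable M" if "i \<le> k" for i
    using simple_data_bounds[OF assms(1) that] assms by (intro W_measurable) auto
  ultimately show ?thesis
    unfolding simple_ito_def[abs_def]
    by (intro borel_measurable_sum borel_measurable_scaleR borel_measurable_diff) auto
qed

text \<open>Both processes are read as one family over the disjoint sum of their index sets, the
  second with reversed sign, and all intervals are clipped at \<open>t\<close>. The isometry then
  gives the integral over times up to \<open>t\<close>; extending it to the whole of
  \<open>[t0, t1]\<close> makes this an inequality.\<close>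

lemma simple_ito_diff_le:
  fixes \<xi> \<eta> :: "nat \<Rightarrow> 'a \<Rightarrow> 'b::euclidean_space"
  assumes d1: "simple_data M F t0 t1 k \<tau> \<xi>" and d2: "simple_data M F t0 t1 l \<rho> \<eta>"
    and t: "0 \<le> t0" "t0 \<le> t" "t \<le> t1"
  shows "(\<integral>\<^sup>+\<omega>. ennreal ((norm (simple_ito W k \<tau> \<xi> t \<omega> - simple_ito W l \<rho> \<eta> t \<omega>))\<^sup>2) \<partial>M)
    \<le> (\<integral>\<^sup>+(s, \<omega>). ennreal ((norm (simple_process k \<tau> \<xi> s \<omega> - simple_process l \<rho> \<eta> s \<omega>))\<^sup>2) \<partial>time_prob M t0 t1)"
proof -
  define P where "P = {..<k} <+> {..<l}"
  define a where "a = case_sum (\<lambda>i. min (\<tau> i) t) (\<lambda>i. min (\<rho> i) t)"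
  define b where "b = case_sum (\<lambda>i. min (\<tau> (Suc i)) t) (\<lambda>i. min (\<rho> (Suc i)) t)"
  \<comment> \<open>If \<open>\<tau> i > t\<close>, the clipped interval starts at \<open>t\<close>,
    where \<open>\<xi> i\<close> need not be measurable. The interval is then empty and its
    increment zero, so the coefficient may be set to zero there.\<close>
  define \<theta> where "\<theta> = case_sum (\<lambda>i \<omega>. if \<tau> i \<le> t then \<xi> i \<omega> else 0) (\<lambda>i \<omega>. if \<rho> i \<le> t then - \<eta> i \<omega> else 0)"
  have P: "finite P" by (simp add: P_def)
  have ab: "0 \<le> a p \<and> a p \<le> b p" if "p \<in> P" for p
    using that simple_data_bounds[OF d1, of "projl p"] simple_data_bounds[OF d2, of "projr p"] d1 d2 t
    by (auto simp: P_def a_def b_def simple_data_def min_def less_imp_le)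
  have meas: "\<theta> p \<in> borel_measurable (F (a p))" if "p \<in> P" for p
  proof -
    have "(\<lambda>\<omega>. if c \<le> t then f \<omega> else 0) \<in> borel_measurable (F (min c t))"
      if "f \<in> borel_measurable (F c)" for c and f :: "'a \<Rightarrow> 'b"
      using that by (cases "c \<le> t") (auto simp: min_def)
    then show ?thesis
      using that d1 d2 by (auto simp: P_def a_def \<theta>_def simple_data_def)
  qed
  have bdd: "bounded (\<theta> p ` space M)" if "p \<in> P" for p
  proof -
    have "bounded ((\<lambda>\<omega>. - \<eta> i \<omega>) ` space M)" if "i < l" for i
      using that d2 by (simp add: simple_data_def bounded_iff)
    moreover have "bounded ((\<lambda>\<omega>. 0 :: 'b) ` space M)"
      by (rule bounded_subset[of "{0}"]) auto
    ultimately show ?thesis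
      using that d1 d2 by (auto simp: P_def \<theta>_def simple_data_def)
  qed
  have ito: "(\<Sum>p\<in>P. (W (b p) \<omega> - W (a p) \<omega>) *\<^sub>R \<theta> p \<omega>)
      = simple_ito W k \<tau> \<xi> t \<omega> - simple_ito W l \<rho> \<eta> t \<omega>" for \<omega>
  proof -
    have e1: "(W (min (\<tau> (Suc i)) t) \<omega> - W (min (\<tau> i) t) \<omega>) *\<^sub>R (if \<tau> i \<le> t then \<xi> i \<omega> else 0)
      = (W (min (\<tau> (Suc i)) t) \<omega> - W (min (\<tau> i) t) \<omega>) *\<^sub>R \<xi> i \<omega>" if "i < k" for i
    proof -
      have "\<tau> i < \<tau> (Suc i)" using d1 that by (auto simp: simple_data_def)
      then show ?thesis by (auto simp: min_def)
    qed
    have e2: "(W (min (\<rho> (Suc i)) t) \<omega> - W (min (\<rho> i) t) \<omega>) *\<^sub>R (if \<rho> i \<le> t then - \<eta> i \<omega> else 0)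
      = - ((W (min (\<rho> (Suc i)) t) \<omega> - W (min (\<rho> i) t) \<omega>) *\<^sub>R \<eta> i \<omega>)" if "i < l" for i
    proof -
      have "\<rho> i < \<rho> (Suc i)" using d2 that by (auto simp: simple_data_def)
      then show ?thesis by (auto simp: min_def)
    qed
    have "(\<Sum>p\<in>P. (W (b p) \<omega> - W (a p) \<omega>) *\<^sub>R \<theta> p \<omega>)
      = (\<Sum>i<k. (W (min (\<tau> (Suc i)) t) \<omega> - W (min (\<tau> i) t) \<omega>) *\<^sub>R (if \<tau> i \<le> t then \<xi> i \<omega> else 0))
      + (\<Sum>i<l. (W (min (\<rho> (Suc i)) t) \<omega> - W (min (\<rho> i) t) \<omega>) *\<^sub>R (if \<rho> i \<le> t then - \<eta> i \<omega> else 0))"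
      unfolding P_def by (subst sum.Plus) (simp_all add: a_def b_def \<theta>_def)
    also have "\<dots> = (\<Sum>i<k. (W (min (\<tau> (Suc i)) t) \<omega> - W (min (\<tau> i) t) \<omega>) *\<^sub>R \<xi> i \<omega>)
      + (\<Sum>i<l. - ((W (min (\<rho> (Suc i)) t) \<omega> - W (min (\<rho> i) t) \<omega>) *\<^sub>R \<eta> i \<omega>))"
      by (intro arg_cong2[where f = "(+)"] sum.cong refl e1 e2) simp_all
    finally show ?thesis by (simp add: simple_ito_def sum_negf)
  qed
  have proc: "(\<Sum>p\<in>P. indicator {a p<..b p} s *\<^sub>R \<theta> p \<omega>)
      = indicator {..t} s *\<^sub>R (simple_process k \<tau> \<xi> s \<omega> - simple_process l \<rho> \<eta> s \<omega>)" for s \<omega>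
  proof -
    have cut: "indicator {min u t<..min v t} s *\<^sub>R (if u \<le> t then y else 0)
      = indicator {..t} s *\<^sub>R indicator {u<..v} s *\<^sub>R y" for u v and y :: 'b
      by (auto simp: indicator_def min_def)
    have "(\<Sum>p\<in>P. indicator {a p<..b p} s *\<^sub>R \<theta> p \<omega>)
      = (\<Sum>i<k. indicator {min (\<tau> i) t<..min (\<tau> (Suc i)) t} s *\<^sub>R (if \<tau> i \<le> t then \<xi> i \<omega> else 0))
      + (\<Sum>i<l. indicator {min (\<rho> i) t<..min (\<rho> (Suc i)) t} s *\<^sub>R (if \<rho> i \<le> t then - \<eta> i \<omega> else 0))"
      unfolding P_def by (subst sum.Plus) (simp_all only: a_def b_def \<theta>_def sum.case finite_lessThan comp_def)
    then show ?thesis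
      unfolding simple_process_def cut
      by (simp only: scaleR_add_right scaleR_sum_right scaleR_minus_right sum_negf diff_conv_add_uminus)
  qed
  \<comment> \<open>All partition points lie in \<open>[t0, t1]\<close>, so the integral over the
    whole line is one over the time interval of \<open>time_prob\<close>.\<close>
  have outside: "simple_process k \<tau> \<xi> s \<omega> - simple_process l \<rho> \<eta> s \<omega> = 0" if "s \<notin> {t0..t1}" for s \<omega>
  proof -
    have "s \<notin> {\<tau> i<..\<tau> (Suc i)}" if "i < k" for i
      using simple_data_bounds[OF d1, of i] simple_data_bounds[OF d1, of "Suc i"] that \<open>s \<notin> {t0..t1}\<close> by auto
    moreover have "s \<notin> {\<rho> i<..\<rho> (Suc i)}" if "i < l" for i
      using simple_data_bounds[OF d2, of i] simple_data_bounds[OF d2, of "Suc i"] that \<open>s \<notin> {t0..t1}\<close> by auto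
    ultimately show ?thesis
      by (simp add: simple_process_def)
  qed
  interpret TP: pair_sigma_finite "restrict_space lborel {t0..t1}" M by (rule pair_sigma_finite_time)
  have "(\<integral>\<^sup>+\<omega>. ennreal ((norm (simple_ito W k \<tau> \<xi> t \<omega> - simple_ito W l \<rho> \<eta> t \<omega>))\<^sup>2) \<partial>M)
    = (\<integral>\<^sup>+\<omega>. (\<integral>\<^sup>+s. ennreal ((norm (indicator {..t} s *\<^sub>R (simple_process k \<tau> \<xi> s \<omega> - simple_process l \<rho> \<eta> s \<omega>)))\<^sup>2) \<partial>lborel) \<partial>M)"
    unfolding ito[symmetric] proc[symmetric] by (rule ito_isometry_family[OF P ab meas bdd])
  also have "\<dots> \<le> (\<integral>\<^sup>+\<omega>. (\<integral>\<^sup>+s. ennreal ((norm (simple_process k \<tau> \<xi> s \<omega> - simple_process l \<rho> \<eta> s \<omega>))\<^sup>2)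
      * indicator {t0..t1} s \<partial>lborel) \<partial>M)"
    using outside by (intro nn_integral_mono) (auto simp: indicator_def)
  also have "\<dots> = (\<integral>\<^sup>+\<omega>. (\<integral>\<^sup>+s. ennreal ((norm (simple_process k \<tau> \<xi> s \<omega> - simple_process l \<rho> \<eta> s \<omega>))\<^sup>2)
      \<partial>restrict_space lborel {t0..t1}) \<partial>M)"
    by (simp add: nn_integral_restrict_space)
  also have "\<dots> = (\<integral>\<^sup>+p. ennreal ((norm (simple_process k \<tau> \<xi> (fst p) (snd p) - simple_process l \<rho> \<eta> (fst p) (snd p)))\<^sup>2)
      \<partial>time_prob M t0 t1)"
    using simple_process_measurable[OF d1] simple_process_measurable[OF d2] unfolding time_prob_def
    by (subst TP.nn_integral_snd[symmetric]) simp_all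
  finally show ?thesis by (simp add: case_prod_unfold)
qed

lemma progressive_time_prob_measurable:
  fixes u :: "real \<Rightarrow> 'a \<Rightarrow> 'b::euclidean_space"
  assumes "progressive_on F t0 t1 u" "t0 \<le> t1"
  shows "(\<lambda>p. u (fst p) (snd p)) \<in> borel_measurable (time_prob M t0 t1)"
proof -
  have u: "(\<lambda>(s, \<omega>). u s \<omega>) \<in> borel_measurable (restrict_space borel {t0..t1} \<Otimes>\<^sub>M F t1)"
    using assms by (auto simp: progressive_on_def)
  have "(\<lambda>p. (fst p, snd p)) \<in> measurable (time_prob M t0 t1) (restrict_space borel {t0..t1} \<Otimes>\<^sub>M F t1)"
    unfolding time_prob_def
  proof (rule measurable_Pair)
    show "fst \<in> restrict_space lborel {t0..t1} \<Otimes>\<^sub>M M \<rightarrow>\<^sub>M restrict_space borel {t0..t1}"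
      using measurable_fst[of "restrict_space lborel {t0..t1}" M]
        measurable_cong_sets[OF refl, of "restrict_space lborel {t0..t1}" "restrict_space borel {t0..t1}"]
      by (simp add: sets_restrict_space)
    show "snd \<in> restrict_space lborel {t0..t1} \<Otimes>\<^sub>M M \<rightarrow>\<^sub>M F t1"
      using sets_F_subset[of t1] sets.sets_into_space[of _ "F t1"]
      by (intro measurable_compose[OF measurable_snd, where g = "\<lambda>x. x"]) (auto simp: measurable_def Int_absorb2)
  qed
  from measurable_compose[OF this u] show ?thesis by (simp add: case_prod_unfold)
qed

text \<open>Pathwise arguments need the order "almost every \<open>\<omega>\<close>, then almost
  every \<open>s\<close>", opposite to the order of the factors. The property \<open>P\<close> need
  not be measurable, so it is a measurable null set covering the exceptions that is carried over to
  the swapped product.\<close>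

lemma AE_time_prob_swap:
  assumes "AE p in time_prob M t0 t1. P (fst p) (snd p)"
  shows "AE \<omega> in M. AE s in lborel. s \<in> {t0..t1} \<longrightarrow> P s \<omega>"
proof -
  interpret TP: pair_sigma_finite "restrict_space lborel {t0..t1}" M by (rule pair_sigma_finite_time)
  interpret TP': pair_sigma_finite M "restrict_space lborel {t0..t1}" ..
  have "AE p in M \<Otimes>\<^sub>M restrict_space lborel {t0..t1}. P (snd p) (fst p)"
  proof -
    obtain E where E: "{p \<in> space (time_prob M t0 t1). \<not> P (fst p) (snd p)} \<subseteq> E"
      "emeasure (time_prob M t0 t1) E = 0" "E \<in> sets (time_prob M t0 t1)"
      using AE_E[OF assms] by blast
    have swap: "(\<lambda>(x, y). (y, x)) \<in> measurable (M \<Otimes>\<^sub>M restrict_space lborel {t0..t1}) (time_prob M t0 t1)"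
      unfolding time_prob_def by (rule measurable_pair_swap')
    have "emeasure (distr (M \<Otimes>\<^sub>M restrict_space lborel {t0..t1}) (time_prob M t0 t1) (\<lambda>(x, y). (y, x))) E = 0"
      using E(2) unfolding time_prob_def by (simp flip: TP.distr_pair_swap)
    then have "emeasure (M \<Otimes>\<^sub>M restrict_space lborel {t0..t1})
        ((\<lambda>(x, y). (y, x)) -` E \<inter> space (M \<Otimes>\<^sub>M restrict_space lborel {t0..t1})) = 0"
      using swap E(3) by (simp add: emeasure_distr)
    then show ?thesis
      using E(1) measurable_sets[OF swap E(3)]
      by (intro AE_I) (auto simp: time_prob_def space_pair_measure)
  qed
  then have "AE \<omega> in M. AE s in restrict_space lborel {t0..t1}. P s \<omega>"
    using TP'.AE_pair by fastforce
  then show ?thesis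
    by (simp add: AE_restrict_space_iff)
qed

text \<open>The version \<open>u'\<close> is jointly measurable, which \<open>u\<close> itself need
  not be; every use of Tonelli goes through it.\<close>

lemma L2_processE:
  fixes u :: "real \<Rightarrow> 'a \<Rightarrow> 'b::euclidean_space"
  assumes "u \<in> L2_process M F t0 t1" "t0 \<le> t1"
  obtains u' where "progressive_on F t0 t1 u'"
    "(\<lambda>p. u' (fst p) (snd p)) \<in> borel_measurable (time_prob M t0 t1)"
    "(\<integral>\<^sup>+ p. ennreal ((norm (u' (fst p) (snd p)))\<^sup>2) \<partial>time_prob M t0 t1) < \<infinity>"
    "AE p in time_prob M t0 t1. u (fst p) (snd p) = u' (fst p) (snd p)"
proof -
  obtain u' where "progressive_on F t0 t1 u'"
    "(\<integral>\<^sup>+ (s, \<omega>). ennreal ((norm (u' s \<omega>))\<^sup>2) \<partial>time_prob M t0 t1) < \<infinity>"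
    "AE (s, \<omega>) in time_prob M t0 t1. u s \<omega> = u' s \<omega>"
    using assms(1) unfolding L2_process_def by blast
  with that[of u'] progressive_time_prob_measurable[OF _ assms(2), of u'] show thesis
    by (simp add: case_prod_unfold)
qed

section \<open>Second moments and uniqueness of the stochastic integral\<close>

text \<open>At each time \<open>I t\<close> is compared with one approximating simple integral,
  whose second moment the isometry bounds by the norm of its integrand, which in turn is close to
  \<open>z\<close>. Uniformity in \<open>t\<close> is the point, since the bound is integrated over
  time later.\<close>

lemma has_ito_integral_bounded:
  fixes z I :: "real \<Rightarrow> 'a \<Rightarrow> 'b::euclidean_space"
  assumes I: "has_ito_integral M W t0 t1 z I" and z: "z \<in> L2_process M F t0 t1" and t: "0 \<le> t0" "t0 < t1"
  shows "\<exists>C<\<infinity>. \<forall>t\<in>{t0..t1}. (\<integral>\<^sup>+\<omega>. ennreal ((norm (I t \<omega>))\<^sup>2) \<partial>M) \<le> C"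
proof -
  obtain z' where z': "(\<lambda>p. z' (fst p) (snd p)) \<in> borel_measurable (time_prob M t0 t1)"
    "(\<integral>\<^sup>+ p. ennreal ((norm (z' (fst p) (snd p)))\<^sup>2) \<partial>time_prob M t0 t1) < \<infinity>"
    "AE p in time_prob M t0 t1. z (fst p) (snd p) = z' (fst p) (snd p)"
    by (rule L2_processE[OF z less_imp_le[OF t(2)]]) blast
  obtain k \<tau> \<xi> where d: "\<And>j. simple_data M F t0 t1 (k j) (\<tau> j) (\<xi> j)"
    and lim_z: "(\<lambda>j. \<integral>\<^sup>+ (s, \<omega>). ennreal ((norm (simple_process (k j) (\<tau> j) (\<xi> j) s \<omega> - z s \<omega>))\<^sup>2)
               \<partial>time_prob M t0 t1) \<longlonglongrightarrow> 0"
    and lim_I: "\<And>t. t \<in> {t0..t1} \<Longrightarrow>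
          (\<lambda>j. \<integral>\<^sup>+ \<omega>. ennreal ((norm (simple_ito W (k j) (\<tau> j) (\<xi> j) t \<omega> - I t \<omega>))\<^sup>2) \<partial>M) \<longlonglongrightarrow> 0"
    using I unfolding has_ito_integral_def by blast
  have I_meas: "I t \<in> borel_measurable M" if "t \<in> {t0..t1}" for t
    using I that by (auto simp: has_ito_integral_def adapted_on_def intro: F_measurable_M)
  have dist_z: "(\<integral>\<^sup>+ (s, \<omega>). ennreal ((norm (simple_process (k j) (\<tau> j) (\<xi> j) s \<omega> - z s \<omega>))\<^sup>2) \<partial>time_prob M t0 t1)
     = (\<integral>\<^sup>+ p. ennreal ((norm (simple_process (k j) (\<tau> j) (\<xi> j) (fst p) (snd p) - z' (fst p) (snd p)))\<^sup>2) \<partial>time_prob M t0 t1)" for j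
    by (rule nn_integral_cong_AE) (use z'(3) in \<open>auto simp: case_prod_unfold\<close>)
  define Z where "Z = (\<integral>\<^sup>+ p. ennreal ((norm (z' (fst p) (snd p)))\<^sup>2) \<partial>time_prob M t0 t1)"
  \<comment> \<open>The zero process on the one-interval partition: as second argument of
    \<open>simple_ito_diff_le\<close> it turns an estimate of differences into an estimate of a
    single integral.\<close>
  have zero: "simple_data M F t0 t1 (Suc 0) (\<lambda>i. if i = 0 then t0 else t1) (\<lambda>_ _. 0 :: 'b)"
    using t by (auto simp: simple_data_def intro: bounded_subset[of "{0}"])
  have zero': "simple_process (Suc 0) (\<lambda>i. if i = 0 then t0 else t1) (\<lambda>_ _. 0 :: 'b) s \<omega> = 0"
    "simple_ito W (Suc 0) (\<lambda>i. if i = 0 then t0 else t1) (\<lambda>_ _. 0 :: 'b) s \<omega> = 0" for s \<omega>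
    by (simp_all add: simple_process_def simple_ito_def)
  have "eventually (\<lambda>j. (\<integral>\<^sup>+ (s, \<omega>). ennreal ((norm (simple_process (k j) (\<tau> j) (\<xi> j) s \<omega> - z s \<omega>))\<^sup>2)
               \<partial>time_prob M t0 t1) < 1) sequentially"
    using lim_z by (rule order_tendstoD) simp
  then have ev_z: "eventually (\<lambda>j. (\<integral>\<^sup>+ p. ennreal ((norm (simple_process (k j) (\<tau> j) (\<xi> j) (fst p) (snd p) - z' (fst p) (snd p)))\<^sup>2)
    \<partial>time_prob M t0 t1) < 1) sequentially"
    unfolding dist_z .
  have "(\<integral>\<^sup>+\<omega>. ennreal ((norm (I t \<omega>))\<^sup>2) \<partial>M) \<le> 2 * 1 + 2 * (2 * 1 + 2 * Z)" if tt: "t \<in> {t0..t1}" for t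
  proof -
    have "eventually (\<lambda>j. (\<integral>\<^sup>+ \<omega>. ennreal ((norm (simple_ito W (k j) (\<tau> j) (\<xi> j) t \<omega> - I t \<omega>))\<^sup>2) \<partial>M) < 1) sequentially"
      using lim_I[OF tt] by (rule order_tendstoD) simp
    \<comment> \<open>The threshold 1 is arbitrary. The index \<open>j\<close> may depend on
      \<open>t\<close>, but the constant obtained from two squared triangle inequalities contains
      only the thresholds and the squared norm \<open>Z\<close>.\<close>
    with ev_z obtain j where j: "(\<integral>\<^sup>+ \<omega>. ennreal ((norm (simple_ito W (k j) (\<tau> j) (\<xi> j) t \<omega> - I t \<omega>))\<^sup>2) \<partial>M) < 1"
      "(\<integral>\<^sup>+ p. ennreal ((norm (simple_process (k j) (\<tau> j) (\<xi> j) (fst p) (snd p) - z' (fst p) (snd p)))\<^sup>2) \<partial>time_prob M t0 t1) < 1"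
      using eventually_happens'[OF sequentially_bot eventually_conj] by blast
    let ?S = "simple_ito W (k j) (\<tau> j) (\<xi> j) t"
    let ?p = "\<lambda>p. simple_process (k j) (\<tau> j) (\<xi> j) (fst p) (snd p)"
    have S: "?S \<in> borel_measurable M" using simple_ito_measurable[OF d] t tt by auto
    have "(\<integral>\<^sup>+\<omega>. ennreal ((norm (?S \<omega>))\<^sup>2) \<partial>M) \<le> (\<integral>\<^sup>+p. ennreal ((norm (?p p))\<^sup>2) \<partial>time_prob M t0 t1)"
      using simple_ito_diff_le[OF d zero, of t j] t tt by (simp add: zero' case_prod_unfold)
    also have "\<dots> \<le> 2 * (\<integral>\<^sup>+p. ennreal ((norm (?p p - z' (fst p) (snd p)))\<^sup>2) \<partial>time_prob M t0 t1) + 2 * Z"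
      using nn_integral_norm_diff_sq[OF simple_process_measurable[OF d] z'(1) borel_measurable_const[of 0], of j]
      by (simp add: Z_def)
    also have "\<dots> \<le> 2 * 1 + 2 * Z"
      using less_imp_le[OF j(2)] by (intro add_mono mult_left_mono) auto
    finally have Sb: "(\<integral>\<^sup>+\<omega>. ennreal ((norm (?S \<omega>))\<^sup>2) \<partial>M) \<le> 2 * 1 + 2 * Z" .
    have "(\<integral>\<^sup>+\<omega>. ennreal ((norm (I t \<omega>))\<^sup>2) \<partial>M)
      \<le> 2 * (\<integral>\<^sup>+\<omega>. ennreal ((norm (I t \<omega> - ?S \<omega>))\<^sup>2) \<partial>M) + 2 * (\<integral>\<^sup>+\<omega>. ennreal ((norm (?S \<omega>))\<^sup>2) \<partial>M)"
      using nn_integral_norm_diff_sq[OF I_meas[OF tt] S borel_measurable_const[of 0]] by simp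
    also have "\<dots> \<le> 2 * 1 + 2 * (2 * 1 + 2 * Z)"
      using less_imp_le[OF j(1)] Sb by (intro add_mono mult_left_mono) (auto simp: norm_minus_commute)
    finally show ?thesis .
  qed
  moreover have "2 * 1 + 2 * (2 * 1 + 2 * Z) < \<infinity>"
    using z'(2) by (simp add: Z_def ennreal_mult_less_top)
  ultimately show ?thesis by blast
qed

text \<open>Two sequences of simple processes approaching the same \<open>z\<close> approach each
  other, and by the isometry so do their integrals. This gives equality at each fixed time outside a
  null set; continuity of the paths then yields one null set for all times.\<close>

lemma has_ito_integral_unique:
  fixes z I I' :: "real \<Rightarrow> 'a \<Rightarrow> 'b::euclidean_space"
  assumes I: "has_ito_integral M W t0 t1 z I" and I': "has_ito_integral M W t0 t1 z I'"
    and z: "z \<in> L2_process M F t0 t1" and t: "0 \<le> t0" "t0 < t1"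
  shows "AE \<omega> in M. \<forall>t\<in>{t0..t1}. I t \<omega> = I' t \<omega>"
proof -
  obtain z' where z': "(\<lambda>p. z' (fst p) (snd p)) \<in> borel_measurable (time_prob M t0 t1)"
    "AE p in time_prob M t0 t1. z (fst p) (snd p) = z' (fst p) (snd p)"
    by (rule L2_processE[OF z less_imp_le[OF t(2)]]) blast
  have I_meas: "I t \<in> borel_measurable M" "I' t \<in> borel_measurable M" if "t \<in> {t0..t1}" for t
    using I I' that by (auto simp: has_ito_integral_def adapted_on_def intro: F_measurable_M)
  obtain k \<tau> \<xi> where d: "\<And>j. simple_data M F t0 t1 (k j) (\<tau> j) (\<xi> j)"
    and lim_z: "(\<lambda>j. \<integral>\<^sup>+ (s, \<omega>). ennreal ((norm (simple_process (k j) (\<tau> j) (\<xi> j) s \<omega> - z s \<omega>))\<^sup>2)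
               \<partial>time_prob M t0 t1) \<longlonglongrightarrow> 0"
    and lim_I: "\<And>t. t \<in> {t0..t1} \<Longrightarrow>
          (\<lambda>j. \<integral>\<^sup>+ \<omega>. ennreal ((norm (simple_ito W (k j) (\<tau> j) (\<xi> j) t \<omega> - I t \<omega>))\<^sup>2) \<partial>M) \<longlonglongrightarrow> 0"
    using I unfolding has_ito_integral_def by blast
  obtain l \<rho> \<eta> where d': "\<And>j. simple_data M F t0 t1 (l j) (\<rho> j) (\<eta> j)"
    and lim_z': "(\<lambda>j. \<integral>\<^sup>+ (s, \<omega>). ennreal ((norm (simple_process (l j) (\<rho> j) (\<eta> j) s \<omega> - z s \<omega>))\<^sup>2)
               \<partial>time_prob M t0 t1) \<longlonglongrightarrow> 0"
    and lim_I': "\<And>t. t \<in> {t0..t1} \<Longrightarrow>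
          (\<lambda>j. \<integral>\<^sup>+ \<omega>. ennreal ((norm (simple_ito W (l j) (\<rho> j) (\<eta> j) t \<omega> - I' t \<omega>))\<^sup>2) \<partial>M) \<longlonglongrightarrow> 0"
    using I' unfolding has_ito_integral_def by blast
  have version: "(\<integral>\<^sup>+ (s, \<omega>). ennreal ((norm (simple_process k \<tau> \<xi> s \<omega> - z s \<omega>))\<^sup>2) \<partial>time_prob M t0 t1)
     = (\<integral>\<^sup>+ p. ennreal ((norm (simple_process k \<tau> \<xi> (fst p) (snd p) - z' (fst p) (snd p)))\<^sup>2) \<partial>time_prob M t0 t1)"
    for k \<tau> and \<xi> :: "nat \<Rightarrow> 'a \<Rightarrow> 'b"
    by (rule nn_integral_cong_AE) (use z'(2) in \<open>auto simp: case_prod_unfold\<close>)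
  have eq: "AE \<omega> in M. I t \<omega> = I' t \<omega>" if tt: "t \<in> {t0..t1}" for t
  proof -
    \<comment> \<open>The chain leads from \<open>I t\<close> through the two simple integrals to
      \<open>I' t\<close>. The middle distance is bounded by \<open>?b\<close> and
      \<open>?b'\<close>, the distances of the simple processes from \<open>z'\<close>.\<close>
    let ?S = "\<lambda>j. simple_ito W (k j) (\<tau> j) (\<xi> j) t" and ?S' = "\<lambda>j. simple_ito W (l j) (\<rho> j) (\<eta> j) t"
    let ?p = "\<lambda>j p. simple_process (k j) (\<tau> j) (\<xi> j) (fst p) (snd p)"
    let ?p' = "\<lambda>j p. simple_process (l j) (\<rho> j) (\<eta> j) (fst p) (snd p)"
    let ?a = "\<lambda>j. \<integral>\<^sup>+ \<omega>. ennreal ((norm (?S j \<omega> - I t \<omega>))\<^sup>2) \<partial>M"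
    let ?a' = "\<lambda>j. \<integral>\<^sup>+ \<omega>. ennreal ((norm (?S' j \<omega> - I' t \<omega>))\<^sup>2) \<partial>M"
    let ?b = "\<lambda>j. \<integral>\<^sup>+ p. ennreal ((norm (?p j p - z' (fst p) (snd p)))\<^sup>2) \<partial>time_prob M t0 t1"
    let ?b' = "\<lambda>j. \<integral>\<^sup>+ p. ennreal ((norm (?p' j p - z' (fst p) (snd p)))\<^sup>2) \<partial>time_prob M t0 t1"
    have S: "?S j \<in> borel_measurable M" "?S' j \<in> borel_measurable M" for j
      using simple_ito_measurable[OF d] simple_ito_measurable[OF d'] t tt by auto
    have "(\<integral>\<^sup>+\<omega>. ennreal ((norm (I t \<omega> - I' t \<omega>))\<^sup>2) \<partial>M)
        \<le> 2 * ?a j + 2 * (2 * (2 * ?b j + 2 * ?b' j) + 2 * ?a' j)" for j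
    proof -
      have "(\<integral>\<^sup>+\<omega>. ennreal ((norm (?S j \<omega> - ?S' j \<omega>))\<^sup>2) \<partial>M)
          \<le> (\<integral>\<^sup>+p. ennreal ((norm (?p j p - ?p' j p))\<^sup>2) \<partial>time_prob M t0 t1)"
        using simple_ito_diff_le[OF d d', of t j j] t tt by (simp add: case_prod_unfold)
      also have "\<dots> \<le> 2 * ?b j + 2 * ?b' j"
        using nn_integral_norm_diff_sq[OF simple_process_measurable[OF d] z'(1) simple_process_measurable[OF d'], of j j]
        by (simp add: norm_minus_commute[of "z' _ _"])
      finally have SS: "(\<integral>\<^sup>+\<omega>. ennreal ((norm (?S j \<omega> - ?S' j \<omega>))\<^sup>2) \<partial>M) \<le> 2 * ?b j + 2 * ?b' j" .
      have "(\<integral>\<^sup>+\<omega>. ennreal ((norm (I t \<omega> - I' t \<omega>))\<^sup>2) \<partial>M)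
          \<le> 2 * ?a j + 2 * (\<integral>\<^sup>+\<omega>. ennreal ((norm (?S j \<omega> - I' t \<omega>))\<^sup>2) \<partial>M)"
        using nn_integral_norm_diff_sq[OF I_meas(1)[OF tt] S(1) I_meas(2)[OF tt], of j]
        by (simp add: norm_minus_commute[of "I _ _"])
      also have "(\<integral>\<^sup>+\<omega>. ennreal ((norm (?S j \<omega> - I' t \<omega>))\<^sup>2) \<partial>M)
          \<le> 2 * (\<integral>\<^sup>+\<omega>. ennreal ((norm (?S j \<omega> - ?S' j \<omega>))\<^sup>2) \<partial>M) + 2 * ?a' j"
        using nn_integral_norm_diff_sq[OF S(1) S(2) I_meas(2)[OF tt], of j j] .
      also note SS
      finally show ?thesis by (simp add: add_mono mult_left_mono)
    qed
    moreover have "(\<lambda>j. 2 * ?a j + 2 * (2 * (2 * ?b j + 2 * ?b' j) + 2 * ?a' j)) \<longlonglongrightarrow> 2 * 0 + 2 * (2 * (2 * 0 + 2 * 0) + 2 * 0)"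
      using lim_z lim_z' lim_I[OF tt] lim_I'[OF tt] unfolding version
      by (intro tendsto_add ennreal_tendsto_cmult) auto
    ultimately have "(\<integral>\<^sup>+\<omega>. ennreal ((norm (I t \<omega> - I' t \<omega>))\<^sup>2) \<partial>M) \<le> 0"
      by (intro LIMSEQ_le_const) auto
    then have "AE \<omega> in M. ennreal ((norm (I t \<omega> - I' t \<omega>))\<^sup>2) = 0"
      using I_meas[OF tt] by (subst nn_integral_0_iff_AE[symmetric]) auto
    then show ?thesis by simp
  qed
  \<comment> \<open>Only countably many null sets can be merged, so equality is collected at
    rational times and extended by density.\<close>
  have "AE \<omega> in M. \<forall>t\<in>\<rat> \<inter> {t0<..<t1}. I t \<omega> = I' t \<omega>"
    using eq by (subst AE_ball_countable) (auto intro: countable_rat countable_Int1)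
  moreover have "AE \<omega> in M. continuous_on {t0..t1} (\<lambda>t. I t \<omega>)" "AE \<omega> in M. continuous_on {t0..t1} (\<lambda>t. I' t \<omega>)"
    using I I' by (auto simp: has_ito_integral_def)
  ultimately show ?thesis
  proof eventually_elim
    case (elim \<omega>)
    have cl: "closure ({t0<..<t1} \<inter> \<rat>) = {t0..t1}"
      using closure_open_Int_superset[of "{t0<..<t1}" "\<rat>"] t by (simp add: Rats_closure_real)
    have "continuous_on (closure ({t0<..<t1} \<inter> \<rat>)) (\<lambda>t. I t \<omega> - I' t \<omega>)"
      unfolding cl using elim by (intro continuous_intros)
    then have "I t \<omega> - I' t \<omega> = 0" if "t \<in> {t0..t1}" for t
      by (rule continuous_constant_on_closure) (use elim that cl in auto)
    then show ?case by auto
  qed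
qed

end

section \<open>Pathwise estimates\<close>

text \<open>Only the integral of \<open>g\<close> is bounded, which suffices for an L2 estimate in
  time and asks no monotonicity of \<open>a\<close>. The discounted integral of \<open>g\<close>
  minus the plain integral of \<open>a\<close> decreases: its derivative is at most
  \<open>(exp (- (C * (t - t0))) - 1) * a t\<close>, which is nonpositive because \<open>a\<close>
  is nonnegative.\<close>

lemma Gronwall_integral:
  fixes a g :: "real \<Rightarrow> real"
  assumes t: "t0 \<le> t1" and C: "0 \<le> C"
    and cont: "continuous_on {t0..t1} g" "continuous_on {t0..t1} a"
    and nonneg: "\<And>t. t \<in> {t0..t1} \<Longrightarrow> 0 \<le> a t"
    and le: "\<And>t. t \<in> {t0..t1} \<Longrightarrow> g t \<le> a t + C * integral {t0..t} g"
  shows "integral {t0..t1} g \<le> exp (C * (t1 - t0)) * integral {t0..t1} a"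
proof -
  define V where "V t = exp (- (C * (t - t0))) * integral {t0..t} g - integral {t0..t} a" for t
  have "V t1 \<le> V t0"
  proof (rule DERIV_nonpos_imp_decreasing_open[OF t])
    fix t assume tt: "t0 < t" "t < t1"
    then have at: "at t within {t0..t1} = at t" by (rule at_within_Icc_at)
    have "((\<lambda>u. integral {t0..u} g) has_real_derivative g t) (at t)"
      "((\<lambda>u. integral {t0..u} a) has_real_derivative a t) (at t)"
      using integral_has_real_derivative[OF cont(1), of t] integral_has_real_derivative[OF cont(2), of t] tt
      by (auto simp: at)
    note [derivative_intros] = this
    have "(V has_real_derivative
        (- C * exp (- (C * (t - t0)))) * integral {t0..t} g + exp (- (C * (t - t0))) * g t - a t) (at t)"
      unfolding V_def[abs_def] by (auto intro!: derivative_eq_intros simp: algebra_simps)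
    moreover have "(- C * exp (- (C * (t - t0)))) * integral {t0..t} g + exp (- (C * (t - t0))) * g t - a t \<le> 0"
    proof -
      have "exp (- (C * (t - t0))) * (g t - C * integral {t0..t} g) \<le> exp (- (C * (t - t0))) * a t"
        using le[of t] tt by (intro mult_left_mono) auto
      also have "\<dots> \<le> 1 * a t"
        using C tt nonneg[of t] by (intro mult_right_mono) auto
      finally show ?thesis by (simp add: algebra_simps)
    qed
    ultimately show "\<exists>y. (V has_real_derivative y) (at t) \<and> y \<le> 0" by blast
  next
    show "continuous_on {t0..t1} V"
      unfolding V_def[abs_def]
      by (intro continuous_intros indefinite_integral_continuous_1 integrable_continuous_real cont)
  qed
  then have "exp (- (C * (t1 - t0))) * integral {t0..t1} g \<le> integral {t0..t1} a"
    by (simp add: V_def)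
  then have "exp (C * (t1 - t0)) * (exp (- (C * (t1 - t0))) * integral {t0..t1} g)
      \<le> exp (C * (t1 - t0)) * integral {t0..t1} a"
    by (intro mult_left_mono) auto
  then show ?thesis by (simp add: mult.assoc[symmetric] exp_minus)
qed

text \<open>Gronwall with \<open>a = 0\<close> makes the integral of \<open>norm (d s)\<close>
  vanish, and the equation itself then returns \<open>d t = 0\<close>.\<close>

lemma linear_integral_equation_zero:
  fixes B :: "real \<Rightarrow> real^'n^'n" and d :: "real \<Rightarrow> real^'n"
  assumes t: "t0 \<le> t1" and cont: "continuous_on {t0..t1} d"
    and int: "set_integrable lebesgue {t0..t1} (\<lambda>s. B s *v d s)"
    and bound: "\<And>s w. s \<in> {t0..t1} \<Longrightarrow> norm (B s *v w) \<le> C * norm w" and C: "0 \<le> C"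
    and eq: "\<And>t. t \<in> {t0..t1} \<Longrightarrow> d t = (LINT s:{t0..t}|lebesgue. B s *v d s)"
    and "t \<in> {t0..t1}"
  shows "d t = 0"
proof -
  have cn: "continuous_on {t0..t1} (\<lambda>s. norm (d s))" using cont by (intro continuous_intros)
  have le: "norm (d t) \<le> C * integral {t0..t} (\<lambda>s. norm (d s))" if t: "t \<in> {t0..t1}" for t
  proof -
    have i1: "set_integrable lebesgue {t0..t} (\<lambda>s. B s *v d s)"
      by (rule set_integrable_subset[OF int]) (use t in auto)
    have i2: "set_integrable lebesgue {t0..t} (\<lambda>s. C * norm (d s))"
      by (intro absolutely_integrable_continuous_real continuous_intros continuous_on_subset[OF cont]) (use t in auto)
    have "norm (d t) \<le> (LINT s:{t0..t}|lebesgue. norm (B s *v d s))"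
      unfolding eq[OF t] by (rule set_integral_norm_bound[OF i1])
    also have "\<dots> \<le> (LINT s:{t0..t}|lebesgue. C * norm (d s))"
      using set_integrable_norm[OF i1] i2 t bound by (intro set_integral_mono) auto
    also have "\<dots> = C * integral {t0..t} (\<lambda>s. norm (d s))"
      using set_lebesgue_integral_eq_integral(2)[OF i2] by simp
    finally show ?thesis .
  qed
  have "integral {t0..t1} (\<lambda>s. norm (d s)) \<le> exp (C * (t1 - t0)) * integral {t0..t1} (\<lambda>_. 0)"
    using le by (intro Gronwall_integral[OF \<open>t0 \<le> t1\<close> C cn]) auto
  then have "integral {t0..t1} (\<lambda>s. norm (d s)) \<le> 0" by simp
  moreover have "integral {t0..t} (\<lambda>s. norm (d s)) \<le> integral {t0..t1} (\<lambda>s. norm (d s))"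
    using \<open>t \<in> {t0..t1}\<close>
    by (intro integral_subset_le integrable_continuous_real continuous_on_subset[OF cn]) auto
  ultimately have "C * integral {t0..t} (\<lambda>s. norm (d s)) \<le> 0"
    using C by (intro mult_nonneg_nonpos) auto
  then have "norm (d t) \<le> 0" using le[OF \<open>t \<in> {t0..t1}\<close>] by linarith
  then show ?thesis by simp
qed

lemma sum3_power2_le: "(a + b + c)\<^sup>2 \<le> 3 * (a\<^sup>2 + b\<^sup>2 + c\<^sup>2)" for a b c :: real
  using zero_le_power2[of "a - b"] zero_le_power2[of "b - c"] zero_le_power2[of "a - c"]
  by (simp add: power2_eq_square algebra_simps)

lemma nn_integral_continuous_Icc:
  fixes g :: "real \<Rightarrow> real"
  assumes "continuous_on {a..b} g" "\<And>s. s \<in> {a..b} \<Longrightarrow> 0 \<le> g s"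
  shows "(\<integral>\<^sup>+s. ennreal (g s) * indicator {a..b} s \<partial>lborel) = ennreal (integral {a..b} g)"
  using assms by (intro nn_integral_has_integral_lebesgue' integrable_integral integrable_continuous_real) auto

text \<open>All constants are deterministic, so the bound can be integrated over
  \<open>\<omega>\<close> without knowing any moment of \<open>x\<close>. In \<open>D\<close> one
  factor 3 comes from splitting \<open>x\<close> into initial value, drift and stochastic integral,
  the other from splitting the drift into its terms in \<open>x\<close>, \<open>z\<close> and
  \<open>v\<close>; \<open>c\<^sup>2\<close> bounds the coefficients, and \<open>t1 - t0\<close>
  comes from Cauchy-Schwarz in time.\<close>

lemma path_energy_bound:
  fixes x I z z' :: "real \<Rightarrow> real^'n" and v v' :: "real \<Rightarrow> real^'k"
    and A K :: "real \<Rightarrow> real^'n^'n" and L :: "real \<Rightarrow> real^'k^'n"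
  defines "R \<equiv> restrict_space lborel"
  assumes t: "t0 < t1" and c: "c > 0"
    and cont: "continuous_on {t0..t1} x" "continuous_on {t0..t1} I"
    and bounds: "\<And>s. s \<in> {t0..t1} \<Longrightarrow> norm (A s) \<le> c" "\<And>s. s \<in> {t0..t1} \<Longrightarrow> norm (K s) \<le> c"
      "\<And>s. s \<in> {t0..t1} \<Longrightarrow> norm (L s) \<le> c"
    and meas: "z' \<in> borel_measurable (R {t0..t1})" "v' \<in> borel_measurable (R {t0..t1})"
    and version: "AE s in lborel. s \<in> {t0..t1} \<longrightarrow> z s = z' s" "AE s in lborel. s \<in> {t0..t1} \<longrightarrow> v s = v' s"
    and int: "set_integrable lebesgue {t0..t1} (\<lambda>s. A s *v x s + K s *v z s + L s *v v s)"
    and eq: "\<And>t. t \<in> {t0..t1} \<Longrightarrow> x t = x0 + (LINT s:{t0..t}|lebesgue. A s *v x s + K s *v z s + L s *v v s) + I t"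
    and D: "D = 9 * c\<^sup>2 * (t1 - t0)"
  shows "(\<integral>\<^sup>+s. ennreal ((norm (x s))\<^sup>2) \<partial>R {t0..t1})
    \<le> ennreal (exp (D * (t1 - t0))) * (ennreal (3 * (t1 - t0) * (norm x0)\<^sup>2)
      + 3 * (\<integral>\<^sup>+s. ennreal ((norm (I s))\<^sup>2) \<partial>R {t0..t1})
      + ennreal (D * (t1 - t0)) * (\<integral>\<^sup>+s. ennreal ((norm (z' s))\<^sup>2 + (norm (v' s))\<^sup>2) \<partial>R {t0..t1}))"
proof -
  define Y where "Y = (\<integral>\<^sup>+s. ennreal ((norm (z' s))\<^sup>2 + (norm (v' s))\<^sup>2) \<partial>R {t0..t1})"
  define g where "g s = (norm (x s))\<^sup>2" for s
  define f where "f s = A s *v x s + K s *v z s + L s *v v s" for s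
  have R: "nn_integral (R {t0..t1}) h = (\<integral>\<^sup>+s. h s * indicator {t0..t1} s \<partial>lborel)" for h
    unfolding R_def by (simp add: nn_integral_restrict_space)
  have D0: "D > 0" using c t by (simp add: D)
  have cg: "continuous_on {t0..t1} g" unfolding g_def[abs_def] using cont by (intro continuous_intros)
  have cI: "continuous_on {t0..t1} (\<lambda>s. (norm (I s))\<^sup>2)" using cont by (intro continuous_intros)
  show ?thesis
  \<comment> \<open>If the path of the control is not square integrable, the right side is infinite,
    because \<open>Y\<close> has a positive coefficient.\<close>
  proof (cases "Y = \<infinity>")
    case True
    then show ?thesis
      unfolding Y_def[symmetric] using D0 t by (simp add: ennreal_mult_top)
  next
    case False
    then obtain y where y: "Y = ennreal y" "0 \<le> y" by (cases Y) auto
    have drift: "(norm (LINT s:{t0..t}|lebesgue. f s))\<^sup>2 \<le> (t1 - t0) * (3 * c\<^sup>2 * (integral {t0..t} g + y))"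
      if t: "t \<in> {t0..t1}" for t
    proof -
      define h where "h s = indicator {t0..t} s *\<^sub>R f s" for s
      have sub: "{t0..t} \<subseteq> {t0..t1}" using t by auto
      have h_int: "integrable lebesgue h"
        using set_integrable_subset[OF int _ sub] unfolding set_integrable_def f_def h_def by simp
      have pt: "ennreal ((norm (h s))\<^sup>2)
          \<le> ennreal (3 * c\<^sup>2) * (ennreal (g s) * indicator {t0..t} s
            + ennreal ((norm (z' s))\<^sup>2 + (norm (v' s))\<^sup>2) * indicator {t0..t1} s)"
        if zs: "s \<in> {t0..t1} \<longrightarrow> z s = z' s" "s \<in> {t0..t1} \<longrightarrow> v s = v' s" for s
      proof (cases "s \<in> {t0..t}")
        case True
        then have s: "s \<in> {t0..t1}" using sub by auto
        have "norm (f s) \<le> norm (A s *v x s) + norm (K s *v z s) + norm (L s *v v s)"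
          unfolding f_def by (intro norm_triangle_le add_mono order_refl norm_triangle_ineq)
        also have "\<dots> \<le> c * norm (x s) + c * norm (z s) + c * norm (v s)"
          by (intro add_mono order_trans[OF norm_matrix_vector_le] mult_right_mono bounds s) auto
        finally have "(norm (f s))\<^sup>2 \<le> (c * norm (x s) + c * norm (z s) + c * norm (v s))\<^sup>2"
          by (intro power_mono) auto
        also have "\<dots> \<le> 3 * ((c * norm (x s))\<^sup>2 + (c * norm (z s))\<^sup>2 + (c * norm (v s))\<^sup>2)"
          by (rule sum3_power2_le)
        also have "\<dots> = 3 * c\<^sup>2 * (g s + ((norm (z' s))\<^sup>2 + (norm (v' s))\<^sup>2))"
          using zs s by (simp add: g_def power_mult_distrib algebra_simps)
        finally show ?thesis
          using True s by (simp add: h_def g_def ennreal_leI flip: ennreal_plus ennreal_mult)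
      qed (simp add: h_def)
      have "ennreal (norm (LINT s:{t0..t}|lebesgue. f s)) \<le> (\<integral>\<^sup>+s. norm (h s) \<partial>lebesgue)"
        unfolding set_lebesgue_integral_def h_def[symmetric] by (rule integral_norm_bound_ennreal[OF h_int])
      also have "\<dots> = (\<integral>\<^sup>+s. ennreal (norm (h s)) * indicator {t0..t} s \<partial>lebesgue)"
        by (intro nn_integral_cong) (auto simp: h_def indicator_def)
      finally have "(ennreal (norm (LINT s:{t0..t}|lebesgue. f s)))\<^sup>2
          \<le> (\<integral>\<^sup>+s. ennreal (norm (h s)) * indicator {t0..t} s \<partial>lebesgue)\<^sup>2"
        by (rule power_mono) simp
      \<comment> \<open>Cauchy-Schwarz against the indicator of \<open>[t0, t]\<close>, which
        supplies the factor \<open>t - t0\<close>.\<close>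
      also have "\<dots> \<le> (\<integral>\<^sup>+s. (ennreal (norm (h s)))\<^sup>2 \<partial>lebesgue) * (\<integral>\<^sup>+s. (indicator {t0..t} s)\<^sup>2 \<partial>lebesgue)"
        using h_int by (intro Cauchy_Schwarz_nn_integral borel_measurable_indicator) auto
      also have "(\<integral>\<^sup>+s. (indicator {t0..t} s :: ennreal)\<^sup>2 \<partial>lebesgue) = ennreal (t - t0)"
      proof -
        have "(\<integral>\<^sup>+s. (indicator {t0..t} s :: ennreal)\<^sup>2 \<partial>lebesgue) = (\<integral>\<^sup>+s. indicator {t0..t} s \<partial>lborel)"
          unfolding nn_integral_completion by (intro nn_integral_cong) (auto simp: indicator_def)
        then show ?thesis using t by simp
      qed
      also have "(\<integral>\<^sup>+s. (ennreal (norm (h s)))\<^sup>2 \<partial>lebesgue) \<le> ennreal (3 * c\<^sup>2) * (ennreal (integral {t0..t} g) + ennreal y)"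
      proof -
        have "(\<integral>\<^sup>+s. (ennreal (norm (h s)))\<^sup>2 \<partial>lebesgue) = (\<integral>\<^sup>+s. (ennreal (norm (h s)))\<^sup>2 \<partial>lborel)"
          by (rule nn_integral_completion)
        also have "\<dots> \<le> (\<integral>\<^sup>+s. ennreal (3 * c\<^sup>2) * (ennreal (g s) * indicator {t0..t} s
            + ennreal ((norm (z' s))\<^sup>2 + (norm (v' s))\<^sup>2) * indicator {t0..t1} s) \<partial>lborel)"
          by (rule nn_integral_mono_AE) (use version in eventually_elim, use pt in \<open>simp add: ennreal_power\<close>)
        also have "\<dots> = ennreal (3 * c\<^sup>2) * ((\<integral>\<^sup>+s. ennreal (g s) * indicator {t0..t} s \<partial>lborel)
            + (\<integral>\<^sup>+s. ennreal ((norm (z' s))\<^sup>2 + (norm (v' s))\<^sup>2) * indicator {t0..t1} s \<partial>lborel))"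
        proof -
          have "(\<lambda>s. indicator {t0..t} s *\<^sub>R g s) \<in> borel_measurable borel"
            by (rule borel_measurable_continuous_on_indicator) (auto intro: continuous_on_subset[OF cg sub])
          then have "(\<lambda>s. ennreal (indicator {t0..t} s *\<^sub>R g s)) \<in> borel_measurable lborel" by simp
          moreover have "ennreal (indicator {t0..t} s *\<^sub>R g s) = ennreal (g s) * indicator {t0..t} s" for s
            by (simp add: indicator_def)
          ultimately have m1: "(\<lambda>s. ennreal (g s) * indicator {t0..t} s) \<in> borel_measurable lborel" by simp
          have "(\<lambda>s. ennreal ((norm (z' s))\<^sup>2 + (norm (v' s))\<^sup>2)) \<in> borel_measurable (restrict_space lborel {t0..t1})"
            using meas unfolding R_def by simp
          then have m2: "(\<lambda>s. ennreal ((norm (z' s))\<^sup>2 + (norm (v' s))\<^sup>2) * indicator {t0..t1} s) \<in> borel_measurable lborel"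
            by (subst (asm) borel_measurable_restrict_space_iff_ennreal) auto
          show ?thesis
            using m1 m2 by (simp add: nn_integral_cmult nn_integral_add)
        qed
        also have "(\<integral>\<^sup>+s. ennreal (g s) * indicator {t0..t} s \<partial>lborel) = ennreal (integral {t0..t} g)"
          by (intro nn_integral_continuous_Icc continuous_on_subset[OF cg sub]) (simp add: g_def)
        also have "(\<integral>\<^sup>+s. ennreal ((norm (z' s))\<^sup>2 + (norm (v' s))\<^sup>2) * indicator {t0..t1} s \<partial>lborel) = ennreal y"
          unfolding y(1)[symmetric] Y_def R ..
        finally show ?thesis .
      qed
      finally have "(ennreal (norm (LINT s:{t0..t}|lebesgue. f s)))\<^sup>2
          \<le> ennreal (3 * c\<^sup>2) * (ennreal (integral {t0..t} g) + ennreal y) * ennreal (t - t0)"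
        by (simp add: mult_right_mono)
      moreover have "0 \<le> integral {t0..t} g" by (rule integral_nonneg)
        (auto intro!: integrable_continuous_real continuous_on_subset[OF cg sub] simp: g_def)
      ultimately have "(norm (LINT s:{t0..t}|lebesgue. f s))\<^sup>2 \<le> 3 * c\<^sup>2 * (integral {t0..t} g + y) * (t - t0)"
        using y(2) t by (simp add: ennreal_power flip: ennreal_plus ennreal_mult)
      also have "\<dots> \<le> 3 * c\<^sup>2 * (integral {t0..t} g + y) * (t1 - t0)"
        using t y(2) \<open>0 \<le> integral {t0..t} g\<close> by (intro mult_left_mono) auto
      finally show ?thesis by (simp add: ac_simps)
    qed
    \<comment> \<open>The part of the estimate that does not involve \<open>x\<close> at other
      times; \<open>D * y\<close> is the contribution of the controls to the drift.\<close>
    define a where "a s = 3 * (norm x0)\<^sup>2 + D * y + 3 * (norm (I s))\<^sup>2" for s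
    have "integral {t0..t1} g \<le> exp (D * (t1 - t0)) * integral {t0..t1} a"
    proof (rule Gronwall_integral)
      fix s assume s: "s \<in> {t0..t1}"
      let ?J = "LINT r:{t0..s}|lebesgue. f r"
      have "norm (x s) \<le> norm x0 + norm ?J + norm (I s)"
        unfolding eq[OF s] f_def by (intro norm_triangle_le add_mono order_refl norm_triangle_ineq)
      then have "g s \<le> (norm x0 + norm ?J + norm (I s))\<^sup>2"
        unfolding g_def by (intro power_mono) auto
      also have "\<dots> \<le> 3 * ((norm x0)\<^sup>2 + (norm ?J)\<^sup>2 + (norm (I s))\<^sup>2)"
        by (rule sum3_power2_le)
      also have "\<dots> \<le> a s + D * integral {t0..s} g"
        using drift[OF s] by (simp add: a_def D algebra_simps)
      finally show "g s \<le> a s + D * integral {t0..s} g" .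
      show "0 \<le> a s" using D0 y(2) by (simp add: a_def)
    next
      show "continuous_on {t0..t1} a"
        unfolding a_def[abs_def] using cont by (intro continuous_intros)
    qed (use t D0 cg in auto)
    also have "integral {t0..t1} a = 3 * (t1 - t0) * (norm x0)\<^sup>2 + 3 * integral {t0..t1} (\<lambda>s. (norm (I s))\<^sup>2) + D * (t1 - t0) * y"
      unfolding a_def[abs_def] using t cI
      by (subst Henstock_Kurzweil_Integration.integral_add)
        (auto intro!: integrable_continuous_real continuous_intros simp: algebra_simps)
    finally have le: "integral {t0..t1} g \<le> exp (D * (t1 - t0)) * (3 * (t1 - t0) * (norm x0)\<^sup>2
        + 3 * integral {t0..t1} (\<lambda>s. (norm (I s))\<^sup>2) + D * (t1 - t0) * y)" .
    have Ip: "0 \<le> integral {t0..t1} (\<lambda>s. (norm (I s))\<^sup>2)"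
      by (rule integral_nonneg) (auto intro!: integrable_continuous_real cI)
    have "(\<integral>\<^sup>+s. ennreal ((norm (x s))\<^sup>2) \<partial>R {t0..t1}) = ennreal (integral {t0..t1} g)"
      unfolding R g_def[symmetric] by (rule nn_integral_continuous_Icc[OF cg]) (simp add: g_def)
    also have "\<dots> \<le> ennreal (exp (D * (t1 - t0)) * (3 * (t1 - t0) * (norm x0)\<^sup>2
        + 3 * integral {t0..t1} (\<lambda>s. (norm (I s))\<^sup>2) + D * (t1 - t0) * y))"
      using le by (rule ennreal_leI)
    also have "\<dots> = ennreal (exp (D * (t1 - t0))) * (ennreal (3 * (t1 - t0) * (norm x0)\<^sup>2)
        + 3 * ennreal (integral {t0..t1} (\<lambda>s. (norm (I s))\<^sup>2)) + ennreal (D * (t1 - t0)) * ennreal y)"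
      using t D0 y(2) Ip by (simp add: ennreal_mult ennreal_plus)
    also have "ennreal (integral {t0..t1} (\<lambda>s. (norm (I s))\<^sup>2)) = (\<integral>\<^sup>+s. ennreal ((norm (I s))\<^sup>2) \<partial>R {t0..t1})"
      unfolding R by (rule nn_integral_continuous_Icc[OF cI, symmetric]) simp
    finally show ?thesis unfolding y(1)[symmetric] Y_def .
  qed
qed

section \<open>Uniqueness and square integrability of solutions\<close>

lemma AE_lebesgue_on_iff:
  "(AE s in lebesgue_on {a..b::real}. P s) \<longleftrightarrow> (AE s in lborel. s \<in> {a..b} \<longrightarrow> P s)"
  by (simp add: AE_restrict_space_iff AE_completion_iff)

text \<open>Coefficients are Lebesgue measurable, whereas progressive measurability refers to Borel
  sets of times. The version is built coordinate by coordinate from the real-valued case after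
  extension by zero outside \<open>S\<close>.\<close>

lemma borel_version_lebesgue_on:
  fixes f :: "real \<Rightarrow> 'b::euclidean_space"
  assumes "f \<in> borel_measurable (lebesgue_on S)" "S \<in> sets lebesgue"
  obtains f' where "f' \<in> borel_measurable borel" "AE s in lborel. s \<in> S \<longrightarrow> f s = f' s"
proof -
  have "\<exists>h\<in>borel_measurable lborel. AE s in lborel. (if s \<in> S then f s else 0) \<bullet> b = h s" for b
  proof (rule completion_ex_borel_measurable_real)
    show "(\<lambda>s. (if s \<in> S then f s else 0) \<bullet> b) \<in> borel_measurable lebesgue"
      using assms borel_measurable_if[OF assms(2), of f] by (intro borel_measurable_inner) auto
  qed
  then obtain h where h: "\<And>b. h b \<in> borel_measurable borel"
    "\<And>b. AE s in lborel. (if s \<in> S then f s else 0) \<bullet> b = h b s" by simp metis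
  have "AE s in lborel. \<forall>b\<in>Basis. (if s \<in> S then f s else 0) \<bullet> b = h b s"
    using h(2) by (simp add: AE_finite_all)
  then have "AE s in lborel. s \<in> S \<longrightarrow> f s = (\<Sum>b\<in>Basis. h b s *\<^sub>R b)"
  proof eventually_elim
    case (elim s)
    show ?case
    proof
      assume "s \<in> S"
      then have "(\<Sum>b\<in>Basis. h b s *\<^sub>R b) = (\<Sum>b\<in>Basis. (f s \<bullet> b) *\<^sub>R b)"
        using elim by (intro sum.cong) auto
      then show "f s = (\<Sum>b\<in>Basis. h b s *\<^sub>R b)" by (simp add: euclidean_representation)
    qed
  qed
  moreover have "(\<lambda>s. \<Sum>b\<in>Basis. h b s *\<^sub>R b) \<in> borel_measurable borel"
    using h(1) by (intro borel_measurable_sum borel_measurable_scaleR) auto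
  ultimately show thesis using that by blast
qed

text \<open>Integrability of \<open>g\<close>, measurability included, is part of the conclusion:
  Lebesgue measure is complete, so a change on a negligible set preserves both. The transformed
  drift acquires its integrability in this way.\<close>

lemma set_integral_lebesgue_cong_AE:
  fixes f g :: "real \<Rightarrow> 'b::euclidean_space"
  assumes "AE s in lborel. s \<in> S \<longrightarrow> g s = f s" "set_integrable lebesgue S f"
  shows "set_integrable lebesgue S g" "(LINT s:S|lebesgue. g s) = (LINT s:S|lebesgue. f s)"
proof -
  have "AE s in lebesgue. s \<in> S \<longrightarrow> g s = f s"
    using assms(1) by (rule AE_completion)
  then obtain E where E: "{s \<in> space lebesgue. \<not> (s \<in> S \<longrightarrow> g s = f s)} \<subseteq> E" "E \<in> null_sets lebesgue"
    unfolding eventually_ae_filter by blast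
  then have neg: "negligible E" and eq: "\<And>s. s \<in> S - E \<Longrightarrow> g s = f s"
    by (auto simp: negligible_iff_null_sets)
  show g: "set_integrable lebesgue S g"
    using absolutely_integrable_spike[OF assms(2) neg eq] .
  show "(LINT s:S|lebesgue. g s) = (LINT s:S|lebesgue. f s)"
    unfolding set_lebesgue_integral_eq_integral(2)[OF g] set_lebesgue_integral_eq_integral(2)[OF assms(2)]
    using integral_spike[OF neg eq] by simp
qed

context brownian_space
begin

lemma AE_time_prob_fst:
  assumes "AE s in lborel. s \<in> {t0..t1} \<longrightarrow> P s"
  shows "AE p in time_prob M t0 t1. P (fst p)"
proof -
  have "AE s in restrict_space lborel {t0..t1}. P s"
    using assms by (simp add: AE_restrict_space_iff)
  then obtain E where E: "{s \<in> space (restrict_space lborel {t0..t1}). \<not> P s} \<subseteq> E"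
    "emeasure (restrict_space lborel {t0..t1}) E = 0" "E \<in> sets (restrict_space lborel {t0..t1})"
    using AE_E by blast
  show ?thesis
  proof (rule AE_I)
    show "{p \<in> space (time_prob M t0 t1). \<not> P (fst p)} \<subseteq> E \<times> space M"
      using E(1) by (auto simp: time_prob_def space_pair_measure)
    show "E \<times> space M \<in> sets (time_prob M t0 t1)"
      using E(3) by (auto simp: time_prob_def)
    show "emeasure (time_prob M t0 t1) (E \<times> space M) = 0"
      unfolding time_prob_def by (subst emeasure_pair_measure_Times) (use E in auto)
  qed
qed

lemma AE_time_prob_snd:
  assumes "AE \<omega> in M. \<forall>s\<in>{t0..t1}. P s \<omega>"
  shows "AE p in time_prob M t0 t1. P (fst p) (snd p)"
proof -
  obtain E where E: "{\<omega> \<in> space M. \<not> (\<forall>s\<in>{t0..t1}. P s \<omega>)} \<subseteq> E" "emeasure M E = 0" "E \<in> sets M"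
    using AE_E[OF assms] by blast
  have Icc: "{t0..t1} \<in> sets (restrict_space lborel {t0..t1})"
    by (auto simp: sets_restrict_space image_iff intro: bexI[of _ UNIV])
  show ?thesis
  proof (rule AE_I)
    show "{p \<in> space (time_prob M t0 t1). \<not> P (fst p) (snd p)} \<subseteq> {t0..t1} \<times> E"
      using E(1) by (fastforce simp: time_prob_def space_pair_measure space_restrict_space)
    show "{t0..t1} \<times> E \<in> sets (time_prob M t0 t1)"
      unfolding time_prob_def by (rule pair_measureI[OF Icc E(3)])
    show "emeasure (time_prob M t0 t1) ({t0..t1} \<times> E) = 0"
      unfolding time_prob_def
      by (subst emeasure_pair_measure_Times) (use E Icc in auto)
  qed
qed

text \<open>Sampling a continuous adapted process on finer and finer grids exhibits it as a limit of
  processes that are evidently progressively measurable.\<close>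

lemma progressive_version:
  fixes x :: "real \<Rightarrow> 'a \<Rightarrow> 'b::euclidean_space"
  assumes adapted: "adapted_on F t0 t1 x" and cont: "AE \<omega> in M. continuous_on {t0..t1} (\<lambda>s. x s \<omega>)"
  obtains x' where "progressive_on F t0 t1 x'" "AE \<omega> in M. \<forall>s. x s \<omega> = x' s \<omega>"
proof -
  obtain E where E: "{\<omega> \<in> space M. \<not> continuous_on {t0..t1} (\<lambda>s. x s \<omega>)} \<subseteq> E"
    "emeasure M E = 0" "E \<in> sets M"
    using AE_E[OF cont] by blast
  then have null: "E \<in> null_sets M" by auto
  \<comment> \<open>The paths are made continuous everywhere by erasing the bad null set. This keeps
    \<open>x'\<close> adapted because the filtration contains all null sets.\<close>
  define x' where "x' s \<omega> = (if \<omega> \<in> E then 0 else x s \<omega>)" for s \<omega>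
  have x'_F: "x' s \<in> borel_measurable (F s)" if "s \<in> {t0..t1}" for s
    unfolding x'_def using adapted that null_sets_F[OF null, of s]
    by (intro measurable_If_set sets.Int[OF _ sets.top]) (auto simp: adapted_on_def)
  have x'_cont: "continuous_on {t0..t1} (\<lambda>s. x' s \<omega>)" if "\<omega> \<in> space M" for \<omega>
    using E(1) that by (cases "\<omega> \<in> E") (auto simp: x'_def)
  have "(\<lambda>(s, \<omega>). x' s \<omega>) \<in> borel_measurable (restrict_space borel {t0..t} \<Otimes>\<^sub>M F t)"
    if t: "t \<in> {t0..t1}" for t
  proof -
    let ?N = "restrict_space borel {t0..t} \<Otimes>\<^sub>M F t"
    \<comment> \<open>Clamping to \<open>[t0, t]\<close> keeps the grid point of every integer index
      inside the interval. The measurability argument below needs \<open>x' (r n i)\<close> to be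
      measurable for \<open>F t\<close> for each \<open>i\<close>, not only for the indices that
      occur.\<close>
    define c where "c u = max t0 (min t u)" for u
    define m where "m n s = \<lfloor>(s - t0) * real (Suc n)\<rfloor>" for n s
    define r where "r n i = c (t0 + real_of_int i / real (Suc n))" for n i
    have "c u \<in> {t0..t}" for u using t by (auto simp: c_def)
    then have r: "r n i \<in> {t0..t1}" "r n i \<le> t" for n i
      using t by (auto simp: r_def intro: order_trans)
    have meas: "(\<lambda>p. x' (r n (m n (fst p))) (snd p)) \<in> borel_measurable ?N" for n
    proof (rule measurable_compose_countable)
      show "(\<lambda>p. x' (r n i) (snd p)) \<in> borel_measurable ?N" for i
      proof (rule measurable_compose[OF measurable_snd])
        show "x' (r n i) \<in> borel_measurable (F t)" using F_measurable_mono[OF x'_F[OF r(1)] r(2)] .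
      qed
      show "(\<lambda>p. m n (fst p)) \<in> measurable ?N (count_space UNIV)"
        unfolding m_def
        by (rule measurable_compose[OF measurable_fst], rule measurable_restrict_space1) measurable
    qed
    have lim: "(\<lambda>n. x' (r n (m n (fst p))) (snd p)) \<longlonglongrightarrow> x' (fst p) (snd p)" if p: "p \<in> space ?N" for p
    proof -
      define s where "s = fst p"
      have s: "s \<in> {t0..t}" "snd p \<in> space M"
        using p by (auto simp: s_def space_pair_measure space_restrict_space)
      have "\<bar>r n (m n s) - s\<bar> \<le> 1 / real (Suc n)" for n
      proof -
        have "real_of_int (m n s) \<le> (s - t0) * real (Suc n)" "(s - t0) * real (Suc n) < real_of_int (m n s) + 1"
          unfolding m_def by linarith+
        then have "real_of_int (m n s) / real (Suc n) \<le> s - t0" "s - t0 \<le> real_of_int (m n s) / real (Suc n) + 1 / real (Suc n)"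
          by (simp_all add: field_simps)
        then show ?thesis using s by (auto simp: r_def c_def)
      qed
      then have "\<forall>\<^sub>F n in sequentially. norm (r n (m n s) - s) \<le> 1 / real (Suc n)"
        by (intro always_eventually allI) (simp only: real_norm_def)
      moreover have "(\<lambda>n. 1 / real (Suc n)) \<longlonglongrightarrow> 0"
        using LIMSEQ_inverse_real_of_nat by (simp add: inverse_eq_divide)
      ultimately have "(\<lambda>n. r n (m n s) - s) \<longlonglongrightarrow> 0"
        by (rule Lim_null_comparison)
      then have "(\<lambda>n. r n (m n s)) \<longlonglongrightarrow> s" by (simp add: LIM_zero_iff)
      then show ?thesis
        unfolding s_def[symmetric]
      proof (rule continuous_on_tendsto_compose[OF x'_cont[OF s(2)]])
        show "s \<in> {t0..t1}" using s t by auto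
        show "\<forall>\<^sub>F n in sequentially. r n (m n s) \<in> {t0..t1}" using r(1) by (intro always_eventually allI)
      qed
    qed
    show ?thesis
      unfolding case_prod_unfold by (rule borel_measurable_LIMSEQ_metric[OF meas lim])
  qed
  then have "progressive_on F t0 t1 x'" by (simp add: progressive_on_def)
  moreover have "AE \<omega> in M. \<forall>s. x s \<omega> = x' s \<omega>"
    using AE_not_in[OF null] by eventually_elim (simp add: x'_def)
  ultimately show thesis by (rule that)
qed

text \<open>The control terms cancel in the difference, so the bound concerns \<open>A\<close>
  alone. For the second system this reduces the required estimate to \<open>A_hat\<close>, away from
  the inverses inside \<open>K_hat\<close> and \<open>L_hat\<close>.\<close>

lemma sde_solution_unique:
  fixes A K :: "real \<Rightarrow> real^'n^'n" and L :: "real \<Rightarrow> real^'k^'n"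
  assumes x: "sde_solution M W A K L t0 t1 x0 z v x" and y: "sde_solution M W A K L t0 t1 x0 z v y"
    and z: "z \<in> L2_process M F t0 t1" and t: "0 \<le> t0" "t0 < t1"
    and bound: "\<And>s w. s \<in> {t0..t1} \<Longrightarrow> norm (A s *v w) \<le> C * norm w" and C: "0 \<le> C"
  shows "AE \<omega> in M. \<forall>t\<in>{t0..t1}. x t \<omega> = y t \<omega>"
proof -
  obtain I where I: "has_ito_integral M W t0 t1 z I" "AE \<omega> in M. \<forall>t\<in>{t0..t1}. x t \<omega> = x0 \<omega> +
           (LINT s:{t0..t}|lebesgue. A s *v x s \<omega> + K s *v z s \<omega> + L s *v v s \<omega>) + I t \<omega>"
    using x unfolding sde_solution_def by blast
  obtain J where J: "has_ito_integral M W t0 t1 z J" "AE \<omega> in M. \<forall>t\<in>{t0..t1}. y t \<omega> = x0 \<omega> +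
           (LINT s:{t0..t}|lebesgue. A s *v y s \<omega> + K s *v z s \<omega> + L s *v v s \<omega>) + J t \<omega>"
    using y unfolding sde_solution_def by blast
  have "AE \<omega> in M. continuous_on {t0..t1} (\<lambda>s. x s \<omega>)" "AE \<omega> in M. continuous_on {t0..t1} (\<lambda>s. y s \<omega>)"
    "AE \<omega> in M. set_integrable lebesgue {t0..t1} (\<lambda>s. A s *v x s \<omega> + K s *v z s \<omega> + L s *v v s \<omega>)"
    "AE \<omega> in M. set_integrable lebesgue {t0..t1} (\<lambda>s. A s *v y s \<omega> + K s *v z s \<omega> + L s *v v s \<omega>)"
    using x y unfolding sde_solution_def by auto
  with I(2) J(2) has_ito_integral_unique[OF I(1) J(1) z t] show ?thesis
  proof eventually_elim
    case (elim \<omega>)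
    let ?fx = "\<lambda>s. A s *v x s \<omega> + K s *v z s \<omega> + L s *v v s \<omega>"
    let ?fy = "\<lambda>s. A s *v y s \<omega> + K s *v z s \<omega> + L s *v v s \<omega>"
    have diff: "?fx s - ?fy s = A s *v (x s \<omega> - y s \<omega>)" for s
      by (simp add: matrix_vector_mult_diff_distrib)
    show ?case
    proof
      fix t assume t: "t \<in> {t0..t1}"
      have "x t \<omega> - y t \<omega> = 0"
      proof (rule linear_integral_equation_zero[where B = A and C = C and d = "\<lambda>s. x s \<omega> - y s \<omega>"])
        show "continuous_on {t0..t1} (\<lambda>s. x s \<omega> - y s \<omega>)"
          using elim by (intro continuous_intros)
        show "set_integrable lebesgue {t0..t1} (\<lambda>s. A s *v (x s \<omega> - y s \<omega>))"
          using set_integral_diff(1)[OF elim(6,7)] unfolding diff .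
        fix u assume u: "u \<in> {t0..t1}"
        have "set_integrable lebesgue {t0..u} ?fx" "set_integrable lebesgue {t0..u} ?fy"
          by (rule set_integrable_subset[OF elim(6)] set_integrable_subset[OF elim(7)]; use u in simp)+
        from set_integral_diff(2)[OF this] have "(LINT s:{t0..u}|lebesgue. A s *v (x s \<omega> - y s \<omega>))
            = (LINT s:{t0..u}|lebesgue. ?fx s) - (LINT s:{t0..u}|lebesgue. ?fy s)"
          unfolding diff .
        then show "x u \<omega> - y u \<omega> = (LINT s:{t0..u}|lebesgue. A s *v (x s \<omega> - y s \<omega>))"
          using elim(1-3) u by simp
      qed (use \<open>t0 < t1\<close> bound C t in auto)
      then show "x t \<omega> = y t \<omega>" by simp
    qed
  qed
qed

lemma time_prob_section_measurable:
  fixes u :: "real \<Rightarrow> 'a \<Rightarrow> 'b::euclidean_space"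
  assumes "(\<lambda>p. u (fst p) (snd p)) \<in> borel_measurable (time_prob M t0 t1)" "\<omega> \<in> space M"
  shows "(\<lambda>s. u s \<omega>) \<in> borel_measurable (restrict_space lborel {t0..t1})"
  using measurable_compose[OF measurable_Pair2'[OF assms(2)] assms(1)[unfolded time_prob_def]] by simp

lemma nn_integral_time_prob:
  assumes "f \<in> borel_measurable (time_prob M t0 t1)"
  shows "nn_integral (time_prob M t0 t1) f = (\<integral>\<^sup>+\<omega>. (\<integral>\<^sup>+s. f (s, \<omega>) \<partial>restrict_space lborel {t0..t1}) \<partial>M)"
    "nn_integral (time_prob M t0 t1) f = (\<integral>\<^sup>+s. (\<integral>\<^sup>+\<omega>. f (s, \<omega>) \<partial>M) \<partial>restrict_space lborel {t0..t1})"
    "(\<lambda>\<omega>. \<integral>\<^sup>+s. f (s, \<omega>) \<partial>restrict_space lborel {t0..t1}) \<in> borel_measurable M"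
proof -
  interpret TP: pair_sigma_finite "restrict_space lborel {t0..t1}" M by (rule pair_sigma_finite_time)
  note f = assms[unfolded time_prob_def]
  show "nn_integral (time_prob M t0 t1) f = (\<integral>\<^sup>+\<omega>. (\<integral>\<^sup>+s. f (s, \<omega>) \<partial>restrict_space lborel {t0..t1}) \<partial>M)"
    unfolding time_prob_def by (rule TP.nn_integral_snd[OF f, symmetric])
  show "nn_integral (time_prob M t0 t1) f = (\<integral>\<^sup>+s. (\<integral>\<^sup>+\<omega>. f (s, \<omega>) \<partial>M) \<partial>restrict_space lborel {t0..t1})"
    unfolding time_prob_def by (rule nn_integral_fst[OF f, symmetric])
  show "(\<lambda>\<omega>. \<integral>\<^sup>+s. f (s, \<omega>) \<partial>restrict_space lborel {t0..t1}) \<in> borel_measurable M"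
    using sigma_finite_measure.borel_measurable_nn_integral_fst[OF sigma_finite_restrict_lborel measurable_pair_swap[OF f]]
    by simp
qed

text \<open>The path estimate is integrated over \<open>\<omega>\<close>. Its three terms are finite
  by square integrability of \<open>x0\<close>, the uniform second moment of the stochastic
  integral, and square integrability of the controls.\<close>

lemma sde_solution_L2:
  fixes A K :: "real \<Rightarrow> real^'n^'n" and L :: "real \<Rightarrow> real^'k^'n"
  assumes x: "sde_solution M W A K L t0 t1 x0 z v x"
    and x0: "x0 \<in> L2_rv M (F t0)"
    and z: "z \<in> L2_process M F t0 t1" and v: "v \<in> L2_process M F t0 t1" and t: "0 \<le> t0" "t0 < t1"
    and c: "c > 0" and bounds: "\<And>s. s \<in> {t0..t1} \<Longrightarrow> norm (A s) \<le> c" "\<And>s. s \<in> {t0..t1} \<Longrightarrow> norm (K s) \<le> c"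
      "\<And>s. s \<in> {t0..t1} \<Longrightarrow> norm (L s) \<le> c"
  shows "x \<in> L2_process M F t0 t1"
proof -
  let ?R = "restrict_space lborel {t0..t1}"
  obtain I where I: "has_ito_integral M W t0 t1 z I" "AE \<omega> in M. \<forall>t\<in>{t0..t1}. x t \<omega> = x0 \<omega> +
           (LINT s:{t0..t}|lebesgue. A s *v x s \<omega> + K s *v z s \<omega> + L s *v v s \<omega>) + I t \<omega>"
    using x unfolding sde_solution_def by blast
  have ad: "adapted_on F t0 t1 x" "AE \<omega> in M. continuous_on {t0..t1} (\<lambda>s. x s \<omega>)"
    "AE \<omega> in M. set_integrable lebesgue {t0..t1} (\<lambda>s. A s *v x s \<omega> + K s *v z s \<omega> + L s *v v s \<omega>)"
    using x unfolding sde_solution_def by auto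
  have adI: "adapted_on F t0 t1 I" "AE \<omega> in M. continuous_on {t0..t1} (\<lambda>s. I s \<omega>)"
    using I(1) unfolding has_ito_integral_def by auto
  \<comment> \<open>\<open>x\<close> and \<open>I\<close> are adapted with almost surely continuous
    paths; progressive versions supply the joint measurability that Tonelli requires.\<close>
  obtain x' where x': "progressive_on F t0 t1 x'" "AE \<omega> in M. \<forall>s. x s \<omega> = x' s \<omega>"
    using progressive_version[OF ad(1,2)] .
  obtain I' where I': "progressive_on F t0 t1 I'" "AE \<omega> in M. \<forall>s. I s \<omega> = I' s \<omega>"
    using progressive_version[OF adI] .
  obtain z' where z': "(\<lambda>p. z' (fst p) (snd p)) \<in> borel_measurable (time_prob M t0 t1)"
    "(\<integral>\<^sup>+ p. ennreal ((norm (z' (fst p) (snd p)))\<^sup>2) \<partial>time_prob M t0 t1) < \<infinity>"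
    "AE p in time_prob M t0 t1. z (fst p) (snd p) = z' (fst p) (snd p)"
    by (rule L2_processE[OF z less_imp_le[OF t(2)]]) blast
  obtain v' where v': "(\<lambda>p. v' (fst p) (snd p)) \<in> borel_measurable (time_prob M t0 t1)"
    "(\<integral>\<^sup>+ p. ennreal ((norm (v' (fst p) (snd p)))\<^sup>2) \<partial>time_prob M t0 t1) < \<infinity>"
    "AE p in time_prob M t0 t1. v (fst p) (snd p) = v' (fst p) (snd p)"
    by (rule L2_processE[OF v less_imp_le[OF t(2)]]) blast
  note x'_m = progressive_time_prob_measurable[OF x'(1) less_imp_le[OF t(2)]]
  note I'_m = progressive_time_prob_measurable[OF I'(1) less_imp_le[OF t(2)]]
  have x'_m2: "(\<lambda>p. ennreal ((norm (x' (fst p) (snd p)))\<^sup>2)) \<in> borel_measurable (time_prob M t0 t1)"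
    using x'_m by simp
  have I'_m2: "(\<lambda>p. ennreal ((norm (I' (fst p) (snd p)))\<^sup>2)) \<in> borel_measurable (time_prob M t0 t1)"
    using I'_m by simp
  have zv_m2: "(\<lambda>p. ennreal ((norm (z' (fst p) (snd p)))\<^sup>2 + (norm (v' (fst p) (snd p)))\<^sup>2)) \<in> borel_measurable (time_prob M t0 t1)"
    using z'(1) v'(1) by simp
  have x0': "x0 \<in> borel_measurable M" "integrable M (\<lambda>\<omega>. (norm (x0 \<omega>))\<^sup>2)"
    using x0 by (auto simp: L2_rv_def intro: F_measurable_M)
  define D where "D = 9 * c\<^sup>2 * (t1 - t0)"
  define e where "e = ennreal (exp (D * (t1 - t0)))"
  define iI where "iI \<omega> = (\<integral>\<^sup>+s. ennreal ((norm (I' s \<omega>))\<^sup>2) \<partial>?R)" for \<omega>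
  define iz where "iz \<omega> = (\<integral>\<^sup>+s. ennreal ((norm (z' s \<omega>))\<^sup>2 + (norm (v' s \<omega>))\<^sup>2) \<partial>?R)" for \<omega>
  have iI_m: "iI \<in> borel_measurable M" and iI_int: "(\<integral>\<^sup>+\<omega>. iI \<omega> \<partial>M) = (\<integral>\<^sup>+p. ennreal ((norm (I' (fst p) (snd p)))\<^sup>2) \<partial>time_prob M t0 t1)"
    using nn_integral_time_prob(1,3)[OF I'_m2] by (simp_all add: iI_def[abs_def])
  have iz_m: "iz \<in> borel_measurable M" and iz_int: "(\<integral>\<^sup>+\<omega>. iz \<omega> \<partial>M)
      = (\<integral>\<^sup>+p. ennreal ((norm (z' (fst p) (snd p)))\<^sup>2 + (norm (v' (fst p) (snd p)))\<^sup>2) \<partial>time_prob M t0 t1)"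
    using nn_integral_time_prob(1,3)[OF zv_m2] by (simp_all add: iz_def[abs_def])
  have path: "AE \<omega> in M. (\<integral>\<^sup>+s. ennreal ((norm (x' s \<omega>))\<^sup>2) \<partial>?R)
      \<le> e * (ennreal (3 * (t1 - t0) * (norm (x0 \<omega>))\<^sup>2) + 3 * iI \<omega> + ennreal (D * (t1 - t0)) * iz \<omega>)"
    using I(2) ad(2,3) adI(2) x'(2) I'(2) AE_time_prob_swap[OF z'(3)] AE_time_prob_swap[OF v'(3)] AE_space
  proof eventually_elim
    case (elim \<omega>)
    have "(\<integral>\<^sup>+s. ennreal ((norm (x s \<omega>))\<^sup>2) \<partial>?R)
      \<le> e * (ennreal (3 * (t1 - t0) * (norm (x0 \<omega>))\<^sup>2) + 3 * (\<integral>\<^sup>+s. ennreal ((norm (I s \<omega>))\<^sup>2) \<partial>?R)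
        + ennreal (D * (t1 - t0)) * iz \<omega>)"
      unfolding e_def iz_def
      by (rule path_energy_bound[where c = c and A = A and K = K and L = L and z = "\<lambda>s. z s \<omega>" and v = "\<lambda>s. v s \<omega>"])
        (use elim t c bounds time_prob_section_measurable[OF z'(1)] time_prob_section_measurable[OF v'(1)]
          in \<open>auto simp: D_def\<close>)
    then show ?case using elim(5,6) by (simp add: iI_def)
  qed
  have fin_I: "(\<integral>\<^sup>+\<omega>. iI \<omega> \<partial>M) < \<infinity>"
  proof -
    \<comment> \<open>The moment bound holds at each time, so Tonelli is used with time as the outer
      variable, giving at most \<open>B\<close> times the length of the interval.\<close>
    obtain B where B: "B < \<infinity>" "\<And>s. s \<in> {t0..t1} \<Longrightarrow> (\<integral>\<^sup>+\<omega>. ennreal ((norm (I s \<omega>))\<^sup>2) \<partial>M) \<le> B"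
      using has_ito_integral_bounded[OF I(1) z t] by blast
    have "(\<integral>\<^sup>+\<omega>. iI \<omega> \<partial>M) = (\<integral>\<^sup>+s. (\<integral>\<^sup>+\<omega>. ennreal ((norm (I' s \<omega>))\<^sup>2) \<partial>M) \<partial>?R)"
      unfolding iI_int nn_integral_time_prob(2)[OF I'_m2] by simp
    also have "\<dots> \<le> (\<integral>\<^sup>+s. B \<partial>?R)"
    proof (rule nn_integral_mono)
      fix s assume "s \<in> space ?R"
      then have "s \<in> {t0..t1}" by (simp add: space_restrict_space)
      moreover have "(\<integral>\<^sup>+\<omega>. ennreal ((norm (I' s \<omega>))\<^sup>2) \<partial>M) = (\<integral>\<^sup>+\<omega>. ennreal ((norm (I s \<omega>))\<^sup>2) \<partial>M)"
        by (rule nn_integral_cong_AE) (use I'(2) in eventually_elim, simp)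
      ultimately show "(\<integral>\<^sup>+\<omega>. ennreal ((norm (I' s \<omega>))\<^sup>2) \<partial>M) \<le> B" using B(2) by simp
    qed
    also have "\<dots> = B * ennreal (t1 - t0)"
      using t by (simp add: emeasure_restrict_space space_restrict_space)
    also have "\<dots> < \<infinity>" using B(1) by (simp add: ennreal_mult_less_top)
    finally show ?thesis .
  qed
  have fin_z: "(\<integral>\<^sup>+\<omega>. iz \<omega> \<partial>M) < \<infinity>"
    unfolding iz_int using z' v' by (simp add: nn_integral_add)
  have fin_0: "(\<integral>\<^sup>+\<omega>. ennreal (3 * (t1 - t0) * (norm (x0 \<omega>))\<^sup>2) \<partial>M) < \<infinity>"
    using x0'(2) t by (subst nn_integral_eq_integral) auto
  have "(\<integral>\<^sup>+p. ennreal ((norm (x' (fst p) (snd p)))\<^sup>2) \<partial>time_prob M t0 t1)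
      = (\<integral>\<^sup>+\<omega>. (\<integral>\<^sup>+s. ennreal ((norm (x' s \<omega>))\<^sup>2) \<partial>?R) \<partial>M)"
    using nn_integral_time_prob(1)[OF x'_m2] by simp
  also have "\<dots> \<le> (\<integral>\<^sup>+\<omega>. e * (ennreal (3 * (t1 - t0) * (norm (x0 \<omega>))\<^sup>2) + 3 * iI \<omega> + ennreal (D * (t1 - t0)) * iz \<omega>) \<partial>M)"
    by (rule nn_integral_mono_AE[OF path])
  also have "\<dots> = e * ((\<integral>\<^sup>+\<omega>. ennreal (3 * (t1 - t0) * (norm (x0 \<omega>))\<^sup>2) \<partial>M) + 3 * (\<integral>\<^sup>+\<omega>. iI \<omega> \<partial>M)
      + ennreal (D * (t1 - t0)) * (\<integral>\<^sup>+\<omega>. iz \<omega> \<partial>M))"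
    using iI_m iz_m x0'(1) by (simp add: nn_integral_cmult nn_integral_add)
  also have "\<dots> < \<infinity>"
    using fin_I fin_z fin_0 by (simp add: e_def ennreal_mult_less_top)
  finally have "(\<integral>\<^sup>+p. ennreal ((norm (x' (fst p) (snd p)))\<^sup>2) \<partial>time_prob M t0 t1) < \<infinity>" .
  moreover have "AE p in time_prob M t0 t1. x (fst p) (snd p) = x' (fst p) (snd p)"
    by (rule AE_time_prob_snd) (use x'(2) in eventually_elim, simp)
  ultimately show ?thesis
    using x'(1) unfolding L2_process_def case_prod_unfold by blast
qed


section \<open>Square integrability of the transformed control and exchange of drifts\<close>

lemma progressive_time_matrix_mult:
  fixes S :: "real \<Rightarrow> real^'n^'m" and u :: "real \<Rightarrow> 'a \<Rightarrow> real^'n"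
  assumes S: "S \<in> borel_measurable borel" and u: "progressive_on F t0 t1 u"
  shows "progressive_on F t0 t1 (\<lambda>s \<omega>. S s *v u s \<omega>)"
  unfolding progressive_on_def
proof
  fix t assume "t \<in> {t0..t1}"
  then have "(\<lambda>p. u (fst p) (snd p)) \<in> borel_measurable (restrict_space borel {t0..t} \<Otimes>\<^sub>M F t)"
    using u by (simp add: progressive_on_def case_prod_unfold)
  moreover have "(\<lambda>p. S (fst p)) \<in> borel_measurable (restrict_space borel {t0..t} \<Otimes>\<^sub>M F t)"
    by (rule measurable_compose[OF measurable_fst measurable_restrict_space1[OF S]])
  ultimately show "(\<lambda>(s, \<omega>). S s *v u s \<omega>) \<in> borel_measurable (restrict_space borel {t0..t} \<Otimes>\<^sub>M F t)"
    unfolding case_prod_unfold by (intro borel_measurable_matrix_vector_mul)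
qed

lemma progressive_vec_append:
  fixes u :: "real \<Rightarrow> 'a \<Rightarrow> real^'n" and w :: "real \<Rightarrow> 'a \<Rightarrow> real^'m"
  assumes "progressive_on F t0 t1 u" "progressive_on F t0 t1 w"
  shows "progressive_on F t0 t1 (\<lambda>s \<omega>. u s \<omega> @v w s \<omega>)"
  using assms unfolding progressive_on_def case_prod_unfold
  by (intro ballI borel_measurable_vec_append) auto

lemma L2_process_vec_append:
  fixes u :: "real \<Rightarrow> 'a \<Rightarrow> real^'n" and w :: "real \<Rightarrow> 'a \<Rightarrow> real^'m"
  assumes "u \<in> L2_process M F t0 t1" "w \<in> L2_process M F t0 t1" "t0 \<le> t1"
  shows "(\<lambda>s \<omega>. u s \<omega> @v w s \<omega>) \<in> L2_process M F t0 t1"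
proof -
  obtain u' where u': "progressive_on F t0 t1 u'"
    "(\<lambda>p. u' (fst p) (snd p)) \<in> borel_measurable (time_prob M t0 t1)"
    "(\<integral>\<^sup>+ p. ennreal ((norm (u' (fst p) (snd p)))\<^sup>2) \<partial>time_prob M t0 t1) < \<infinity>"
    "AE p in time_prob M t0 t1. u (fst p) (snd p) = u' (fst p) (snd p)"
    by (rule L2_processE[OF assms(1,3)])
  obtain w' where w': "progressive_on F t0 t1 w'"
    "(\<lambda>p. w' (fst p) (snd p)) \<in> borel_measurable (time_prob M t0 t1)"
    "(\<integral>\<^sup>+ p. ennreal ((norm (w' (fst p) (snd p)))\<^sup>2) \<partial>time_prob M t0 t1) < \<infinity>"
    "AE p in time_prob M t0 t1. w (fst p) (snd p) = w' (fst p) (snd p)"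
    by (rule L2_processE[OF assms(2,3)])
  have "progressive_on F t0 t1 (\<lambda>s \<omega>. u' s \<omega> @v w' s \<omega>)"
    by (rule progressive_vec_append[OF u'(1) w'(1)])
  moreover have "(\<integral>\<^sup>+ p. ennreal ((norm (u' (fst p) (snd p) @v w' (fst p) (snd p)))\<^sup>2) \<partial>time_prob M t0 t1) < \<infinity>"
    using u'(2,3) w'(2,3) by (simp add: norm_vec_append nn_integral_add)
  moreover have "AE p in time_prob M t0 t1.
      u (fst p) (snd p) @v w (fst p) (snd p) = u' (fst p) (snd p) @v w' (fst p) (snd p)"
    using u'(4) w'(4) by eventually_elim simp
  ultimately show ?thesis
    unfolding L2_process_def case_prod_unfold by blast
qed

text \<open>The progressive version uses \<open>scaled_sqrt c\<close> of a Borel version of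
  \<open>P\<close>, and agrees with the given product wherever \<open>P s\<close> is positive
  semidefinite and equals its Borel version. The strict bound \<open>c\<close> is what identifies
  the two roots there, and it also bounds the norm.\<close>

lemma L2_process_psd_sqrt_mult:
  fixes P :: "real \<Rightarrow> real^'n^'n" and u :: "real \<Rightarrow> 'a \<Rightarrow> real^'n"
  assumes P: "P \<in> borel_measurable (lebesgue_on S)" "S \<in> sets lebesgue" "{t0..t1} \<subseteq> S"
    and bound: "\<And>s. s \<in> S \<Longrightarrow> norm (P s) < c"
    and psd: "AE s in lborel. s \<in> {t0..t1} \<longrightarrow> psd (P s)"
    and u: "u \<in> L2_process M F t0 t1" and t: "t0 \<le> t1"
  shows "(\<lambda>s \<omega>. psd_sqrt (P s) *v u s \<omega>) \<in> L2_process M F t0 t1"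
proof -
  obtain P' where P': "P' \<in> borel_measurable borel" "AE s in lborel. s \<in> S \<longrightarrow> P s = P' s"
    using borel_version_lebesgue_on[OF P(1,2)] .
  obtain u' where u': "progressive_on F t0 t1 u'"
    "(\<lambda>p. u' (fst p) (snd p)) \<in> borel_measurable (time_prob M t0 t1)"
    "(\<integral>\<^sup>+ p. ennreal ((norm (u' (fst p) (snd p)))\<^sup>2) \<partial>time_prob M t0 t1) < \<infinity>"
    "AE p in time_prob M t0 t1. u (fst p) (snd p) = u' (fst p) (snd p)"
    by (rule L2_processE[OF u t])
  define w where "w s \<omega> = scaled_sqrt c (P' s) *v u' s \<omega>" for s \<omega>
  have prog: "progressive_on F t0 t1 w"
    unfolding w_def[abs_def]
    by (rule progressive_time_matrix_mult[OF measurable_compose[OF P'(1) borel_measurable_scaled_sqrt] u'(1)])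
  have "AE s in lborel. s \<in> {t0..t1} \<longrightarrow> psd (P s) \<and> norm (P s) < c \<and> psd_sqrt (P s) = scaled_sqrt c (P' s)"
    using P'(2) psd
  proof eventually_elim
    case (elim s)
    show ?case
    proof
      assume s: "s \<in> {t0..t1}"
      then have *: "psd (P s)" "norm (P s) < c" "P s = P' s"
        using elim P(3) bound[of s] by auto
      then show "psd (P s) \<and> norm (P s) < c \<and> psd_sqrt (P s) = scaled_sqrt c (P' s)"
        using psd_sqrt(3)[OF *(1,2)] by simp
    qed
  qed
  note sq = AE_time_prob_fst[OF this]
  have "(\<integral>\<^sup>+ p. ennreal ((norm (w (fst p) (snd p)))\<^sup>2) \<partial>time_prob M t0 t1)
      \<le> (\<integral>\<^sup>+ p. ennreal \<bar>c\<bar> * ennreal ((norm (u' (fst p) (snd p)))\<^sup>2) \<partial>time_prob M t0 t1)"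
  proof (rule nn_integral_mono_AE, use sq in eventually_elim)
    case (elim p)
    have "(norm (w (fst p) (snd p)))\<^sup>2 \<le> norm (P (fst p)) * (norm (u' (fst p) (snd p)))\<^sup>2"
      using norm_psd_sqrt[of "P (fst p)" "u' (fst p) (snd p)"] elim by (simp add: w_def)
    also have "\<dots> \<le> \<bar>c\<bar> * (norm (u' (fst p) (snd p)))\<^sup>2"
      using elim by (intro mult_right_mono) auto
    finally show ?case by (simp add: ennreal_leI flip: ennreal_mult)
  qed
  also have "\<dots> < \<infinity>"
    using u'(2,3) by (simp add: nn_integral_cmult ennreal_mult_less_top)
  finally have "(\<integral>\<^sup>+ p. ennreal ((norm (w (fst p) (snd p)))\<^sup>2) \<partial>time_prob M t0 t1) < \<infinity>" .
  moreover have "AE p in time_prob M t0 t1. psd_sqrt (P (fst p)) *v u (fst p) (snd p) = w (fst p) (snd p)"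
    using sq u'(4) by eventually_elim (simp add: w_def)
  ultimately show ?thesis
    using prog unfolding L2_process_def case_prod_unfold by blast
qed

text \<open>The diffusion coefficient \<open>z\<close> is the same in both systems, so the same
  \<open>I\<close> serves. In the hypothesis \<open>\<omega>\<close> is quantified inside, so the
  exceptional set of times is common to all paths and null sets need not be exchanged.\<close>

lemma sde_solution_drift_cong:
  fixes A K B H :: "real \<Rightarrow> real^'n^'n" and L :: "real \<Rightarrow> real^'k^'n" and J :: "real \<Rightarrow> real^'l^'n"
  assumes sol: "sde_solution M W A K L t0 t1 x0 z v x"
    and drift: "AE s in lborel. s \<in> {t0..t1} \<longrightarrow>
      (\<forall>\<omega>. B s *v x s \<omega> + H s *v z s \<omega> + J s *v w s \<omega> = A s *v x s \<omega> + K s *v z s \<omega> + L s *v v s \<omega>)"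
  shows "sde_solution M W B H J t0 t1 x0 z w x"
proof -
  let ?f = "\<lambda>s \<omega>. A s *v x s \<omega> + K s *v z s \<omega> + L s *v v s \<omega>"
  let ?g = "\<lambda>s \<omega>. B s *v x s \<omega> + H s *v z s \<omega> + J s *v w s \<omega>"
  obtain I where I: "has_ito_integral M W t0 t1 z I"
    "AE \<omega> in M. \<forall>t\<in>{t0..t1}. x t \<omega> = x0 \<omega> + (LINT s:{t0..t}|lebesgue. ?f s \<omega>) + I t \<omega>"
    using sol unfolding sde_solution_def by blast
  have int: "AE \<omega> in M. set_integrable lebesgue {t0..t1} (\<lambda>s. ?f s \<omega>)"
    using sol unfolding sde_solution_def by blast
  have ae: "AE s in lborel. s \<in> {t0..t} \<longrightarrow> ?g s \<omega> = ?f s \<omega>" if "t \<le> t1" for t \<omega>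
    using drift by eventually_elim (use that in auto)
  have "AE \<omega> in M. set_integrable lebesgue {t0..t1} (\<lambda>s. ?g s \<omega>)"
    using int by eventually_elim (rule set_integral_lebesgue_cong_AE(1)[OF ae], auto)
  moreover have "AE \<omega> in M. \<forall>t\<in>{t0..t1}. x t \<omega> = x0 \<omega> + (LINT s:{t0..t}|lebesgue. ?g s \<omega>) + I t \<omega>"
    using int I(2)
  proof eventually_elim
    case (elim \<omega>)
    show ?case
    proof
      fix t assume t: "t \<in> {t0..t1}"
      have "set_integrable lebesgue {t0..t} (\<lambda>s. ?f s \<omega>)"
        by (rule set_integrable_subset[OF elim(1)]) (use t in auto)
      from set_integral_lebesgue_cong_AE(2)[OF ae this] elim(2) t
      show "x t \<omega> = x0 \<omega> + (LINT s:{t0..t}|lebesgue. ?g s \<omega>) + I t \<omega>" by simp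
    qed
  qed
  ultimately show ?thesis
    using sol I(1) unfolding sde_solution_def by blast
qed

end

theorem proposition5p2:
  fixes M :: "'a measure" and W :: "real \<Rightarrow> 'a \<Rightarrow> real"
    and T t0 t1 \<delta> :: real
    and A K Q R \<Sigma> :: "real \<Rightarrow> real^'n^'n" and L :: "real \<Rightarrow> real^'k^'n"
    and N :: "real \<Rightarrow> real^'k^'k" and G :: "real^'n^'n"
    and x0 x1 :: "'a \<Rightarrow> real^'n"
    and z x :: "real \<Rightarrow> 'a \<Rightarrow> real^'n" and v :: "real \<Rightarrow> 'a \<Rightarrow> real^'k"
  assumes "brownian_space M W"
    and "A \<in> borel_measurable (lebesgue_on {0..T})" "bounded (A ` {0..T})"
    and "K \<in> borel_measurable (lebesgue_on {0..T})" "bounded (K ` {0..T})"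
    and "L \<in> borel_measurable (lebesgue_on {0..T})" "bounded (L ` {0..T})"
    and "Q \<in> borel_measurable (lebesgue_on {0..T})" "bounded (Q ` {0..T})"
    and "R \<in> borel_measurable (lebesgue_on {0..T})" "bounded (R ` {0..T})"
    and "N \<in> borel_measurable (lebesgue_on {0..T})" "bounded (N ` {0..T})"
    and "\<forall>s\<in>{0..T}. transpose (Q s) = Q s \<and> transpose (R s) = R s \<and> transpose (N s) = N s"
    and "transpose G = G" "psd G"
    and "AE s in lebesgue_on {0..T}. psd (Q s)"
    and "AE s in lebesgue_on {0..T}. psd (R s)"
    and "\<delta> > 0" "AE s in lebesgue_on {0..T}. psd (N s - \<delta> *\<^sub>R mat 1)"
    and "riccati_solution T A K L Q R N \<Sigma>"
    and "0 \<le> t0" "t0 < t1" "t1 \<le> T"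
    and "x0 \<in> L2_rv M (aug_filtration M W t0)"
    and "x1 \<in> L2_rv M (aug_filtration M W t1)"
    and "z \<in> L2_process M (aug_filtration M W) t0 t1"
    and "v \<in> L2_process M (aug_filtration M W) t0 t1"
    and "sde_solution M W A K L t0 t1 x0 z v x"
  shows "transfers M W A K L z v (t0, x0) (t1, x1) \<longleftrightarrow>
    transfers M W (A_hat A Q \<Sigma>) (K_hat K R \<Sigma>) (L_hat K L Q R N \<Sigma>)
      z (v_hat Q R N x z v) (t0, x0) (t1, x1)"
proof -
  interpret brownian_space M W by fact
  note t = \<open>0 \<le> t0\<close> \<open>t0 < t1\<close> and z = assms(27) and v = assms(28) and sol = assms(29)
  have sub: "{t0..t1} \<subseteq> {0..T}" using t \<open>t1 \<le> T\<close> by auto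
  obtain c where c: "c > 0" "\<And>s. s \<in> {0..T} \<Longrightarrow> norm (A s) \<le> c \<and> norm (K s) \<le> c \<and> norm (L s) \<le> c
      \<and> norm (Q s) < c \<and> norm (R s) < c \<and> norm (N s) < c \<and> norm (\<Sigma> s) \<le> c"
  proof -
    have "compact (\<Sigma> ` {0..T})"
      using \<open>riccati_solution T A K L Q R N \<Sigma>\<close>
      by (intro compact_continuous_image) (auto simp: riccati_solution_def Let_def)
    then have "bounded (\<Sigma> ` {0..T})" by (rule compact_imp_bounded)
    then obtain a k l q r n m where
      "\<forall>s\<in>{0..T}. norm (A s) \<le> a" "\<forall>s\<in>{0..T}. norm (K s) \<le> k" "\<forall>s\<in>{0..T}. norm (L s) \<le> l"
      "\<forall>s\<in>{0..T}. norm (Q s) \<le> q" "\<forall>s\<in>{0..T}. norm (R s) \<le> r" "\<forall>s\<in>{0..T}. norm (N s) \<le> n"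
      "\<forall>s\<in>{0..T}. norm (\<Sigma> s) \<le> m"
      using assms(3,5,7,9,11,13) by (auto simp: bounded_iff)
    then have b: "norm (A s) \<le> a" "norm (K s) \<le> k" "norm (L s) \<le> l" "norm (Q s) \<le> q"
      "norm (R s) \<le> r" "norm (N s) \<le> n" "norm (\<Sigma> s) \<le> m" if "s \<in> {0..T}" for s
      using that by blast+
    \<comment> \<open>The summand 1 makes the constant positive and the bounds on \<open>Q\<close>,
      \<open>R\<close> and \<open>N\<close> strict, as the identification of their square roots with
      \<open>scaled_sqrt\<close> requires.\<close>
    let ?c = "\<bar>a\<bar> + \<bar>k\<bar> + \<bar>l\<bar> + \<bar>q\<bar> + \<bar>r\<bar> + \<bar>n\<bar> + \<bar>m\<bar> + 1"
    show thesis
    proof (rule that[of ?c])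
      fix s assume "s \<in> {0..T}"
      from b[OF this] show "norm (A s) \<le> ?c \<and> norm (K s) \<le> ?c \<and> norm (L s) \<le> ?c
          \<and> norm (Q s) < ?c \<and> norm (R s) < ?c \<and> norm (N s) < ?c \<and> norm (\<Sigma> s) \<le> ?c"
        by (intro conjI; linarith)
    qed linarith
  qed
  have \<Sigma>: "psd (\<Sigma> s)" if "s \<in> {0..T}" for s
    using \<open>riccati_solution T A K L Q R N \<Sigma>\<close> that unfolding riccati_solution_def Let_def by blast
  have psdQ: "AE s in lborel. s \<in> {0..T} \<longrightarrow> psd (Q s)"
    and psdR: "AE s in lborel. s \<in> {0..T} \<longrightarrow> psd (R s)"
    and psdN: "AE s in lborel. s \<in> {0..T} \<longrightarrow> psd (N s - \<delta> *\<^sub>R mat 1)"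
    using assms(17,18,20) by (simp_all only: AE_lebesgue_on_iff)
  have psdN': "AE s in lborel. s \<in> {0..T} \<longrightarrow> psd (N s)"
    using psdN by eventually_elim (use psd_of_psd_diff \<open>\<delta> > 0\<close> in \<open>blast intro: less_imp_le\<close>)
  let ?v = "v_hat Q R N x z v"
  have v_hat: "?v \<in> L2_process M F t0 t1"
  proof -
    note sq = L2_process_psd_sqrt_mult[where S = "{0..T}" and c = c, OF _ _ sub _ _ _ less_imp_le[OF t(2)]]
    \<comment> \<open>The middle block of the control contains the state, so this is where the
      energy estimate enters.\<close>
    have x: "x \<in> L2_process M F t0 t1"
      by (rule sde_solution_L2[OF sol _ _ _ t c(1)])
        (use assms c(2) sub in auto)
    have "(\<lambda>s \<omega>. psd_sqrt (N s) *v v s \<omega>) \<in> L2_process M F t0 t1"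
      by (rule sq) (use assms(12) v c(2) psdN' sub in auto)
    moreover have "(\<lambda>s \<omega>. psd_sqrt (Q s) *v x s \<omega>) \<in> L2_process M F t0 t1"
      by (rule sq) (use assms(8) x c(2) psdQ sub in auto)
    moreover have "(\<lambda>s \<omega>. psd_sqrt (R s) *v z s \<omega>) \<in> L2_process M F t0 t1"
      by (rule sq) (use assms(10) z c(2) psdR sub in auto)
    ultimately show ?thesis
      unfolding v_hat_def[abs_def] using t by (intro L2_process_vec_append) auto
  qed
  have "AE s in lborel. s \<in> {t0..t1} \<longrightarrow>
      (\<forall>\<omega>. A_hat A Q \<Sigma> s *v x s \<omega> + K_hat K R \<Sigma> s *v z s \<omega> + L_hat K L Q R N \<Sigma> s *v ?v s \<omega>
        = A s *v x s \<omega> + K s *v z s \<omega> + L s *v v s \<omega>)"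
    using psdQ psdR psdN
  proof eventually_elim
    case (elim s)
    show ?case
    proof (intro impI allI)
      fix \<omega> assume "s \<in> {t0..t1}"
      then have "s \<in> {0..T}" using sub by blast
      with elim \<Sigma> show "A_hat A Q \<Sigma> s *v x s \<omega> + K_hat K R \<Sigma> s *v z s \<omega> + L_hat K L Q R N \<Sigma> s *v ?v s \<omega>
          = A s *v x s \<omega> + K s *v z s \<omega> + L s *v v s \<omega>"
        by (intro drift_hat_eq[OF _ _ _ _ \<open>\<delta> > 0\<close>]) blast+
    qed
  qed
  then have x_hat: "sde_solution M W (A_hat A Q \<Sigma>) (K_hat K R \<Sigma>) (L_hat K L Q R N \<Sigma>) t0 t1 x0 z ?v x"
    by (rule sde_solution_drift_cong[OF sol])
  have A_bound: "norm (A s *v w) \<le> c * norm w" if "s \<in> {t0..t1}" for s w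
    using norm_matrix_vector_le[of "A s" w] c(2)[of s] sub that
    by (meson mult_right_mono norm_ge_zero order_trans subsetD)
  \<comment> \<open>The summand \<open>c\<close> bounds \<open>A\<close>, and \<open>c * c\<close>
    bounds the product of \<open>\<Sigma>\<close> and \<open>Q\<close>.\<close>
  have A_hat_bound: "norm (A_hat A Q \<Sigma> s *v w) \<le> (c + c * c) * norm w" if s: "s \<in> {t0..t1}" for s w
  proof -
    have "norm (\<Sigma> s *v (Q s *v w)) \<le> norm (\<Sigma> s) * (norm (Q s) * norm w)"
      by (rule order_trans[OF norm_matrix_vector_le mult_left_mono[OF norm_matrix_vector_le]]) simp
    also have "\<dots> \<le> c * (c * norm w)"
      using c(1) c(2)[of s] sub s by (intro mult_mono) auto
    finally have "norm (A s *v w + \<Sigma> s *v (Q s *v w)) \<le> c * norm w + c * (c * norm w)"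
      by (intro norm_triangle_le add_mono A_bound s)
    then show ?thesis
      by (simp add: A_hat_def matrix_vector_mult_add_rdistrib matrix_vector_mul_assoc algebra_simps)
  qed
  \<comment> \<open>Uniqueness replaces the existential over solutions in \<open>transfers\<close>
    by the given \<open>x\<close>. The control dimension is left general, since the two systems have
    controls of different types.\<close>
  have end_eq: "(\<exists>y. sde_solution M W B H J t0 t1 x0 z w y \<and> (AE \<omega> in M. y t1 \<omega> = x1 \<omega>))
      \<longleftrightarrow> (AE \<omega> in M. x t1 \<omega> = x1 \<omega>)"
    if x: "sde_solution M W B H J t0 t1 x0 z w x"
      and b: "\<And>s u. s \<in> {t0..t1} \<Longrightarrow> norm (B s *v u) \<le> b * norm u" "0 \<le> b"
    for B H and J :: "real \<Rightarrow> real^'l^'n" and w :: "real \<Rightarrow> 'a \<Rightarrow> real^'l" and b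
  proof
    assume "\<exists>y. sde_solution M W B H J t0 t1 x0 z w y \<and> (AE \<omega> in M. y t1 \<omega> = x1 \<omega>)"
    then obtain y where y: "sde_solution M W B H J t0 t1 x0 z w y" "AE \<omega> in M. y t1 \<omega> = x1 \<omega>"
      by blast
    have "AE \<omega> in M. \<forall>t\<in>{t0..t1}. x t \<omega> = y t \<omega>"
      by (rule sde_solution_unique[OF x y(1) z t b])
    with y(2) show "AE \<omega> in M. x t1 \<omega> = x1 \<omega>"
      by eventually_elim (use t in auto)
  qed (use x in blast)
  have "transfers M W A K L z v (t0, x0) (t1, x1) \<longleftrightarrow> (AE \<omega> in M. x t1 \<omega> = x1 \<omega>)"
    unfolding transfers_def using z v end_eq[OF sol A_bound] c(1) by simp
  moreover have "transfers M W (A_hat A Q \<Sigma>) (K_hat K R \<Sigma>) (L_hat K L Q R N \<Sigma>) z ?v (t0, x0) (t1, x1)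
      \<longleftrightarrow> (AE \<omega> in M. x t1 \<omega> = x1 \<omega>)"
    unfolding transfers_def using z v_hat end_eq[OF x_hat A_hat_bound] c(1) by simp
  ultimately show ?thesis by blast
qed

end
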